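(* There is an absolute constant $\gamma>0$ such that the following holds. Let $p\in(1,\infty)$, $\alpha>1-1/p$ and $\beta\in\mathbb{R}$. Let $\sigma_j=j^{-\alpha}(\log(j+1))^{-\beta}$ for $1\le j\le N$, with associated $p$-ellipsoid $\mathcal{E}_p\subset\mathbb{R}^N$. Then for all $1\le n<N$, $$\mathbb{P}\left(\mathcal{R}_n(\mathcal{E}_p)\approx n^{1/2-1/p-\alpha}(\log(n+1))^{-\beta}\right)\ge\begin{cases}1-2e^{-\gamma n} & \text{if }p\le2,\\ 1-2e^{-\gamma p n^{2/p}} & \text{if }p>2.\end{cases}$$
   Context: $\mathcal{E}_p=\{x\in\mathbb{R}^N:\sum_{i=1}^N(|x_i|/\sigma_i)^p\le1\}$. The $n$-th random radius is $\mathcal{R}_n(\mathcal{E}_p)=\max_{y\in E_n\cap\mathcal{E}_p}|y|$, where $|\cdot|$ is the Euclidean norm and $E_n$ is a random $n$-codimensional linear subspace of $\mathbb{R}^N$ distributed according to the normalized Haar measure on the Grassmannian. $a\approx b$ means $C^{-1}b\le a\le Cb$ for a constant $C\ge1$ depending only on $p,\alpha,\beta$ (in particular independent of $n$ and $N$). *)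

theory Defs
  imports "HOL-Probability.Probability" "HOL-Library.Function_Algebras"
begin

text \<open>
  The dimension \<open>N\<close> is quantified inside the main statement, so \<open>\<real>\<^sup>N\<close> cannot be a type. It is
  realised as the set of sequences \<open>nat \<Rightarrow> real\<close> vanishing outside \<open>{1..N}\<close>, inside the
  vector space of all real sequences with pointwise operations; \<^const>\<open>subspace\<close>, \<^const>\<open>dim\<close>
  and \<^const>\<open>linear\<close> are then the library notions. The Euclidean norm is \<open>L2_set x {1..N}\<close>.
\<close>

instantiation "fun" :: (type, real_vector) real_vector
begin

definition scaleR_fun :: "real \<Rightarrow> ('a \<Rightarrow> 'b) \<Rightarrow> 'a \<Rightarrow> 'b"
  where "scaleR_fun c f = (\<lambda>x. c *\<^sub>R f x)"

instance
  by standard (auto simp: scaleR_fun_def fun_eq_iff scaleR_add_right scaleR_add_left)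

end

definition Rvec :: "nat \<Rightarrow> (nat \<Rightarrow> real) set"
  where "Rvec N = {x. \<forall>i. i \<notin> {1..N} \<longrightarrow> x i = 0}"

definition unit_vec :: "nat \<Rightarrow> nat \<Rightarrow> real"
  where "unit_vec j = (\<lambda>i. if i = j then 1 else 0)"

definition orthogonal_maps :: "nat \<Rightarrow> ((nat \<Rightarrow> real) \<Rightarrow> nat \<Rightarrow> real) set"
  where "orthogonal_maps N =
    {U. linear U \<and> (\<forall>x\<in>Rvec N. U x \<in> Rvec N \<and> L2_set (U x) {1..N} = L2_set x {1..N})}"

definition grassmannian :: "nat \<Rightarrow> nat \<Rightarrow> (nat \<Rightarrow> real) set set"
  where "grassmannian N n = {E. subspace E \<and> E \<subseteq> Rvec N \<and> dim E = N - n}"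

definition orth_proj :: "nat \<Rightarrow> (nat \<Rightarrow> real) set \<Rightarrow> (nat \<Rightarrow> real) \<Rightarrow> nat \<Rightarrow> real"
  where "orth_proj N E x = (THE y. y \<in> E \<and> (\<forall>z\<in>E. (\<Sum>i=1..N. (x i - y i) * z i) = 0))"

text \<open>
  The Grassmannian carries its usual topology, in which a subspace is identified with the matrix
  of the orthogonal projection onto it; \<open>grassmannian_borel\<close> is the Borel \<open>\<sigma>\<close>-algebra of that
  topology. (For \<open>j \<notin> {1..N}\<close> the \<open>j\<close>-th column is \<open>0\<close>.)
\<close>

definition grassmannian_borel :: "nat \<Rightarrow> nat \<Rightarrow> (nat \<Rightarrow> real) set measure"
  where "grassmannian_borel N n =
    vimage_algebra (grassmannian N n) (\<lambda>E j. orth_proj N E (unit_vec j)) borel"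

text \<open>
  The normalized Haar measure: the unique Borel probability measure on the Grassmannian that is
  invariant under the action of the orthogonal group.
\<close>

definition haar_grassmannian :: "nat \<Rightarrow> nat \<Rightarrow> (nat \<Rightarrow> real) set measure"
  where "haar_grassmannian N n =
    (THE M. sets M = sets (grassmannian_borel N n) \<and> prob_space M \<and>
            (\<forall>U\<in>orthogonal_maps N. distr M M (\<lambda>E. U ` E) = M))"

definition p_ellipsoid :: "nat \<Rightarrow> real \<Rightarrow> (nat \<Rightarrow> real) \<Rightarrow> (nat \<Rightarrow> real) set"
  where "p_ellipsoid N p \<sigma> = {x \<in> Rvec N. (\<Sum>i=1..N. (\<bar>x i\<bar> / \<sigma> i) powr p) \<le> 1}"

text \<open>
  The radius of the section \<open>E \<inter> K\<close>; for compact \<open>K\<close> containing \<open>0\<close> the supremum is a maximum.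
\<close>

definition section_radius :: "nat \<Rightarrow> (nat \<Rightarrow> real) set \<Rightarrow> (nat \<Rightarrow> real) set \<Rightarrow> real"
  where "section_radius N K E = (SUP y\<in>E \<inter> K. L2_set y {1..N})"

definition approx_const :: "real \<Rightarrow> real \<Rightarrow> real \<Rightarrow> bool"
  where "approx_const C a b \<longleftrightarrow> inverse C * b \<le> a \<and> a \<le> C * b"

definition semiaxes :: "real \<Rightarrow> real \<Rightarrow> nat \<Rightarrow> real"
  where "semiaxes \<alpha> \<beta> j = real j powr (- \<alpha>) * ln (real j + 1) powr (- \<beta>)"

end

theory Submission
  imports Defs
begin

text \<open>
  By uniqueness the Haar measure is the law of the kernel of an \<open>n\<close> by \<open>N\<close> Gaussian matrix \<open>G\<close>. Put
  \<open>\<tau> = \<sigma>\<^sub>n n powr - (1/p)\<close>. A vector \<open>x\<close> of the ellipsoid is split into \<open>a + b\<close>, where \<open>a\<close> consists of the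
  first \<open>\<eta> n\<close> coordinates and of those exceeding \<open>D \<tau>\<close>. The weights \<open>(D \<tau> / \<sigma>\<^sub>i) powr p\<close> grow so fast that
  there are at most \<open>exp (2 n)\<close> possible supports of \<open>a\<close>, each of size at most \<open>2 \<eta> n\<close>, whence \<open>G\<close> is bounded
  below by \<open>c sqrt n\<close> on all of them outside an event of probability \<open>exp (- n)\<close>. On the flat part, Young's
  inequality and an exponential moment bound give \<open>\<bar>G b\<bar> \<le> C \<tau> n\<close>, and this is where \<open>\<alpha> > 1 - 1/p\<close> is used.
  If \<open>G x = 0\<close>, then \<open>\<bar>a\<bar> \<le> C \<bar>G b\<bar> / sqrt n\<close>, so that \<open>\<bar>x\<bar> \<le> C \<tau> sqrt n\<close>.

  For the lower bound, \<open>ker G\<close> contains the kernel of the first \<open>n + 1\<close> columns, again by uniqueness a line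
  spanned by a Gaussian vector \<open>h\<close>, and it remains to compare the Euclidean norm and the \<open>p\<close>-norm of \<open>h\<close>.
  For \<open>p > 2\<close> the upper deviations of the \<open>p\<close>-norm limit the probability to \<open>1 - exp (- c p n powr (2/p))\<close>;
  the finitely many \<open>n\<close> with \<open>n < p n powr (2/p)\<close> are covered by the diameter of the ellipsoid.
\<close>

section \<open>Orthonormal systems\<close>


text \<open>\<open>haar_grassmannian\<close> is a definite description, so nothing is known about it
  before existence and uniqueness are: the Gaussian kernel supplies existence, and uniqueness
  identifies every other equivariant construction with it. Failure must be exponentially unlikely in
  n, but the dual sum of \<open>(\<rho>\<^sub>i * \<bar>g\<^sub>i\<bar>) powr q\<close> has no
  exponential moment once q > 2, that is p < 2. This is why large coordinates go to the sparse part: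
  under the cap D the summands grow only linearly in the Gaussian entry. The first coordinates go
  there as well, because \<open>\<sigma>\<^sub>i\<close> may exceed \<open>\<sigma>\<^sub>n\<close>
  by an unbounded factor. The price is a union bound over all supports. With the lower bound exp (-
  6) sqrt n for G, failure at one net point has probability at most exp (- 5 n), and the sparsity is
  then fixed by the size of the nets. Neither depends on p, so \<gamma> is absolute, while D and the
  radius may depend on p, \<alpha>, \<beta>. The assumption on \<alpha> says that the semiaxes are
  q-summable with room to spare; half of that room absorbs the logarithm.\<close>

definition ip :: "nat \<Rightarrow> (nat \<Rightarrow> real) \<Rightarrow> (nat \<Rightarrow> real) \<Rightarrow> real"
  where "ip N x y = (\<Sum>i=1..N. x i * y i)"

definition orthonormal :: "nat \<Rightarrow> (nat \<Rightarrow> real) set \<Rightarrow> bool"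
  where "orthonormal N B \<longleftrightarrow> finite B \<and> B \<subseteq> Rvec N \<and>
    (\<forall>b\<in>B. \<forall>c\<in>B. ip N b c = (if b = c then 1 else 0))"

definition proj :: "nat \<Rightarrow> (nat \<Rightarrow> real) set \<Rightarrow> (nat \<Rightarrow> real) \<Rightarrow> nat \<Rightarrow> real"
  where "proj N B x = (\<Sum>b\<in>B. ip N x b *\<^sub>R b)"

text \<open>Completeness is stated as reproduction by \<open>proj\<close>, the form in which it is
  used; \<open>onb_span\<close> translates it into the span.\<close>

definition onb :: "nat \<Rightarrow> (nat \<Rightarrow> real) set \<Rightarrow> (nat \<Rightarrow> real) set \<Rightarrow> bool"
  where "onb N E B \<longleftrightarrow> orthonormal N B \<and> B \<subseteq> E \<and> (\<forall>x\<in>E. proj N B x = x)"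

lemma sum_fun_apply: "(\<Sum>a\<in>A. f a) i = (\<Sum>a\<in>A. f a i)" for f :: "'a \<Rightarrow> 'b \<Rightarrow> 'c::comm_monoid_add"
  by (induction A rule: infinite_finite_induct) (auto simp: zero_fun_def plus_fun_def)

lemma scaleR_fun_apply [simp]: "(c *\<^sub>R f) i = c *\<^sub>R f i" for f :: "'a \<Rightarrow> 'b::real_vector"
  by (simp add: scaleR_fun_def)

lemma fun_apply_simps:
  "(f + g) i = f i + g i" "(f - g) i = f i - g i" "(0 :: 'a \<Rightarrow> 'b) i = 0" "(- f) i = - f i"
  for f g :: "'a \<Rightarrow> 'b::ab_group_add"
  by (simp_all add: plus_fun_def zero_fun_def fun_diff_def uminus_apply)

lemma proj_apply: "proj N B x i = (\<Sum>b\<in>B. ip N x b * b i)"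
  by (simp add: proj_def sum_fun_apply)

lemma ip_commute: "ip N x y = ip N y x"
  by (simp add: ip_def mult.commute)

lemma ip_add: "ip N (x + y) z = ip N x z + ip N y z" "ip N z (x + y) = ip N z x + ip N z y"
  by (simp_all add: ip_def fun_apply_simps algebra_simps sum.distrib)

lemma ip_diff: "ip N (x - y) z = ip N x z - ip N y z" "ip N z (x - y) = ip N z x - ip N z y"
  by (simp_all add: ip_def fun_apply_simps algebra_simps sum_subtractf)

lemma ip_scale: "ip N (c *\<^sub>R x) z = c * ip N x z" "ip N z (c *\<^sub>R x) = c * ip N z x"
  by (simp_all add: ip_def sum_distrib_left algebra_simps)

lemma ip_sum: "ip N (\<Sum>a\<in>A. f a) z = (\<Sum>a\<in>A. ip N (f a) z)" "ip N z (\<Sum>a\<in>A. f a) = (\<Sum>a\<in>A. ip N z (f a))"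
  unfolding ip_def sum_fun_apply sum_distrib_left sum_distrib_right by (rule sum.swap)+

lemma ip_zero [simp]: "ip N 0 z = 0" "ip N z 0 = 0"
  by (simp_all add: ip_def fun_apply_simps)

lemma ip_self: "ip N x x = (L2_set x {1..N})\<^sup>2"
  by (simp add: ip_def L2_set_def power2_eq_square sum_nonneg)

lemma ip_self_nonneg: "ip N x x \<ge> 0"
  by (simp add: ip_self)

lemma ip_self_eq_0: assumes "x \<in> Rvec N" "ip N x x = 0" shows "x = 0"
proof
  fix i
  have "(\<Sum>i=1..N. x i * x i) = 0" using assms(2) by (simp add: ip_def)
  hence *: "\<forall>i\<in>{1..N}. x i * x i = 0" by (subst (asm) sum_nonneg_eq_0_iff) auto
  show "x i = 0 i"
  proof (cases "i \<in> {1..N}")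
    case True thus ?thesis using * by (simp add: fun_apply_simps)
  next
    case False thus ?thesis using assms(1) unfolding Rvec_def fun_apply_simps by blast
  qed
qed

lemma subspace_Rvec: "subspace (Rvec N)"
  unfolding subspace_def by (auto simp: Rvec_def fun_apply_simps)

lemma ip_unit_vec: "j \<in> {1..N} \<Longrightarrow> ip N x (unit_vec j) = x j"
  "j \<in> {1..N} \<Longrightarrow> ip N (unit_vec j) x = x j"
  by (simp_all add: ip_def unit_vec_def if_distrib[of "\<lambda>c. c * _"] if_distrib[of "\<lambda>c. _ * c"] cong: if_cong)

lemma unit_vec_Rvec: "j \<in> {1..N} \<Longrightarrow> unit_vec j \<in> Rvec N"
  by (auto simp: Rvec_def unit_vec_def)

lemma Rvec_expand: "x \<in> Rvec N \<Longrightarrow> x = (\<Sum>j=1..N. x j *\<^sub>R unit_vec j)"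
proof
  fix i assume x: "x \<in> Rvec N"
  have "(\<Sum>j=1..N. x j *\<^sub>R unit_vec j) i = (\<Sum>j=1..N. if i = j then x j else 0)"
    by (subst sum_fun_apply, rule sum.cong) (auto simp: unit_vec_def)
  also have "\<dots> = x i"
  proof (cases "i \<in> {1..N}")
    case True thus ?thesis by simp
  next
    case False
    hence "x i = 0" using x unfolding Rvec_def by blast
    thus ?thesis using False by simp
  qed
  finally show "x i = (\<Sum>j=1..N. x j *\<^sub>R unit_vec j) i" by simp
qed

lemma parseval_unit_vec: "ip N x y = (\<Sum>j=1..N. ip N x (unit_vec j) * ip N y (unit_vec j))"
  unfolding ip_def[of N x y] by (rule sum.cong) (simp_all add: ip_unit_vec)

lemma orthonormal_ip: "orthonormal N B \<Longrightarrow> b \<in> B \<Longrightarrow> c \<in> B \<Longrightarrow> ip N b c = (if b = c then 1 else 0)"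
  by (simp add: orthonormal_def)

lemma orthonormal_finite: "orthonormal N B \<Longrightarrow> finite B"
  by (simp add: orthonormal_def)

lemma ip_proj: assumes "orthonormal N B" "b \<in> B" shows "ip N (proj N B x) b = ip N x b"
proof -
  have "ip N (proj N B x) b = (\<Sum>c\<in>B. if c = b then ip N x b else 0)"
    unfolding proj_def ip_sum ip_scale
    by (rule sum.cong) (use assms in \<open>auto simp: orthonormal_ip\<close>)
  thus ?thesis using assms by (simp add: orthonormal_finite)
qed

lemma ip_proj_left: "ip N (proj N B x) y = (\<Sum>b\<in>B. ip N x b * ip N b y)"
  unfolding proj_def ip_sum ip_scale by simp

lemma bessel_eq:
  assumes "orthonormal N B"
  shows "ip N (x - proj N B x) (x - proj N B x) = ip N x x - (\<Sum>b\<in>B. (ip N x b)\<^sup>2)"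
proof -
  have 1: "ip N (proj N B x) x = (\<Sum>b\<in>B. (ip N x b)\<^sup>2)"
    unfolding ip_proj_left by (simp add: power2_eq_square ip_commute)
  have 2: "ip N (proj N B x) (proj N B x) = (\<Sum>b\<in>B. (ip N x b)\<^sup>2)"
    unfolding ip_proj_left by (rule sum.cong) (use assms in \<open>simp_all add: ip_proj power2_eq_square ip_commute[of N _ "proj N B x"]\<close>)
  show ?thesis unfolding ip_diff using 1 2 by (simp add: ip_commute)
qed

lemma bessel: assumes "orthonormal N B" shows "(\<Sum>b\<in>B. (ip N x b)\<^sup>2) \<le> ip N x x"
  using bessel_eq[OF assms, of x] ip_self_nonneg[of N "x - proj N B x"] by simp

text \<open>The trace of the projection, summed in two orders. Dimensions are compared through it,
  since the ambient space of all sequences is infinite-dimensional.\<close>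

lemma card_eq_trace:
  assumes "orthonormal N B" shows "real (card B) = (\<Sum>j=1..N. \<Sum>b\<in>B. (ip N (unit_vec j) b)\<^sup>2)"
proof -
  have "(\<Sum>j=1..N. \<Sum>b\<in>B. (ip N (unit_vec j) b)\<^sup>2) = (\<Sum>b\<in>B. \<Sum>j=1..N. (ip N (unit_vec j) b)\<^sup>2)"
    by (rule sum.swap)
  also have "\<dots> = (\<Sum>b\<in>B. ip N b b)"
    by (rule sum.cong[OF refl], subst parseval_unit_vec) (simp add: power2_eq_square ip_commute)
  also have "\<dots> = (\<Sum>b\<in>B. 1)" by (rule sum.cong) (use assms in \<open>auto simp: orthonormal_ip\<close>)
  finally show ?thesis by simp
qed

lemma orthonormal_card_le: assumes "orthonormal N B" shows "card B \<le> N"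
proof -
  have "real (card B) \<le> (\<Sum>j=1..N. ip N (unit_vec j) (unit_vec j))"
    unfolding card_eq_trace[OF assms] by (rule sum_mono) (rule bessel[OF assms])
  also have "\<dots> = (\<Sum>j=1..N. 1)" by (rule sum.cong) (auto simp: ip_unit_vec(1), auto simp: unit_vec_def)
  finally show ?thesis by simp
qed

lemma proj_in_subspace: "subspace E \<Longrightarrow> B \<subseteq> E \<Longrightarrow> proj N B x \<in> E"
  unfolding proj_def by (rule subspace_sum) (auto intro: subspace_scale)

lemma orthonormal_insert:
  assumes "orthonormal N B" "x \<in> Rvec N" "r = x - proj N B x" "r \<noteq> 0"
  shows "orthonormal N (insert ((1 / sqrt (ip N r r)) *\<^sub>R r) B)"
    and "(1 / sqrt (ip N r r)) *\<^sub>R r \<notin> B"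
proof -
  let ?u = "(1 / sqrt (ip N r r)) *\<^sub>R r"
  have B: "B \<subseteq> Rvec N" using assms(1) by (simp add: orthonormal_def)
  have rR: "r \<in> Rvec N" unfolding assms(3)
    by (intro subspace_diff subspace_Rvec assms proj_in_subspace B)
  have pos: "ip N r r > 0" using ip_self_eq_0[OF rR] assms(4) ip_self_nonneg[of N r] by force
  have u: "ip N ?u ?u = 1" unfolding ip_scale using pos by (simp add: field_simps)
  have orth: "ip N ?u b = 0" if "b \<in> B" for b
    unfolding ip_scale assms(3) ip_diff using ip_proj[OF assms(1) that] by simp
  have uR: "?u \<in> Rvec N" by (intro subspace_scale subspace_Rvec rR)
  show "?u \<notin> B" using u orth by fastforce
  show "orthonormal N (insert ?u B)"
    using assms(1) uR u orth orth[unfolded ip_commute[of N ?u]] unfolding orthonormal_def by auto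
qed

text \<open>An orthonormal system in \<open>E\<close> of maximal cardinality is complete: otherwise
  the normalized residual of a missed vector enlarges it. The trace bound
  \<open>card B \<le> N\<close> provides the maximum.\<close>

lemma onb_extend:
  assumes E: "subspace E" "E \<subseteq> Rvec N" and B0: "orthonormal N B0" "B0 \<subseteq> E"
  shows "\<exists>B. onb N E B \<and> B0 \<subseteq> B"
proof -
  define P where "P B \<longleftrightarrow> orthonormal N B \<and> B0 \<subseteq> B \<and> B \<subseteq> E" for B
  have "\<exists>B. P B \<and> (\<forall>C. P C \<longrightarrow> card C \<le> card B)"
    by (rule ex_has_greatest_nat[where k = B0 and b = "Suc N"])
       (use B0 in \<open>auto simp: P_def orthonormal_card_le le_imp_less_Suc\<close>)
  then obtain B where B: "P B" "\<And>C. P C \<Longrightarrow> card C \<le> card B" by blast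
  have "proj N B x = x" if x: "x \<in> E" for x
  proof (rule ccontr)
    assume ne: "proj N B x \<noteq> x"
    define r where "r = x - proj N B x"
    have r0: "r \<noteq> 0" using ne by (simp add: r_def)
    note ins = orthonormal_insert[OF _ _ r_def r0]
    let ?u = "(1 / sqrt (ip N r r)) *\<^sub>R r"
    have rE: "?u \<in> E" unfolding r_def using B(1) x E
      by (intro subspace_scale subspace_diff proj_in_subspace) (auto simp: P_def)
    have "P (insert ?u B)" using ins(1) B(1) rE x E(2) by (auto simp: P_def)
    moreover have "card (insert ?u B) = Suc (card B)"
      using ins(2) B(1) x E(2) by (subst card_insert_disjoint) (auto simp: P_def orthonormal_finite)
    ultimately show False using B(2)[of "insert ?u B"] by simp
  qed
  thus ?thesis using B(1) by (auto simp: P_def onb_def)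
qed

lemma onb_exists: "subspace E \<Longrightarrow> E \<subseteq> Rvec N \<Longrightarrow> \<exists>B. onb N E B"
  using onb_extend[of E N "{}"] by (auto simp: orthonormal_def)

lemma orthonormal_independent: assumes "orthonormal N B" shows "independent B"
proof -
  have "u c = 0" if "(\<Sum>v\<in>B. u v *\<^sub>R v) = 0" "c \<in> B" for u c
  proof -
    have "0 = ip N (\<Sum>v\<in>B. u v *\<^sub>R v) c" using that by simp
    also have "\<dots> = (\<Sum>v\<in>B. if v = c then u c else 0)"
      unfolding ip_sum ip_scale by (rule sum.cong) (use assms that in \<open>auto simp: orthonormal_ip\<close>)
    also have "\<dots> = u c" using assms that by (simp add: orthonormal_finite)
    finally show ?thesis by simp
  qed
  thus ?thesis using assms by (subst dependent_finite) (auto simp: orthonormal_finite)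
qed

lemma onb_span:
  assumes "subspace E" "onb N E B" shows "span B = E"
proof
  show "span B \<subseteq> E" by (rule span_minimal) (use assms in \<open>auto simp: onb_def\<close>)
  show "E \<subseteq> span B"
  proof
    fix x assume "x \<in> E"
    hence "x = proj N B x" using assms by (auto simp: onb_def)
    also have "\<dots> \<in> span B" unfolding proj_def by (intro span_sum span_scale span_base)
    finally show "x \<in> span B" .
  qed
qed

lemma dim_orthonormal:
  assumes "subspace E" "onb N E B" shows "dim E = card B"
proof (rule dim_eq_card)
  show "span B = span E" using onb_span[OF assms] assms(1) by (metis span_eq_iff)
  show "independent B" using assms by (auto simp: onb_def orthonormal_independent)
qed

text \<open>The residual is orthogonal to \<open>E\<close>, and two candidates differ by a vector of
  \<open>E\<close> orthogonal to itself. From here on \<open>orth_proj\<close> is a finite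
  sum.\<close>

lemma orth_proj_eq_proj:
  assumes E: "subspace E" "E \<subseteq> Rvec N" and B: "onb N E B"
  shows "orth_proj N E x = proj N B x"
  unfolding orth_proj_def
proof (rule the_equality)
  have oB: "orthonormal N B" using B by (simp add: onb_def)
  have ipeq: "(\<Sum>i=1..N. (x i - y i) * z i) = ip N (x - y) z" for x y z
    by (simp add: ip_def fun_apply_simps)
  have orth: "ip N (x - proj N B x) z = 0" if "z \<in> E" for z
  proof -
    have "z = proj N B z" using that B by (simp add: onb_def)
    hence "ip N (x - proj N B x) z = ip N (x - proj N B x) (proj N B z)" by simp
    also have "\<dots> = 0" unfolding proj_def[of N B z] ip_sum ip_scale ip_diff
      by (rule sum.neutral) (simp add: ip_proj[OF oB])
    finally show ?thesis .
  qed
  show "proj N B x \<in> E \<and> (\<forall>z\<in>E. (\<Sum>i = 1..N. (x i - proj N B x i) * z i) = 0)"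
    unfolding ipeq using orth E B by (auto intro: proj_in_subspace simp: onb_def)
  fix y assume "y \<in> E \<and> (\<forall>z\<in>E. (\<Sum>i = 1..N. (x i - y i) * z i) = 0)"
  hence y: "y \<in> E" "\<And>z. z \<in> E \<Longrightarrow> ip N (x - y) z = 0" unfolding ipeq by auto
  have d: "y - proj N B x \<in> E" using y E B by (auto intro: subspace_diff proj_in_subspace simp: onb_def)
  have "ip N (y - proj N B x) (y - proj N B x) = ip N (x - proj N B x) (y - proj N B x) - ip N (x - y) (y - proj N B x)"
    by (simp add: ip_diff)
  also have "\<dots> = 0" using orth y d by simp
  finally have "y - proj N B x = 0" using d E by (intro ip_self_eq_0) auto
  thus "y = proj N B x" by simp
qed

lemma onb_Rvec_card: assumes "onb N (Rvec N) B" shows "card B = N"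
proof -
  have oB: "orthonormal N B" using assms by (simp add: onb_def)
  have "real (card B) = (\<Sum>j=1..N. \<Sum>b\<in>B. (ip N (unit_vec j) b)\<^sup>2)" by (rule card_eq_trace[OF oB])
  also have "\<dots> = (\<Sum>j=1..N. 1)"
  proof (rule sum.cong[OF refl])
    fix j assume j: "j \<in> {1..N}"
    have "unit_vec j - proj N B (unit_vec j) = 0" using assms unit_vec_Rvec[OF j] by (simp add: onb_def)
    hence "0 = ip N (unit_vec j) (unit_vec j) - (\<Sum>b\<in>B. (ip N (unit_vec j) b)\<^sup>2)"
      using bessel_eq[OF oB, of "unit_vec j"] by simp
    moreover have "ip N (unit_vec j) (unit_vec j) = 1" using j by (simp add: ip_unit_vec(1)) (simp add: unit_vec_def)
    ultimately show "(\<Sum>b\<in>B. (ip N (unit_vec j) b)\<^sup>2) = 1" by simp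
  qed
  finally show ?thesis by simp
qed

section \<open>Orthogonal maps acting on the Grassmannian\<close>

lemma orthogonal_maps_ip:
  assumes U: "U \<in> orthogonal_maps N" and x: "x \<in> Rvec N" "y \<in> Rvec N"
  shows "ip N (U x) (U y) = ip N x y"
proof -
  have lin: "linear U" using U by (simp add: orthogonal_maps_def)
  have nrm: "ip N (U z) (U z) = ip N z z" if "z \<in> Rvec N" for z
    using U that by (simp add: orthogonal_maps_def ip_self)
  have pol: "ip N u v = (ip N (u + v) (u + v) - ip N u u - ip N v v) / 2" for u v
    by (simp add: ip_add ip_commute[of N v u])
  have "x + y \<in> Rvec N" using x by (intro subspace_add subspace_Rvec)
  thus ?thesis by (subst (1 2) pol) (simp add: nrm x linear_add[OF lin, symmetric])
qed

lemma orthonormal_image: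
  assumes U: "U \<in> orthogonal_maps N" and B: "orthonormal N B"
  shows "orthonormal N (U ` B)" "inj_on U B"
proof -
  have BR: "B \<subseteq> Rvec N" using B by (simp add: orthonormal_def)
  have ip: "ip N (U b) (U c) = (if b = c then 1 else 0)" if "b \<in> B" "c \<in> B" for b c
    using orthogonal_maps_ip[OF U subsetD[OF BR that(1)] subsetD[OF BR that(2)]] orthonormal_ip[OF B that] by simp
  show inj: "inj_on U B"
  proof
    fix b c assume bc: "b \<in> B" "c \<in> B" "U b = U c"
    have "ip N (U b) (U c) = 1" using ip[of b b] bc by simp
    thus "b = c" using ip[of b c] bc by (simp split: if_splits)
  qed
  show "orthonormal N (U ` B)"
    unfolding orthonormal_def using BR B U ip inj
    by (auto simp: orthonormal_def orthogonal_maps_def inj_on_eq_iff)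
qed

lemma linear_proj_image:
  assumes U: "U \<in> orthogonal_maps N" and B: "orthonormal N B" and x: "x \<in> Rvec N"
  shows "U (proj N B x) = proj N (U ` B) (U x)"
proof -
  have lin: "linear U" using U by (simp add: orthogonal_maps_def)
  have BR: "B \<subseteq> Rvec N" using B by (simp add: orthonormal_def)
  have "proj N (U ` B) (U x) = (\<Sum>b\<in>B. ip N (U x) (U b) *\<^sub>R U b)"
    unfolding proj_def by (rule sum.reindex[OF orthonormal_image(2)[OF U B], simplified o_def])
  also have "\<dots> = (\<Sum>b\<in>B. ip N x b *\<^sub>R U b)"
    by (rule sum.cong) (use BR x in \<open>auto simp: orthogonal_maps_ip[OF U]\<close>)
  also have "\<dots> = U (proj N B x)" unfolding proj_def by (simp add: linear_sum[OF lin] linear_scale[OF lin])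
  finally show ?thesis by simp
qed

lemma onb_image:
  assumes U: "U \<in> orthogonal_maps N" and E: "subspace E" "E \<subseteq> Rvec N" and B: "onb N E B"
  shows "onb N (U ` E) (U ` B)" "subspace (U ` E)" "U ` E \<subseteq> Rvec N"
proof -
  have lin: "linear U" using U by (simp add: orthogonal_maps_def)
  show "subspace (U ` E)" by (rule linear_subspace_image[OF lin E(1)])
  show "U ` E \<subseteq> Rvec N" using U E by (auto simp: orthogonal_maps_def)
  show "onb N (U ` E) (U ` B)" unfolding onb_def
    using orthonormal_image[OF U] B linear_proj_image[OF U, symmetric] E by (auto simp: onb_def)
qed

lemma grassmannianD:
  assumes "E \<in> grassmannian N n" shows "subspace E" "E \<subseteq> Rvec N" "dim E = N - n"
  using assms by (auto simp: grassmannian_def)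

lemma grassmannian_onb:
  assumes "E \<in> grassmannian N n" obtains B where "onb N E B" "card B = N - n"
  using onb_exists[of E N] dim_orthonormal[of E N] grassmannianD[OF assms] by metis

lemma grassmannian_image:
  assumes U: "U \<in> orthogonal_maps N" and E: "E \<in> grassmannian N n"
  shows "U ` E \<in> grassmannian N n"
proof -
  note E' = grassmannianD[OF E]
  obtain B where B: "onb N E B" "card B = N - n" by (rule grassmannian_onb[OF E])
  have "card (U ` B) = card B" using orthonormal_image[OF U] B by (intro card_image) (auto simp: onb_def)
  thus ?thesis using onb_image[OF U E'(1,2) B(1)] dim_orthonormal B by (auto simp: grassmannian_def)
qed

text \<open>Bases of \<open>E\<close> and \<open>F\<close> are extended to bases of the whole space
  and matched so that \<open>B\<close> goes to \<open>C\<close>; \<open>U\<close> is the linear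
  extension of this matching. Transitivity forces an invariant measure to give all balls of one
  radius the same mass.\<close>

lemma grassmannian_transitive:
  assumes E: "E \<in> grassmannian N n" and F: "F \<in> grassmannian N n"
  shows "\<exists>U\<in>orthogonal_maps N. U ` E = F"
proof -
  note E' = grassmannianD[OF E] and F' = grassmannianD[OF F]
  obtain B where B: "onb N E B" "card B = N - n" by (rule grassmannian_onb[OF E])
  obtain C where C: "onb N F C" "card C = N - n" by (rule grassmannian_onb[OF F])
  obtain B' where B': "onb N (Rvec N) B'" "B \<subseteq> B'"
    using onb_extend[OF subspace_Rvec order_refl, of N B] B E' by (auto simp: onb_def)
  obtain C' where C': "onb N (Rvec N) C'" "C \<subseteq> C'"
    using onb_extend[OF subspace_Rvec order_refl, of N C] C F' by (auto simp: onb_def)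
  have o: "orthonormal N B'" "orthonormal N C'" "orthonormal N B" "orthonormal N C" using B' C' B C by (auto simp: onb_def)
  note fin = o[THEN orthonormal_finite]
  have "card (B' - B) = card (C' - C)" using onb_Rvec_card[OF B'(1)] onb_Rvec_card[OF C'(1)] B C B' C' fin
    by (simp add: card_Diff_subset)
  then obtain f where f: "bij_betw f (B' - B) (C' - C)"
    using fin by (metis finite_Diff finite_same_card_bij)
  obtain g where g: "bij_betw g B C" using fin B C by (metis finite_same_card_bij)
  define h where "h b = (if b \<in> B then g b else f b)" for b
  have hB: "bij_betw h B C" using g by (rule bij_betw_cong[THEN iffD1, rotated]) (simp add: h_def)
  have hBc: "bij_betw h (B' - B) (C' - C)" using f by (rule bij_betw_cong[THEN iffD1, rotated]) (simp add: h_def)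
  have "bij_betw h (B \<union> (B' - B)) (C \<union> (C' - C))" by (rule bij_betw_combine[OF hB hBc]) auto
  hence h: "bij_betw h B' C'" using B' C' by (simp add: Un_absorb1)
  have hin: "h b \<in> C'" if "b \<in> B'" for b using h that by (auto simp: bij_betw_def)
  define U where "U x = (\<Sum>b\<in>B'. ip N x b *\<^sub>R h b)" for x
  have lin: "linear U"
    by (rule linearI) (simp_all add: U_def ip_add ip_scale scaleR_add_left sum.distrib scaleR_sum_right)
  have UR: "U x \<in> Rvec N" for x unfolding U_def
    using hin o(2) by (intro subspace_sum subspace_scale subspace_Rvec) (auto simp: orthonormal_def)
  \<comment> \<open>Valid for every sequence, as both sides see \<open>x\<close> only through its
    inner products with \<open>B'\<close>; the norm of \<open>x\<close> enters on
    \<open>Rvec N\<close> alone, where \<open>B'\<close> is complete.\<close>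
  have ipU: "ip N (U x) (U x) = (\<Sum>b\<in>B'. (ip N x b)\<^sup>2)" for x
  proof -
    have "ip N (U x) (h b) = ip N x b" if b: "b \<in> B'" for b
    proof -
      have "ip N (U x) (h b) = (\<Sum>c\<in>B'. if c = b then ip N x b else 0)"
        unfolding U_def ip_sum ip_scale
      proof (rule sum.cong[OF refl])
        fix c assume c: "c \<in> B'"
        have "ip N (h c) (h b) = (if c = b then 1 else 0)"
          using orthonormal_ip[OF o(2) hin[OF c] hin[OF b]] h b c by (auto simp: bij_betw_def inj_on_eq_iff)
        thus "ip N x c * ip N (h c) (h b) = (if c = b then ip N x b else 0)" by simp
      qed
      thus ?thesis using b fin by simp
    qed
    hence "ip N (U x) (\<Sum>b\<in>B'. ip N x b *\<^sub>R h b) = (\<Sum>b\<in>B'. (ip N x b)\<^sup>2)"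
      unfolding ip_sum ip_scale by (simp add: power2_eq_square)
    thus ?thesis by (simp add: U_def)
  qed
  have "ip N (U x) (U x) = ip N x x" if "x \<in> Rvec N" for x
    unfolding ipU using bessel_eq[OF o(1), of x] B'(1) that by (simp add: onb_def)
  hence L2: "L2_set (U x) {1..N} = L2_set x {1..N}" if "x \<in> Rvec N" for x
    using that by (auto simp: ip_self L2_set_nonneg)
  have U: "U \<in> orthogonal_maps N" using lin UR L2 by (auto simp: orthogonal_maps_def)
  have Ub: "U b = h b" if "b \<in> B'" for b
  proof -
    have "U b = (\<Sum>c\<in>B'. if c = b then h b else 0)" unfolding U_def
      by (rule sum.cong) (use that in \<open>auto simp: orthonormal_ip[OF o(1)]\<close>)
    thus ?thesis using that fin by simp
  qed
  have "U ` B = C" using hB B' Ub by (auto simp: bij_betw_def image_def) (metis subsetD)+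
  moreover have "U ` E = span (U ` B)" unfolding onb_span[OF E'(1) B(1), symmetric] by (rule linear_span_image[OF lin, symmetric])
  moreover have "F = span C" by (rule onb_span[OF F'(1) C(1), symmetric])
  ultimately show ?thesis using U by blast
qed

section \<open>Uniqueness of the Haar measure\<close>


text \<open>
  Christensen's argument: by Fubini the two measures of a ball agree, and the proportion of the ball
  around \<open>x\<close> that lies in an open set \<open>V\<close> has integral \<open>emeasure M2 V\<close> and tends to \<open>1\<close> on \<open>V\<close>.
\<close>

lemma emeasure_le_of_uniform_balls:
  fixes d :: "'a \<Rightarrow> 'a \<Rightarrow> real"
  assumes M1: "prob_space M1" and M2: "prob_space M2" and sets: "sets M2 = sets M1"
    and meas: "(\<lambda>z. d (fst z) (snd z)) \<in> borel_measurable (M1 \<Otimes>\<^sub>M M1)"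
    and sym: "\<And>x y. d x y = d y x"
    and c1: "\<And>r x. r > 0 \<Longrightarrow> x \<in> space M1 \<Longrightarrow> emeasure M1 {y\<in>space M1. d x y < r} = c1 r"
    and c2: "\<And>r x. r > 0 \<Longrightarrow> x \<in> space M1 \<Longrightarrow> emeasure M2 {y\<in>space M1. d x y < r} = c2 r"
    and cover: "\<And>r. r > 0 \<Longrightarrow> \<exists>C. countable C \<and> C \<subseteq> space M1 \<and> (\<forall>x\<in>space M1. \<exists>y\<in>C. d y x < r)"
    and V: "V \<in> sets M1" and op: "\<And>x. x \<in> V \<Longrightarrow> \<exists>r>0. \<forall>y\<in>space M1. d x y < r \<longrightarrow> y \<in> V"
  shows "emeasure M1 V \<le> emeasure M2 V"
proof -
  interpret M1: prob_space M1 by fact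
  interpret M2: prob_space M2 by fact
  interpret P: pair_sigma_finite M1 M2 ..
  have sp: "space M2 = space M1" using sets by (rule sets_eq_imp_space_eq)
  have Msets: "sets (M1 \<Otimes>\<^sub>M M2) = sets (M1 \<Otimes>\<^sub>M M1)" using sets by (intro sets_pair_measure_cong) auto
  have meas12: "(\<lambda>z. d (fst z) (snd z)) \<in> borel_measurable (M1 \<Otimes>\<^sub>M M2)"
    using meas by (simp add: measurable_cong_sets[OF Msets refl])
  define B where "B x r = {y\<in>space M1. d x y < r}" for x r
  have Bmeas: "B x r \<in> sets M1" if "x \<in> space M1" for x r
  proof -
    have "(\<lambda>y. d (fst (x, y)) (snd (x, y))) \<in> borel_measurable M1"
      by (rule measurable_compose[OF _ meas]) (use that in auto)
    thus ?thesis unfolding B_def by auto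
  qed
  have kmeas: "(\<lambda>z. indicator A (snd z) * indicator {z. d (fst z) (snd z) < r} z :: ennreal) \<in> borel_measurable (M1 \<Otimes>\<^sub>M M2)"
    if A: "A \<in> sets M1" for A r
  proof -
    have [measurable]: "A \<in> sets M2" using A sets by simp
    have [measurable]: "{z \<in> space (M1 \<Otimes>\<^sub>M M2). d (fst z) (snd z) < r} \<in> sets (M1 \<Otimes>\<^sub>M M2)"
      using meas12 by measurable
    have "(\<lambda>z. indicator A (snd z) * indicator {z \<in> space (M1 \<Otimes>\<^sub>M M2). d (fst z) (snd z) < r} z :: ennreal) \<in> borel_measurable (M1 \<Otimes>\<^sub>M M2)"
      by measurable
    thus ?thesis by (rule measurable_cong[THEN iffD1, rotated]) (auto simp: indicator_def)
  qed
  have inner2: "(\<integral>\<^sup>+y. indicator A y * indicator {z. d (fst z) (snd z) < r} (x, y) \<partial>M2) = emeasure M2 (A \<inter> B x r)"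
    if A: "A \<in> sets M1" and x: "x \<in> space M1" for A x r
  proof -
    have "(\<integral>\<^sup>+y. indicator A y * indicator {z. d (fst z) (snd z) < r} (x, y) \<partial>M2) = (\<integral>\<^sup>+y. indicator (A \<inter> B x r) y \<partial>M2)"
      by (rule nn_integral_cong) (auto simp: indicator_def B_def sp)
    thus ?thesis using Bmeas[OF x] A sets by simp
  qed
  have inner1: "(\<integral>\<^sup>+x. indicator A y * indicator {z. d (fst z) (snd z) < r} (x, y) \<partial>M1) = indicator A y * c1 r"
    if y: "y \<in> space M1" and r: "r > 0" for A y r
  proof -
    have "(\<integral>\<^sup>+x. indicator A y * indicator {z. d (fst z) (snd z) < r} (x, y) \<partial>M1) = (\<integral>\<^sup>+x. indicator A y * indicator (B y r) x \<partial>M1)"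
      by (rule nn_integral_cong) (auto simp: indicator_def B_def sym)
    also have "\<dots> = indicator A y * c1 r" using Bmeas[OF y] c1[OF r y]
      by (simp add: nn_integral_cmult B_def)
    finally show ?thesis .
  qed
  have ballm: "(\<lambda>x. emeasure M2 (A \<inter> B x r)) \<in> borel_measurable M1" if A: "A \<in> sets M1" for A r
  proof -
    have "(\<lambda>x. \<integral>\<^sup>+y. indicator A y * indicator {z. d (fst z) (snd z) < r} (x, y) \<partial>M2) \<in> borel_measurable M1"
      using M2.borel_measurable_nn_integral[of "\<lambda>x y. indicator A y * indicator {z. d (fst z) (snd z) < r} (x, y)" M1] kmeas[OF A, of r]
      by (simp add: case_prod_beta')
    thus ?thesis by (rule measurable_cong[THEN iffD1, rotated]) (simp add: inner2[OF A])
  qed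
  have dbl: "(\<integral>\<^sup>+x. emeasure M2 (A \<inter> B x r) \<partial>M1) = c1 r * emeasure M2 A" if A: "A \<in> sets M1" and r: "r > 0" for A r
  proof -
    have "(\<integral>\<^sup>+x. emeasure M2 (A \<inter> B x r) \<partial>M1) = (\<integral>\<^sup>+x. \<integral>\<^sup>+y. indicator A y * indicator {z. d (fst z) (snd z) < r} (x, y) \<partial>M2 \<partial>M1)"
      by (rule nn_integral_cong) (simp add: inner2[OF A])
    also have "\<dots> = (\<integral>\<^sup>+y. \<integral>\<^sup>+x. indicator A y * indicator {z. d (fst z) (snd z) < r} (x, y) \<partial>M1 \<partial>M2)"
      using P.Fubini'[of "\<lambda>x y. indicator A y * indicator {z. d (fst z) (snd z) < r} (x, y)"] kmeas[OF A, of r]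
      by (simp add: case_prod_beta')
    also have "\<dots> = (\<integral>\<^sup>+y. indicator A y * c1 r \<partial>M2)"
      by (rule nn_integral_cong) (simp add: inner1 sp r)
    also have "\<dots> = c1 r * emeasure M2 A" using A sets by (subst nn_integral_multc) (simp_all add: mult.commute)
    finally show ?thesis .
  qed
  \<comment> \<open>Countably many balls of radius r cover the space, so they cannot all be null
    sets; \<open>f\<close> below divides by \<open>c2\<close>.\<close>
  have c2pos: "c2 r > 0" if r: "r > 0" for r
  proof -
    obtain C where C: "countable C" "C \<subseteq> space M1" "\<And>x. x \<in> space M1 \<Longrightarrow> \<exists>y\<in>C. d y x < r"
      using cover[OF r] by blast
    have "space M1 = (\<Union>y\<in>C. B y r)" using C by (auto simp: B_def) 
    hence "1 = emeasure M2 (\<Union>y\<in>C. B y r)" using M2.emeasure_space_1 sp by simp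
    moreover have "emeasure M2 (\<Union>y\<in>C. B y r) = 0" if "c2 r = 0"
    proof -
      have "(\<Union>y\<in>C. B y r) \<in> null_sets M2"
        by (rule null_sets_UN'[OF C(1)]) (use C(2) c2[OF r] that Bmeas sets in \<open>auto simp: null_sets_def B_def\<close>)
      thus ?thesis by auto
    qed
    ultimately show ?thesis by (metis not_gr_zero zero_neq_one)
  qed
  obtain x0 where x0: "x0 \<in> space M1" using M1.not_empty by blast
  have c2fin: "c2 r \<noteq> \<infinity>" if "r > 0" for r using c2[OF that x0] M2.emeasure_finite by (metis infinity_ennreal_def)
  \<comment> \<open>The double integral with the whole space in place of \<open>A\<close>.\<close>
  have c12: "c1 r = c2 r" if r: "r > 0" for r
  proof -
    have "c2 r = (\<integral>\<^sup>+x. c2 r \<partial>M1)" by (simp add: M1.emeasure_space_1)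
    also have "\<dots> = (\<integral>\<^sup>+x. emeasure M2 (space M1 \<inter> B x r) \<partial>M1)"
    proof (rule nn_integral_cong)
      fix x assume x: "x \<in> space M1"
      have "space M1 \<inter> B x r = {y\<in>space M1. d x y < r}" by (auto simp: B_def)
      thus "c2 r = emeasure M2 (space M1 \<inter> B x r)" using c2[OF r x] by simp
    qed
    also have "\<dots> = c1 r * emeasure M2 (space M1)" by (rule dbl[OF sets.top r])
    also have "\<dots> = c1 r" using M2.emeasure_space_1 sp by simp
    finally show ?thesis by simp
  qed
  define \<rho> where "\<rho> m = 1 / real (Suc m)" for m
  have \<rho>: "\<rho> m > 0" for m by (simp add: \<rho>_def)
  define f where "f m x = emeasure M2 (V \<inter> B x (\<rho> m)) / c2 (\<rho> m)" for m x
  have fm: "f m \<in> borel_measurable M1" for m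
    unfolding f_def using ballm[OF V] by measurable
  have fi: "(\<integral>\<^sup>+x. f m x \<partial>M1) = emeasure M2 V" for m
  proof -
    have "(\<integral>\<^sup>+x. f m x \<partial>M1) = (\<integral>\<^sup>+x. emeasure M2 (V \<inter> B x (\<rho> m)) \<partial>M1) / c2 (\<rho> m)"
      unfolding f_def by (rule nn_integral_divide[OF ballm[OF V]])
    also have "\<dots> = emeasure M2 V * (c2 (\<rho> m) / c2 (\<rho> m))"
      unfolding dbl[OF V \<rho>] c12[OF \<rho>] by (simp add: ennreal_times_divide mult.commute)
    also have "\<dots> = emeasure M2 V" using c2pos[OF \<rho>, of m] c2fin[OF \<rho>, of m]
      by (subst ennreal_divide_self) (auto simp: less_top)
    finally show ?thesis .
  qed
  have lim: "indicator V x \<le> liminf (\<lambda>m. f m x)" if x: "x \<in> space M1" for x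
  proof (cases "x \<in> V")
    case True
    then obtain r where r: "r > 0" "\<And>y. y \<in> space M1 \<Longrightarrow> d x y < r \<Longrightarrow> y \<in> V" using op by blast
    have "eventually (\<lambda>m. \<rho> m < r) sequentially"
      unfolding \<rho>_def using r(1) by (rule order_tendstoD(2)[OF LIMSEQ_Suc[OF lim_1_over_n]])
    hence "eventually (\<lambda>m. 1 \<le> f m x) sequentially"
    proof eventually_elim
      case (elim m)
      have "V \<inter> B x (\<rho> m) = B x (\<rho> m)" using r(2) elim by (auto simp: B_def)
      hence "f m x = c2 (\<rho> m) / c2 (\<rho> m)" unfolding f_def using c2[OF \<rho> x, of m] by (simp add: B_def)
      also have "\<dots> = 1" using c2pos[OF \<rho>, of m] c2fin[OF \<rho>, of m] by (subst ennreal_divide_self) (auto simp: less_top)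
      finally show ?case by simp
    qed
    hence "1 \<le> liminf (\<lambda>m. f m x)" by (rule Liminf_bounded)
    thus ?thesis using True by simp
  qed simp
  have "emeasure M1 V = (\<integral>\<^sup>+x. indicator V x \<partial>M1)" using V by simp
  also have "\<dots> \<le> (\<integral>\<^sup>+x. liminf (\<lambda>m. f m x) \<partial>M1)" by (rule nn_integral_mono) (rule lim)
  \<comment> \<open>Fatou's lemma. It gives one inequality; the other comes from exchanging the two
    measures.\<close>
  also have "\<dots> \<le> liminf (\<lambda>m. \<integral>\<^sup>+x. f m x \<partial>M1)" by (rule nn_integral_liminf[OF fm])
  also have "\<dots> = emeasure M2 V" unfolding fi by (simp add: Liminf_const)
  finally show ?thesis .
qed

section \<open>The Grassmannian seen through projection matrices\<close>

definition proj_entry :: "nat \<Rightarrow> (nat \<Rightarrow> real) set \<Rightarrow> nat \<Rightarrow> nat \<Rightarrow> real"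
  where "proj_entry N E i j = orth_proj N E (unit_vec j) i"

text \<open>The squared Hilbert-Schmidt distance of the projection matrices. Without the root the
  triangle inequality may fail, but the ball argument asks for symmetry, measurability and countable
  covers.\<close>

definition proj_dist :: "nat \<Rightarrow> (nat \<Rightarrow> real) set \<Rightarrow> (nat \<Rightarrow> real) set \<Rightarrow> real"
  where "proj_dist N E F = (\<Sum>i=1..N. \<Sum>j=1..N. (proj_entry N E i j - proj_entry N F i j)\<^sup>2)"

lemma space_grassmannian_borel [simp]: "space (grassmannian_borel N n) = grassmannian N n"
  by (simp add: grassmannian_borel_def)

lemma proj_entry_onb:
  assumes E: "subspace E" "E \<subseteq> Rvec N" "onb N E B"
  shows "proj_entry N E i j = (\<Sum>b\<in>B. b i * b j)"
proof (cases "j \<in> {1..N}")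
  case True
  thus ?thesis unfolding proj_entry_def orth_proj_eq_proj[OF E] proj_apply
    by (simp add: ip_unit_vec mult.commute)
next
  case False
  have "b j = 0" if "b \<in> B" for b
  proof -
    have "b \<in> Rvec N" using E that by (auto simp: onb_def)
    thus ?thesis using False unfolding Rvec_def by blast
  qed
  moreover have "ip N (unit_vec j) b = 0" for b using False unfolding ip_def unit_vec_def
    by (intro sum.neutral) auto
  ultimately show ?thesis unfolding proj_entry_def orth_proj_eq_proj[OF E] proj_apply
    by (simp add: sum.neutral)
qed

lemma proj_entry_outside:
  assumes "E \<in> grassmannian N n" "i \<notin> {1..N} \<or> j \<notin> {1..N}" shows "proj_entry N E i j = 0"
proof -
  note E = grassmannianD[OF assms(1)]
  obtain B where B: "onb N E B" by (rule grassmannian_onb[OF assms(1)])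
  have "b i * b j = 0" if "b \<in> B" for b
  proof -
    have "b \<in> Rvec N" using E B that by (auto simp: onb_def)
    thus ?thesis using assms(2) unfolding Rvec_def by auto
  qed
  thus ?thesis unfolding proj_entry_onb[OF E(1,2) B] by (intro sum.neutral) blast
qed

lemma proj_entry_measurable [measurable]:
  "(\<lambda>E. proj_entry N E i j) \<in> borel_measurable (grassmannian_borel N n)"
proof -
  have "(\<lambda>E j. orth_proj N E (unit_vec j)) \<in> grassmannian_borel N n \<rightarrow>\<^sub>M borel"
    unfolding grassmannian_borel_def by (rule measurable_vimage_algebra1) simp
  hence "(\<lambda>E. orth_proj N E (unit_vec j)) \<in> grassmannian_borel N n \<rightarrow>\<^sub>M borel"
    by (rule measurable_product_then_coordinatewise)
  hence "(\<lambda>E. orth_proj N E (unit_vec j) i) \<in> grassmannian_borel N n \<rightarrow>\<^sub>M borel"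
    by (rule measurable_product_then_coordinatewise)
  thus ?thesis by (simp add: proj_entry_def)
qed

text \<open>The generating map has infinitely many coordinates; those outside the N by N block
  vanish on the Grassmannian, so the entries of the block determine measurability.\<close>

lemma measurable_grassmannian_borelI:
  assumes "\<And>x. x \<in> space M \<Longrightarrow> f x \<in> grassmannian N n"
    and "\<And>i j. i \<in> {1..N} \<Longrightarrow> j \<in> {1..N} \<Longrightarrow> (\<lambda>x. proj_entry N (f x) i j) \<in> borel_measurable M"
  shows "f \<in> M \<rightarrow>\<^sub>M grassmannian_borel N n"
  unfolding grassmannian_borel_def
proof (rule measurable_vimage_algebra2)
  show "f \<in> space M \<rightarrow> grassmannian N n" using assms by auto
  have "(\<lambda>x. proj_entry N (f x) i j) \<in> borel_measurable M" for i j
  proof (cases "i \<in> {1..N} \<and> j \<in> {1..N}")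
    case False
    have "proj_entry N (f x) i j = 0" if "x \<in> space M" for x
      using proj_entry_outside[OF assms(1)[OF that]] False by blast
    hence "(\<lambda>x. 0 :: real) \<in> borel_measurable M \<longleftrightarrow> (\<lambda>x. proj_entry N (f x) i j) \<in> borel_measurable M"
      by (intro measurable_cong) simp
    thus ?thesis by simp
  qed (use assms in auto)
  thus "(\<lambda>x j. orth_proj N (f x) (unit_vec j)) \<in> borel_measurable M"
    unfolding proj_entry_def
    by (intro measurable_coordinatewise_then_product)
qed

text \<open>The projection onto the image is U P U^T. Its entries are linear in those of P, whence
  the action is measurable.\<close>

lemma proj_entry_image:
  assumes U: "U \<in> orthogonal_maps N" and E: "E \<in> grassmannian N n" and ij: "i \<in> {1..N}" "j \<in> {1..N}"
  shows "proj_entry N (U ` E) i j =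
    (\<Sum>k=1..N. \<Sum>l=1..N. U (unit_vec k) i * U (unit_vec l) j * proj_entry N E k l)"
proof -
  note E' = grassmannianD[OF E]
  obtain B where B: "onb N E B" by (rule grassmannian_onb[OF E])
  have oB: "orthonormal N B" "B \<subseteq> E" using B by (auto simp: onb_def)
  have lin: "linear U" using U by (simp add: orthogonal_maps_def)
  have Ub: "U b i = (\<Sum>k=1..N. b k * U (unit_vec k) i)" if "b \<in> B" for b i
  proof -
    have "b \<in> Rvec N" using that oB E' by auto
    hence "U b = U (\<Sum>k=1..N. b k *\<^sub>R unit_vec k)" using Rvec_expand by metis
    also have "\<dots> = (\<Sum>k=1..N. b k *\<^sub>R U (unit_vec k))" by (simp add: linear_sum[OF lin] linear_scale[OF lin])
    finally show ?thesis by (simp add: sum_fun_apply)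
  qed
  have "proj_entry N (U ` E) i j = (\<Sum>b\<in>U ` B. b i * b j)"
    by (rule proj_entry_onb) (use onb_image[OF U E'(1,2) B] in auto)
  also have "\<dots> = (\<Sum>b\<in>B. U b i * U b j)"
    using orthonormal_image[OF U oB(1)] by (simp add: sum.reindex)
  also have "\<dots> = (\<Sum>b\<in>B. \<Sum>k=1..N. \<Sum>l=1..N. U (unit_vec k) i * U (unit_vec l) j * (b k * b l))"
    by (rule sum.cong[OF refl]) (simp add: Ub sum_product algebra_simps)
  also have "\<dots> = (\<Sum>k=1..N. \<Sum>l=1..N. \<Sum>b\<in>B. U (unit_vec k) i * U (unit_vec l) j * (b k * b l))"
    by (subst sum.swap) (rule sum.cong[OF refl], rule sum.swap)
  also have "\<dots> = (\<Sum>k=1..N. \<Sum>l=1..N. U (unit_vec k) i * U (unit_vec l) j * proj_entry N E k l)"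
    unfolding proj_entry_onb[OF E'(1,2) B] sum_distrib_left ..
  finally show ?thesis .
qed

lemma image_measurable:
  assumes U: "U \<in> orthogonal_maps N"
  shows "(\<lambda>E. U ` E) \<in> grassmannian_borel N n \<rightarrow>\<^sub>M grassmannian_borel N n"
proof (rule measurable_grassmannian_borelI)
  fix i j assume ij: "i \<in> {1..N}" "j \<in> {1..N}"
  have "(\<lambda>E. \<Sum>k=1..N. \<Sum>l=1..N. U (unit_vec k) i * U (unit_vec l) j * proj_entry N E k l) \<in> borel_measurable (grassmannian_borel N n)"
    by measurable
  thus "(\<lambda>E. proj_entry N (U ` E) i j) \<in> borel_measurable (grassmannian_borel N n)"
    by (rule measurable_cong[THEN iffD1, rotated]) (use proj_entry_image[OF U _ ij] in auto)
qed (use grassmannian_image[OF U] in auto)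

text \<open>Expand the square: the projections P and Q both have trace N - n, and the trace of PQ is
  the double sum. In this form invariance under orthogonal maps is visible.\<close>

lemma proj_dist_onb:
  assumes E: "E \<in> grassmannian N n" "onb N E B" and F: "F \<in> grassmannian N n" "onb N F C"
  shows "proj_dist N E F = 2 * real (N - n) - 2 * (\<Sum>b\<in>B. \<Sum>c\<in>C. (ip N b c)\<^sup>2)"
proof -
  have cross: "(\<Sum>i=1..N. \<Sum>j=1..N. proj_entry N G i j * proj_entry N H i j) = (\<Sum>b\<in>B. \<Sum>c\<in>C. (ip N b c)\<^sup>2)"
    if G: "G \<in> grassmannian N n" "onb N G B" and H: "H \<in> grassmannian N n" "onb N H C" for G H B C
  proof -
    have "(\<Sum>i=1..N. \<Sum>j=1..N. proj_entry N G i j * proj_entry N H i j) =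
       (\<Sum>i=1..N. \<Sum>j=1..N. \<Sum>b\<in>B. \<Sum>c\<in>C. (b i * c i) * (b j * c j))"
      using proj_entry_onb[OF grassmannianD(1,2)[OF G(1)] G(2)] proj_entry_onb[OF grassmannianD(1,2)[OF H(1)] H(2)]
      by (simp add: sum_product algebra_simps)
    also have "\<dots> = (\<Sum>i=1..N. \<Sum>b\<in>B. \<Sum>j=1..N. \<Sum>c\<in>C. (b i * c i) * (b j * c j))"
      by (rule sum.cong[OF refl], rule sum.swap)
    also have "\<dots> = (\<Sum>b\<in>B. \<Sum>i=1..N. \<Sum>j=1..N. \<Sum>c\<in>C. (b i * c i) * (b j * c j))"
      by (rule sum.swap)
    also have "\<dots> = (\<Sum>b\<in>B. \<Sum>i=1..N. \<Sum>c\<in>C. \<Sum>j=1..N. (b i * c i) * (b j * c j))"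
      by (rule sum.cong[OF refl], rule sum.cong[OF refl], rule sum.swap)
    also have "\<dots> = (\<Sum>b\<in>B. \<Sum>c\<in>C. \<Sum>i=1..N. \<Sum>j=1..N. (b i * c i) * (b j * c j))"
      by (rule sum.cong[OF refl], rule sum.swap)
    also have "\<dots> = (\<Sum>b\<in>B. \<Sum>c\<in>C. (ip N b c)\<^sup>2)"
      by (simp add: ip_def power2_eq_square sum_product)
    finally show ?thesis .
  qed
  have self: "(\<Sum>b\<in>B. \<Sum>c\<in>B. (ip N b c)\<^sup>2) = real (N - n)" if G: "G \<in> grassmannian N n" "onb N G B" for G B
  proof -
    have o: "orthonormal N B" using G by (simp add: onb_def)
    have "(\<Sum>b\<in>B. \<Sum>c\<in>B. (ip N b c)\<^sup>2) = (\<Sum>b\<in>B. \<Sum>c\<in>B. if b = c then 1 else 0)"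
      by (intro sum.cong refl) (simp add: orthonormal_ip[OF o])
    also have "\<dots> = real (card B)" using orthonormal_finite[OF o] by simp
    also have "card B = N - n" using dim_orthonormal[OF _ G(2)] grassmannianD[OF G(1)] by simp
    finally show ?thesis .
  qed
  have "proj_dist N E F = (\<Sum>i=1..N. \<Sum>j=1..N. proj_entry N E i j * proj_entry N E i j)
      + (\<Sum>i=1..N. \<Sum>j=1..N. proj_entry N F i j * proj_entry N F i j)
      - 2 * (\<Sum>i=1..N. \<Sum>j=1..N. proj_entry N E i j * proj_entry N F i j)"
    unfolding proj_dist_def power2_eq_square
    by (simp add: algebra_simps sum.distrib sum_subtractf sum_distrib_left)
  thus ?thesis unfolding cross[OF E F] cross[OF E E] cross[OF F F] self[OF E] self[OF F] by simp
qed

lemma proj_dist_image: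
  assumes U: "U \<in> orthogonal_maps N" and E: "E \<in> grassmannian N n" and F: "F \<in> grassmannian N n"
  shows "proj_dist N (U ` E) (U ` F) = proj_dist N E F"
proof -
  obtain B where B: "onb N E B" by (rule grassmannian_onb[OF E])
  obtain C where C: "onb N F C" by (rule grassmannian_onb[OF F])
  have o: "orthonormal N B" "orthonormal N C" using B C by (auto simp: onb_def)
  have R: "B \<subseteq> Rvec N" "C \<subseteq> Rvec N" using o by (auto simp: orthonormal_def)
  have "(\<Sum>b\<in>U ` B. \<Sum>c\<in>U ` C. (ip N b c)\<^sup>2) = (\<Sum>b\<in>B. \<Sum>c\<in>C. (ip N (U b) (U c))\<^sup>2)"
    using orthonormal_image(2)[OF U] o by (simp add: sum.reindex)
  also have "\<dots> = (\<Sum>b\<in>B. \<Sum>c\<in>C. (ip N b c)\<^sup>2)"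
    by (intro sum.cong refl arg_cong[of _ _ "\<lambda>t. t\<^sup>2"] orthogonal_maps_ip[OF U] subsetD[OF R(1)] subsetD[OF R(2)])
  finally show ?thesis
    using proj_dist_onb[OF E B F C]
      proj_dist_onb[OF grassmannian_image[OF U E] onb_image(1)[OF U grassmannianD(1,2)[OF E] B]
        grassmannian_image[OF U F] onb_image(1)[OF U grassmannianD(1,2)[OF F] C]] by simp
qed

text \<open>Entries are rounded down to multiples of 1/K. There are countably many integer patterns,
  and one subspace is selected for each pattern that occurs.\<close>

lemma proj_dist_cover:
  assumes "r > 0"
  shows "\<exists>C. countable C \<and> C \<subseteq> grassmannian N n \<and> (\<forall>E\<in>grassmannian N n. \<exists>F\<in>C. proj_dist N F E < r)"
proof -
  define I where "I = {1..N} \<times> {1..N}"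
  \<comment> \<open>Two subspaces with the same pattern have distance at most N^2/K^2 \<le> N^2/K <
    r.\<close>
  obtain K :: nat where K: "real K > (real N)\<^sup>2 / r + 1" using reals_Archimedean2 by blast
  have K1: "real K > 1" using K assms by (smt (verit) divide_nonneg_pos zero_le_power2)
  define q where "q E = (\<lambda>z\<in>I. \<lfloor>real K * proj_entry N E (fst z) (snd z)\<rfloor>)" for E
  have cnt: "countable (q ` grassmannian N n)"
  proof (rule countable_subset)
    show "q ` grassmannian N n \<subseteq> I \<rightarrow>\<^sub>E UNIV" by (auto simp: q_def)
    show "countable (I \<rightarrow>\<^sub>E (UNIV :: int set))" by (rule countable_PiE) (auto simp: I_def)
  qed
  define h where "h c = (SOME E. E \<in> grassmannian N n \<and> q E = c)" for c
  have h: "h (q E) \<in> grassmannian N n" "q (h (q E)) = q E" if "E \<in> grassmannian N n" for E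
    using someI[of "\<lambda>F. F \<in> grassmannian N n \<and> q F = q E" E] that by (auto simp: h_def)
  have close: "proj_dist N F E < r" if "q F = q E" for E F
  proof -
    have "\<bar>proj_entry N F i j - proj_entry N E i j\<bar> \<le> 1 / K" if ij: "i \<in> {1..N}" "j \<in> {1..N}" for i j
    proof -
      have "\<lfloor>real K * proj_entry N F i j\<rfloor> = \<lfloor>real K * proj_entry N E i j\<rfloor>"
        using fun_cong[OF \<open>q F = q E\<close>, of "(i, j)"] ij by (simp add: q_def I_def)
      hence "\<bar>real K * proj_entry N F i j - real K * proj_entry N E i j\<bar> \<le> 1" by linarith
      hence "\<bar>real K * (proj_entry N F i j - proj_entry N E i j)\<bar> \<le> 1" by (simp only: right_diff_distrib)
      hence "real K * \<bar>proj_entry N F i j - proj_entry N E i j\<bar> \<le> 1" by (simp only: abs_mult abs_of_nat)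
      thus ?thesis using K1 by (simp add: pos_le_divide_eq mult.commute)
    qed
    hence "(proj_entry N F i j - proj_entry N E i j)\<^sup>2 \<le> (1 / K)\<^sup>2" if "i \<in> {1..N}" "j \<in> {1..N}" for i j
      using that by (subst abs_le_square_iff[symmetric]) auto
    hence "proj_dist N F E \<le> (\<Sum>i=1..N. \<Sum>j=1..N. (1 / K)\<^sup>2)"
      unfolding proj_dist_def by (intro sum_mono) auto
    also have "\<dots> = (real N)\<^sup>2 / (real K)\<^sup>2" by (simp add: power2_eq_square)
    also have "\<dots> \<le> (real N)\<^sup>2 / real K" using K1 by (intro divide_left_mono) (auto simp: power2_eq_square)
    also have "\<dots> < r" using K assms K1 by (simp add: field_simps)
    finally show ?thesis .
  qed
  show ?thesis
  proof (intro exI conjI ballI)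
    show "countable (h ` q ` grassmannian N n)" using cnt by (rule countable_image)
    show "h ` q ` grassmannian N n \<subseteq> grassmannian N n" using h by auto
    show "\<exists>F\<in>h ` q ` grassmannian N n. proj_dist N F E < r" if "E \<in> grassmannian N n" for E
      using h[OF that] close that by blast
  qed
qed

lemma proj_dist_measurable:
  assumes "sets M = sets (grassmannian_borel N n)" "sets M' = sets (grassmannian_borel N n)"
  shows "(\<lambda>z. proj_dist N (fst z) (snd z)) \<in> borel_measurable (M \<Otimes>\<^sub>M M')"
proof -
  have [measurable]: "(\<lambda>E. proj_entry N E i j) \<in> borel_measurable M" "(\<lambda>E. proj_entry N E i j) \<in> borel_measurable M'" for i j
    using assms by (simp_all add: measurable_cong_sets[OF assms(1) refl] measurable_cong_sets[OF assms(2) refl])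
  show ?thesis unfolding proj_dist_def by measurable
qed

lemma proj_dist_commute: "proj_dist N E F = proj_dist N F E"
  by (simp add: proj_dist_def power2_commute)

text \<open>A rotation taking \<open>E\<close> to \<open>F\<close> maps one ball onto the
  other.\<close>

lemma ball_const:
  assumes M: "sets M = sets (grassmannian_borel N n)" and inv: "\<And>U. U \<in> orthogonal_maps N \<Longrightarrow> distr M M (\<lambda>E. U ` E) = M"
    and E: "E \<in> grassmannian N n" and F: "F \<in> grassmannian N n"
  shows "emeasure M {G\<in>grassmannian N n. proj_dist N E G < r} = emeasure M {G\<in>grassmannian N n. proj_dist N F G < r}"
proof -
  have sp: "space M = grassmannian N n" using sets_eq_imp_space_eq[OF M] by simp
  obtain U where U: "U \<in> orthogonal_maps N" "U ` E = F" using grassmannian_transitive[OF E F] by blast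
  have ms: "{G\<in>grassmannian N n. proj_dist N F G < r} \<in> sets M"
  proof -
    have "(\<lambda>G. proj_dist N (fst (F, G)) (snd (F, G))) \<in> borel_measurable M"
      by (rule measurable_compose[OF _ proj_dist_measurable[OF M M]]) (use F sp in auto)
    thus ?thesis unfolding sp[symmetric] by auto
  qed
  have Um: "(\<lambda>E. U ` E) \<in> M \<rightarrow>\<^sub>M M" using image_measurable[OF U(1), of n] by (simp add: measurable_cong_sets[OF M M])
  have "emeasure M {G\<in>grassmannian N n. proj_dist N F G < r} = emeasure (distr M M (\<lambda>E. U ` E)) {G\<in>grassmannian N n. proj_dist N F G < r}"
    by (simp add: inv[OF U(1)])
  also have "\<dots> = emeasure M ((\<lambda>E. U ` E) -` {G\<in>grassmannian N n. proj_dist N F G < r} \<inter> space M)"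
    by (rule emeasure_distr[OF Um ms])
  also have "(\<lambda>E. U ` E) -` {G\<in>grassmannian N n. proj_dist N F G < r} \<inter> space M = {G\<in>grassmannian N n. proj_dist N E G < r}"
    using proj_dist_image[OF U(1) E] grassmannian_image[OF U(1)] U(2) sp by auto
  finally show ?thesis by simp
qed

lemma haar_unique:
  assumes M1: "sets M1 = sets (grassmannian_borel N n)" "prob_space M1" "\<And>U. U \<in> orthogonal_maps N \<Longrightarrow> distr M1 M1 (\<lambda>E. U ` E) = M1"
    and M2: "sets M2 = sets (grassmannian_borel N n)" "prob_space M2" "\<And>U. U \<in> orthogonal_maps N \<Longrightarrow> distr M2 M2 (\<lambda>E. U ` E) = M2"
  shows "M1 = M2"
proof -
  let ?X = "grassmannian N n"
  interpret M1: prob_space M1 by fact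
  interpret M2: prob_space M2 by fact
  have sp: "space M1 = ?X" "space M2 = ?X" using sets_eq_imp_space_eq[OF M1(1)] sets_eq_imp_space_eq[OF M2(1)] by auto
  obtain E0 where E0: "E0 \<in> ?X" using M1.not_empty sp by auto
  \<comment> \<open>The measurable open sets: the ball argument compares the measures on them in
    both directions, they are stable under intersection, and they generate the
    sigma-algebra.\<close>
  define V where "V = {A \<in> sets (grassmannian_borel N n). \<forall>E\<in>A. \<exists>r>0. \<forall>F\<in>?X. proj_dist N E F < r \<longrightarrow> F \<in> A}"
  note c1 = ball_const[OF M1(1,3) _ E0] and c2 = ball_const[OF M2(1,3) _ E0]
  have le: "emeasure M1 A = emeasure M2 A" if A: "A \<in> V" for A
  proof (rule antisym)
    show "emeasure M1 A \<le> emeasure M2 A"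
      by (rule emeasure_le_of_uniform_balls[where d = "proj_dist N"
            and ?c1.0 = "\<lambda>r. emeasure M1 {G\<in>?X. proj_dist N E0 G < r}"
            and ?c2.0 = "\<lambda>r. emeasure M2 {G\<in>?X. proj_dist N E0 G < r}"])
         (use M1 M2 A sp c1 c2 proj_dist_measurable[OF M1(1) M1(1)] proj_dist_commute proj_dist_cover in \<open>auto simp: V_def\<close>)
    show "emeasure M2 A \<le> emeasure M1 A"
      by (rule emeasure_le_of_uniform_balls[where d = "proj_dist N"
            and ?c1.0 = "\<lambda>r. emeasure M2 {G\<in>?X. proj_dist N E0 G < r}"
            and ?c2.0 = "\<lambda>r. emeasure M1 {G\<in>?X. proj_dist N E0 G < r}"])
         (use M1 M2 A sp c1 c2 proj_dist_measurable[OF M2(1) M2(1)] proj_dist_commute proj_dist_cover in \<open>auto simp: V_def\<close>)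
  qed
  have VX: "V \<subseteq> Pow ?X" using sets.sets_into_space[of _ "grassmannian_borel N n"] by (auto simp: V_def)
  have gen: "sigma_sets ?X V = sets (grassmannian_borel N n)"
  proof
    show "sigma_sets ?X V \<subseteq> sets (grassmannian_borel N n)"
      using sets.sigma_sets_subset[of V "grassmannian_borel N n"] by (auto simp: V_def)
    have sets_V: "{E\<in>?X. proj_entry N E i j < a} \<in> V" if ij: "i \<in> {1..N}" "j \<in> {1..N}" for i j a
      unfolding V_def
    proof (intro CollectI conjI ballI)
      show "{E\<in>?X. proj_entry N E i j < a} \<in> sets (grassmannian_borel N n)"
        using measurable_sets[OF proj_entry_measurable[of N i j n], of "{..<a}"] by (simp add: vimage_def Int_def conj_commute)
      fix E assume "E \<in> {E\<in>?X. proj_entry N E i j < a}"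
      hence E: "E \<in> ?X" "proj_entry N E i j < a" by auto
      show "\<exists>r>0. \<forall>F\<in>?X. proj_dist N E F < r \<longrightarrow> F \<in> {E\<in>?X. proj_entry N E i j < a}"
      \<comment> \<open>The radius is squared because \<open>proj_dist\<close> is a sum of
        squares.\<close>
      proof (intro exI[of _ "(a - proj_entry N E i j)\<^sup>2"] conjI ballI impI CollectI)
        fix F assume F: "F \<in> ?X" "proj_dist N E F < (a - proj_entry N E i j)\<^sup>2"
        have "(proj_entry N E i j - proj_entry N F i j)\<^sup>2 \<le> (\<Sum>l=1..N. (proj_entry N E i l - proj_entry N F i l)\<^sup>2)"
          by (rule member_le_sum[of j]) (use ij in auto)
        also have "\<dots> \<le> proj_dist N E F" unfolding proj_dist_def
          by (rule member_le_sum[of i]) (use ij in \<open>auto intro: sum_nonneg\<close>)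
        finally have "(proj_entry N E i j - proj_entry N F i j)\<^sup>2 < (a - proj_entry N E i j)\<^sup>2" using F by simp
        hence "\<bar>proj_entry N E i j - proj_entry N F i j\<bar> < \<bar>a - proj_entry N E i j\<bar>"
          by (metis linorder_not_le abs_le_square_iff)
        thus "proj_entry N F i j < a" using E by linarith
      qed (use E in auto)
    qed
    \<comment> \<open>Measurability of the identity expresses that the Borel sets are contained in
      the sigma-algebra generated by \<open>V\<close>.\<close>
    have "(\<lambda>E. E) \<in> sigma ?X V \<rightarrow>\<^sub>M grassmannian_borel N n"
    proof (rule measurable_grassmannian_borelI)
      fix i j assume ij: "i \<in> {1..N}" "j \<in> {1..N}"
      show "(\<lambda>E. proj_entry N E i j) \<in> borel_measurable (sigma ?X V)"
        using sets_V[OF ij] VX by (intro borel_measurableI_less) (auto simp: space_measure_of)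
    qed (use VX in \<open>auto simp: space_measure_of\<close>)
    note ident = measurable_sets[OF this]
    show "sets (grassmannian_borel N n) \<subseteq> sigma_sets ?X V"
    proof
      fix A assume A: "A \<in> sets (grassmannian_borel N n)"
      have "A \<inter> ?X = A" using sets.sets_into_space[OF A] by auto
      thus "A \<in> sigma_sets ?X V" using ident[OF A] VX by (simp add: space_measure_of sets_measure_of)
    qed
  qed
  have XV: "?X \<in> V" using sets.top[of "grassmannian_borel N n"] by (auto simp: V_def intro: exI[of _ 1])
  have stable: "Int_stable V"
  proof (rule Int_stableI)
    fix A B assume AB: "A \<in> V" "B \<in> V"
    show "A \<inter> B \<in> V" unfolding V_def
    proof (intro CollectI conjI ballI)
      show "A \<inter> B \<in> sets (grassmannian_borel N n)" using AB by (auto simp: V_def)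
      fix E assume E: "E \<in> A \<inter> B"
      have rad: "\<exists>r>0. \<forall>F\<in>?X. proj_dist N E F < r \<longrightarrow> F \<in> D" if "D \<in> V" "E \<in> D" for D
        using that unfolding V_def by simp
      obtain r1 where r1: "r1 > 0" "\<forall>F\<in>?X. proj_dist N E F < r1 \<longrightarrow> F \<in> A" using rad AB(1) E by blast
      obtain r2 where r2: "r2 > 0" "\<forall>F\<in>?X. proj_dist N E F < r2 \<longrightarrow> F \<in> B" using rad AB(2) E by blast
      show "\<exists>r>0. \<forall>F\<in>?X. proj_dist N E F < r \<longrightarrow> F \<in> A \<inter> B"
        by (rule exI[of _ "min r1 r2"]) (use r1 r2 in simp)
    qed
  qed
  show ?thesis
    by (rule measure_eqI_generator_eq[OF stable VX le, of "\<lambda>_. ?X"])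
       (use gen M1(1) M2(1) XV in \<open>simp_all add: M1.emeasure_finite\<close>)
qed

lemma haar_grassmannian_eqI:
  assumes "sets M = sets (grassmannian_borel N n)" "prob_space M" "\<And>U. U \<in> orthogonal_maps N \<Longrightarrow> distr M M (\<lambda>E. U ` E) = M"
  shows "haar_grassmannian N n = M"
  unfolding haar_grassmannian_def
proof (rule the_equality)
  show "sets M = sets (grassmannian_borel N n) \<and> prob_space M \<and> (\<forall>U\<in>orthogonal_maps N. distr M M (\<lambda>E. U ` E) = M)"
    using assms by blast
  show "M' = M" if "sets M' = sets (grassmannian_borel N n) \<and> prob_space M' \<and> (\<forall>U\<in>orthogonal_maps N. distr M' M' (\<lambda>E. U ` E) = M')" for M'
    using that by (intro haar_unique[of M' N n M] assms) auto
qed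

section \<open>Rotation invariance of the Gaussian measure\<close>


definition stdn :: "real measure"
  where "stdn = density lborel (\<lambda>x. ennreal (std_normal_density x))"

definition gauss :: "'k set \<Rightarrow> ('k \<Rightarrow> real) measure"
  where "gauss K = PiM K (\<lambda>_. stdn)"

text \<open>Rows and columns are both asked to be orthonormal, so that passing to the transpose
  involves no inversion.\<close>

definition orthmat :: "'k set \<Rightarrow> ('k \<Rightarrow> 'k \<Rightarrow> real) \<Rightarrow> bool"
  where "orthmat K t \<longleftrightarrow>
    (\<forall>k\<in>K. \<forall>l\<in>K. (\<Sum>m\<in>K. t k m * t l m) = (if k = l then 1 else 0)) \<and>
    (\<forall>k\<in>K. \<forall>l\<in>K. (\<Sum>m\<in>K. t m k * t m l) = (if k = l then 1 else 0))"

text \<open>The restriction to \<open>K\<close> keeps the result extensional, that is, in the space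
  of \<open>gauss K\<close>.\<close>

definition matvec :: "'k set \<Rightarrow> ('k \<Rightarrow> 'k \<Rightarrow> real) \<Rightarrow> ('k \<Rightarrow> real) \<Rightarrow> 'k \<Rightarrow> real"
  where "matvec K t x = (\<lambda>k\<in>K. \<Sum>l\<in>K. t k l * x l)"

lemma sets_stdn [simp, measurable_cong]: "sets stdn = sets borel"
  by (simp add: stdn_def)

lemma space_stdn [simp]: "space stdn = UNIV"
  by (simp add: stdn_def)

lemma prob_space_stdn: "prob_space stdn"
  unfolding stdn_def by (rule prob_space_normal_density) simp

lemma sets_gauss [measurable_cong]: "sets (gauss K) = sets (PiM K (\<lambda>_. borel))"
  unfolding gauss_def by (rule sets_PiM_cong) auto

lemma prob_space_gauss: "prob_space (gauss K)"
  unfolding gauss_def by (intro prob_space_PiM prob_space_stdn)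

lemma gauss_component_measurable: "k \<in> K \<Longrightarrow> (\<lambda>x. x k) \<in> borel_measurable (gauss K)"
  using measurable_component_singleton[of k K "\<lambda>_. stdn"]
  by (simp add: gauss_def measurable_cong_sets[OF refl sets_stdn])

lemma product_sigma_finite_lborel: "product_sigma_finite (\<lambda>_. lborel :: real measure)"
  by (simp add: product_sigma_finite_def sigma_finite_lborel)

lemma sigma_finite_leb: "finite K \<Longrightarrow> sigma_finite_measure (PiM K (\<lambda>_. lborel :: real measure))"
  by (rule product_sigma_finite.sigma_finite[OF product_sigma_finite_lborel])

lemma gauss_density:
  assumes "finite K"
  shows "gauss K = density (PiM K (\<lambda>_. lborel)) (\<lambda>x. \<Prod>k\<in>K. ennreal (std_normal_density (x k)))"
proof -
  interpret S: product_sigma_finite "\<lambda>_. stdn"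
    unfolding product_sigma_finite_def using prob_space_stdn by (auto intro: prob_space_imp_sigma_finite)
  interpret L: product_sigma_finite "\<lambda>_. lborel :: real measure" by (rule product_sigma_finite_lborel)
  have "density (PiM K (\<lambda>_. lborel)) (\<lambda>x. \<Prod>k\<in>K. ennreal (std_normal_density (x k))) = PiM K (\<lambda>_. stdn)"
  proof (rule S.PiM_eqI[OF assms])
    show "sets (density (PiM K (\<lambda>_. lborel)) (\<lambda>x. \<Prod>k\<in>K. ennreal (std_normal_density (x k)))) = sets (PiM K (\<lambda>_. stdn))"
      by (simp cong: sets_PiM_cong)
    fix A :: "'a \<Rightarrow> real set" assume A: "\<And>i. i \<in> K \<Longrightarrow> A i \<in> sets stdn"
    hence A': "\<And>i. i \<in> K \<Longrightarrow> A i \<in> sets borel" by simp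
    have "emeasure (density (PiM K (\<lambda>_. lborel)) (\<lambda>x. \<Prod>k\<in>K. ennreal (std_normal_density (x k)))) (PiE K A)
      = (\<integral>\<^sup>+x. (\<Prod>k\<in>K. ennreal (std_normal_density (x k))) * indicator (PiE K A) x \<partial>PiM K (\<lambda>_. lborel))"
      by (subst emeasure_density) (use A' assms in \<open>auto intro!: sets_PiM_I_finite\<close>)
    also have "\<dots> = (\<integral>\<^sup>+x. (\<Prod>k\<in>K. ennreal (std_normal_density (x k)) * indicator (A k) (x k)) \<partial>PiM K (\<lambda>_. lborel))"
    proof (rule nn_integral_cong)
      fix x assume x: "x \<in> space (PiM K (\<lambda>_. lborel :: real measure))"
      have "(indicator (PiE K A) x :: ennreal) = (\<Prod>k\<in>K. indicator (A k) (x k))"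
        using x assms by (auto simp: indicator_def space_PiM PiE_def Pi_def prod_zero_iff)
      thus "(\<Prod>k\<in>K. ennreal (std_normal_density (x k))) * indicator (PiE K A) x
        = (\<Prod>k\<in>K. ennreal (std_normal_density (x k)) * indicator (A k) (x k))"
        by (simp add: prod.distrib)
    qed
    also have "\<dots> = (\<Prod>k\<in>K. \<integral>\<^sup>+x. ennreal (std_normal_density x) * indicator (A k) x \<partial>lborel)"
      by (rule L.product_nn_integral_prod[OF assms]) (use A' in \<open>auto intro!: borel_measurable_times_ennreal borel_measurable_indicator\<close>)
    also have "\<dots> = (\<Prod>k\<in>K. emeasure stdn (A k))"
      by (rule prod.cong[OF refl]) (use A' in \<open>simp add: stdn_def emeasure_density\<close>)
    finally show "emeasure (density (PiM K (\<lambda>_. lborel)) (\<lambda>x. \<Prod>k\<in>K. ennreal (std_normal_density (x k)))) (PiE K A)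
      = (\<Prod>i\<in>K. emeasure stdn (A i))" .
  qed
  thus ?thesis by (simp add: gauss_def)
qed

lemma prod_std_normal_density:
  assumes "finite K"
  shows "(\<Prod>k\<in>K. ennreal (std_normal_density (x k))) = ennreal ((1 / sqrt (2 * pi)) ^ card K * exp (- (\<Sum>k\<in>K. (x k)\<^sup>2) / 2))"
proof -
  have "(\<Prod>k\<in>K. ennreal (std_normal_density (x k))) = ennreal (\<Prod>k\<in>K. std_normal_density (x k))"
    by (rule prod_ennreal) simp
  also have "(\<Prod>k\<in>K. std_normal_density (x k)) = (1 / sqrt (2 * pi)) ^ card K * exp (\<Sum>k\<in>K. - (x k)\<^sup>2 / 2)"
    unfolding std_normal_density_def prod.distrib using assms by (simp add: exp_sum)
  also have "(\<Sum>k\<in>K. - (x k)\<^sup>2 / 2) = - (\<Sum>k\<in>K. (x k)\<^sup>2) / 2"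
    by (simp add: sum_negf sum_divide_distrib)
  finally show ?thesis .
qed

lemma matvec_measurable:
  "finite K \<Longrightarrow> matvec K t \<in> PiM K (\<lambda>_. borel) \<rightarrow>\<^sub>M PiM K (\<lambda>_. borel)"
  unfolding matvec_def by measurable

text \<open>On boxes this is translation invariance in one dimension, and boxes determine the
  product measure.\<close>

lemma nn_integral_leb_translate:
  fixes f :: "('k \<Rightarrow> real) \<Rightarrow> ennreal"
  assumes "finite K" and f: "f \<in> borel_measurable (PiM K (\<lambda>_. borel))"
  shows "(\<integral>\<^sup>+x. f (\<lambda>k\<in>K. x k + a k) \<partial>PiM K (\<lambda>_. lborel)) = (\<integral>\<^sup>+x. f x \<partial>PiM K (\<lambda>_. lborel))"
proof -
  interpret L: product_sigma_finite "\<lambda>_. lborel :: real measure" by (rule product_sigma_finite_lborel)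
  let ?L = "PiM K (\<lambda>_. lborel :: real measure)"
  have setsL: "sets ?L = sets (PiM K (\<lambda>_. borel))" by (rule sets_PiM_cong) auto
  have T: "(\<lambda>x. \<lambda>k\<in>K. x k + a k) \<in> ?L \<rightarrow>\<^sub>M ?L" by measurable
  have "distr ?L ?L (\<lambda>x. \<lambda>k\<in>K. x k + a k) = ?L"
  proof (rule L.PiM_eqI[OF assms(1)])
    fix A :: "'k \<Rightarrow> real set" assume A: "\<And>i. i \<in> K \<Longrightarrow> A i \<in> sets lborel"
    have m: "(\<lambda>x. x + a i) -` A i \<in> sets lborel" if "i \<in> K" for i
      using measurable_sets[of "\<lambda>x. x + a i" borel borel "A i"] A[OF that] by simp
    have "emeasure (distr ?L ?L (\<lambda>x. \<lambda>k\<in>K. x k + a k)) (PiE K A) = emeasure ?L ((\<lambda>x. \<lambda>k\<in>K. x k + a k) -` PiE K A \<inter> space ?L)"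
      by (rule emeasure_distr[OF T]) (use A assms(1) in \<open>auto intro!: sets_PiM_I_finite\<close>)
    also have "(\<lambda>x. \<lambda>k\<in>K. x k + a k) -` PiE K A \<inter> space ?L = PiE K (\<lambda>k. (\<lambda>x. x + a k) -` A k)"
      by (auto simp: space_PiM PiE_def Pi_def)
    also have "emeasure ?L \<dots> = (\<Prod>k\<in>K. emeasure lborel ((\<lambda>x. x + a k) -` A k))"
      by (rule L.emeasure_PiM[OF assms(1)]) (use m in auto)
    also have "\<dots> = (\<Prod>k\<in>K. emeasure lborel (A k))"
    proof (rule prod.cong[OF refl])
      fix k assume k: "k \<in> K"
      have "emeasure lborel (A k) = emeasure (distr lborel borel (\<lambda>x. a k + x)) (A k)"
        by (simp add: lborel_distr_plus)
      also have "\<dots> = emeasure lborel ((\<lambda>x. a k + x) -` A k \<inter> space lborel)"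
        by (rule emeasure_distr) (use A[OF k] in auto)
      finally show "emeasure lborel ((\<lambda>x. x + a k) -` A k) = emeasure lborel (A k)" by (simp add: add.commute)
    qed
    finally show "emeasure (distr ?L ?L (\<lambda>x. \<lambda>k\<in>K. x k + a k)) (PiE K A) = (\<Prod>i\<in>K. emeasure lborel (A i))" .
  qed simp
  hence "(\<integral>\<^sup>+x. f x \<partial>?L) = (\<integral>\<^sup>+x. f x \<partial>distr ?L ?L (\<lambda>x. \<lambda>k\<in>K. x k + a k))" by simp
  also have "\<dots> = (\<integral>\<^sup>+x. f (\<lambda>k\<in>K. x k + a k) \<partial>?L)"
    by (rule nn_integral_distr[OF T]) (use f in \<open>simp add: measurable_cong_sets[OF setsL refl]\<close>)
  finally show ?thesis ..
qed

lemma orthmat_transpose: "orthmat K t \<Longrightarrow> orthmat K (\<lambda>k l. t l k)"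
  by (auto simp: orthmat_def)

lemma matvec_transpose:
  assumes K: "finite K" and t: "orthmat K t" and k: "k \<in> K"
  shows "(\<Sum>l\<in>K. t k l * matvec K (\<lambda>k l. t l k) y l) = y k"
proof -
  have "(\<Sum>l\<in>K. t k l * matvec K (\<lambda>k l. t l k) y l) = (\<Sum>l\<in>K. \<Sum>m\<in>K. y m * (t k l * t m l))"
    by (rule sum.cong) (auto simp: matvec_def sum_distrib_left algebra_simps)
  also have "\<dots> = (\<Sum>m\<in>K. y m * (\<Sum>l\<in>K. t k l * t m l))"
    by (subst sum.swap) (simp add: sum_distrib_left)
  also have "\<dots> = (\<Sum>m\<in>K. if m = k then y k else 0)"
    by (rule sum.cong) (use t k in \<open>auto simp: orthmat_def\<close>)
  finally show ?thesis using K k by simp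
qed

lemma matvec_norm:
  assumes K: "finite K" and t: "orthmat K t"
  shows "(\<Sum>k\<in>K. (matvec K t x k)\<^sup>2) = (\<Sum>k\<in>K. (x k)\<^sup>2)"
proof -
  have "(\<Sum>k\<in>K. (matvec K t x k)\<^sup>2) = (\<Sum>k\<in>K. \<Sum>l\<in>K. x l * (t k l * matvec K t x k))"
    by (rule sum.cong) (auto simp: matvec_def power2_eq_square sum_distrib_left sum_distrib_right algebra_simps intro: sum.swap)
  also have "\<dots> = (\<Sum>l\<in>K. x l * (\<Sum>k\<in>K. t k l * matvec K t x k))"
    by (subst sum.swap) (simp add: sum_distrib_left)
  also have "\<dots> = (\<Sum>l\<in>K. x l * x l)"
    using matvec_transpose[OF K orthmat_transpose[OF t], of _ x] by (intro sum.cong) auto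
  finally show ?thesis by (simp add: power2_eq_square)
qed

text \<open>
  Compute the double integral of \<open>f (T x + y) * \<psi> x\<close> in two ways, once translating in \<open>y\<close> and
  once, since \<open>T x + y = T (x + T\<^sup>t y)\<close>, translating in \<open>x\<close>.
\<close>

lemma nn_integral_leb_orthmat:
  fixes f :: "('k \<Rightarrow> real) \<Rightarrow> ennreal"
  assumes K: "finite K" and t: "orthmat K t" and f [measurable]: "f \<in> borel_measurable (PiM K (\<lambda>_. borel))"
  shows "(\<integral>\<^sup>+x. f (matvec K t x) \<partial>PiM K (\<lambda>_. lborel)) = (\<integral>\<^sup>+x. f x \<partial>PiM K (\<lambda>_. lborel))"
proof -
  let ?L = "PiM K (\<lambda>_. lborel :: real measure)"
  let ?T = "matvec K t" and ?T' = "matvec K (\<lambda>k l. t l k)"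
  define \<psi> :: "('k \<Rightarrow> real) \<Rightarrow> ennreal" where "\<psi> x = (\<Prod>k\<in>K. ennreal (std_normal_density (x k)))" for x
  interpret S: sigma_finite_measure ?L by (rule sigma_finite_leb[OF K])
  interpret P: pair_sigma_finite ?L ?L ..
  have setsL [measurable_cong]: "sets ?L = sets (PiM K (\<lambda>_. borel))" by (rule sets_PiM_cong) auto
  have spL: "space ?L = (K \<rightarrow>\<^sub>E UNIV)" by (simp add: space_PiM)
  have \<psi>m [measurable]: "\<psi> \<in> borel_measurable (PiM K (\<lambda>_. borel))" unfolding \<psi>_def by measurable
  have Tm [measurable]: "?T \<in> PiM K (\<lambda>_. borel) \<rightarrow>\<^sub>M PiM K (\<lambda>_. borel)" "?T' \<in> PiM K (\<lambda>_. borel) \<rightarrow>\<^sub>M PiM K (\<lambda>_. borel)"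
    by (rule matvec_measurable[OF K])+
  have \<psi>1: "(\<integral>\<^sup>+x. \<psi> x \<partial>?L) = 1"
  proof -
    have "1 = emeasure (gauss K) (space (gauss K))" using prob_space.emeasure_space_1[OF prob_space_gauss, of K] by simp
    also have "\<dots> = (\<integral>\<^sup>+x. \<psi> x * indicator (space ?L) x \<partial>?L)"
      unfolding gauss_density[OF K] by (subst emeasure_density) (auto simp: \<psi>_def)
    also have "\<dots> = (\<integral>\<^sup>+x. \<psi> x \<partial>?L)" by (rule nn_integral_cong) simp
    finally show ?thesis by simp
  qed
  \<comment> \<open>The Gaussian density depends on the Euclidean norm only: a weight of total mass
    1 that rotations preserve.\<close>
  have \<psi>_cong: "\<psi> x = \<psi> y" if "(\<Sum>k\<in>K. (x k)\<^sup>2) = (\<Sum>k\<in>K. (y k)\<^sup>2)" for x y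
    unfolding \<psi>_def prod_std_normal_density[OF K] that ..
  have T_ext: "?T x \<in> K \<rightarrow>\<^sub>E UNIV" for x by (auto simp: matvec_def)
  have plus_ext: "(\<lambda>k\<in>K. x k + y k) \<in> K \<rightarrow>\<^sub>E UNIV" for x y :: "'k \<Rightarrow> real" by auto
  have shift: "(\<lambda>k\<in>K. ?T x k + y k) = ?T (\<lambda>k\<in>K. x k + ?T' y k)" for x y
  proof
    fix k
    show "(\<lambda>k\<in>K. ?T x k + y k) k = ?T (\<lambda>k\<in>K. x k + ?T' y k) k"
    proof (cases "k \<in> K")
      case True
      have "?T (\<lambda>k\<in>K. x k + ?T' y k) k = (\<Sum>l\<in>K. t k l * (x l + ?T' y l))" using True by (simp add: matvec_def)
      also have "\<dots> = (\<Sum>l\<in>K. t k l * x l) + (\<Sum>l\<in>K. t k l * ?T' y l)" by (simp add: algebra_simps sum.distrib)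
      also have "\<dots> = ?T x k + y k" unfolding matvec_transpose[OF K t True] using True by (simp add: matvec_def)
      finally show ?thesis using True by simp
    qed (simp add: matvec_def)
  qed
  have "(\<integral>\<^sup>+x. f x \<partial>?L) = (\<integral>\<^sup>+x. \<psi> x * (\<integral>\<^sup>+y. f y \<partial>?L) \<partial>?L)"
    by (subst nn_integral_multc) (simp_all add: \<psi>1)
  also have "\<dots> = (\<integral>\<^sup>+x. \<integral>\<^sup>+y. \<psi> x * f (\<lambda>k\<in>K. ?T x k + y k) \<partial>?L \<partial>?L)"
  proof (rule nn_integral_cong)
    fix x
    have "(\<integral>\<^sup>+y. f (\<lambda>k\<in>K. ?T x k + y k) \<partial>?L) = (\<integral>\<^sup>+y. f (\<lambda>k\<in>K. y k + ?T x k) \<partial>?L)"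
      by (simp add: add.commute)
    also have "\<dots> = (\<integral>\<^sup>+y. f y \<partial>?L)" by (rule nn_integral_leb_translate[OF K f])
    finally show "\<psi> x * (\<integral>\<^sup>+y. f y \<partial>?L) = (\<integral>\<^sup>+y. \<psi> x * f (\<lambda>k\<in>K. ?T x k + y k) \<partial>?L)"
      by (subst nn_integral_cmult) simp_all
  qed
  also have "\<dots> = (\<integral>\<^sup>+y. \<integral>\<^sup>+x. \<psi> x * f (\<lambda>k\<in>K. ?T x k + y k) \<partial>?L \<partial>?L)"
    by (rule P.Fubini') measurable
  also have "\<dots> = (\<integral>\<^sup>+y. \<integral>\<^sup>+x. \<psi> (\<lambda>k\<in>K. x k - ?T' y k) * f (?T x) \<partial>?L \<partial>?L)"
  proof (rule nn_integral_cong)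
    fix y
    have "(\<integral>\<^sup>+x. \<psi> (\<lambda>k\<in>K. x k - ?T' y k) * f (?T x) \<partial>?L)
      = (\<integral>\<^sup>+x. \<psi> (\<lambda>k\<in>K. (\<lambda>k\<in>K. x k + ?T' y k) k - ?T' y k) * f (?T (\<lambda>k\<in>K. x k + ?T' y k)) \<partial>?L)"
      by (rule nn_integral_leb_translate[OF K, symmetric, of "\<lambda>x. \<psi> (\<lambda>k\<in>K. x k - ?T' y k) * f (?T x)"]) measurable
    also have "\<dots> = (\<integral>\<^sup>+x. \<psi> x * f (\<lambda>k\<in>K. ?T x k + y k) \<partial>?L)"
    proof (rule nn_integral_cong)
      fix x assume "x \<in> space ?L"
      have "\<psi> (\<lambda>k\<in>K. (\<lambda>k\<in>K. x k + ?T' y k) k - ?T' y k) = \<psi> x" by (rule \<psi>_cong) simp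
      thus "\<psi> (\<lambda>k\<in>K. (\<lambda>k\<in>K. x k + ?T' y k) k - ?T' y k) * f (?T (\<lambda>k\<in>K. x k + ?T' y k)) = \<psi> x * f (\<lambda>k\<in>K. ?T x k + y k)"
        by (simp only: shift)
    qed
    finally show "(\<integral>\<^sup>+x. \<psi> x * f (\<lambda>k\<in>K. ?T x k + y k) \<partial>?L) = (\<integral>\<^sup>+x. \<psi> (\<lambda>k\<in>K. x k - ?T' y k) * f (?T x) \<partial>?L)" ..
  qed
  also have "\<dots> = (\<integral>\<^sup>+x. \<integral>\<^sup>+y. \<psi> (\<lambda>k\<in>K. x k - ?T' y k) * f (?T x) \<partial>?L \<partial>?L)"
    by (rule P.Fubini') measurable
  also have "\<dots> = (\<integral>\<^sup>+x. f (?T x) \<partial>?L)"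
  proof (rule nn_integral_cong)
    fix x
    \<comment> \<open>For fixed x, replacing y by y + T x turns x - T' y into - T' y, which has the
      norm of y; hence the weight integrates to 1.\<close>
    have "(\<integral>\<^sup>+y. \<psi> (\<lambda>k\<in>K. x k - ?T' y k) \<partial>?L) = (\<integral>\<^sup>+y. \<psi> (\<lambda>k\<in>K. x k - ?T' (\<lambda>k\<in>K. y k + ?T x k) k) \<partial>?L)"
      by (rule nn_integral_leb_translate[OF K, symmetric, of "\<lambda>y. \<psi> (\<lambda>k\<in>K. x k - ?T' y k)"]) measurable
    also have "\<dots> = (\<integral>\<^sup>+y. \<psi> y \<partial>?L)"
    proof (rule nn_integral_cong, rule \<psi>_cong)
      fix y
      have "x k - ?T' (\<lambda>k\<in>K. y k + ?T x k) k = - ?T' y k" if "k \<in> K" for k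
        using matvec_transpose[OF K orthmat_transpose[OF t] that, of x] that
        by (simp add: matvec_def algebra_simps sum.distrib)
      hence "(\<Sum>k\<in>K. ((\<lambda>k\<in>K. x k - ?T' (\<lambda>k\<in>K. y k + ?T x k) k) k)\<^sup>2) = (\<Sum>k\<in>K. (?T' y k)\<^sup>2)"
        by (intro sum.cong) auto
      also have "\<dots> = (\<Sum>k\<in>K. (y k)\<^sup>2)" by (rule matvec_norm[OF K orthmat_transpose[OF t]])
      finally show "(\<Sum>k\<in>K. ((\<lambda>k\<in>K. x k - ?T' (\<lambda>k\<in>K. y k + ?T x k) k) k)\<^sup>2) = (\<Sum>k\<in>K. (y k)\<^sup>2)" .
    qed
    finally show "(\<integral>\<^sup>+y. \<psi> (\<lambda>k\<in>K. x k - ?T' y k) * f (?T x) \<partial>?L) = f (?T x)"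
      by (subst nn_integral_multc) (simp_all add: \<psi>1)
  qed
  finally show ?thesis ..
qed

lemma gauss_orthmat:
  fixes K :: "'k set"
  assumes K: "finite K" and t: "orthmat K t"
  shows "distr (gauss K) (gauss K) (matvec K t) = gauss K"
proof (rule measure_eqI)
  fix A assume "A \<in> sets (distr (gauss K) (gauss K) (matvec K t))"
  hence A: "A \<in> sets (gauss K)" by simp
  let ?L = "PiM K (\<lambda>_. lborel :: real measure)"
  define \<psi> :: "('k \<Rightarrow> real) \<Rightarrow> ennreal" where "\<psi> x = (\<Prod>k\<in>K. ennreal (std_normal_density (x k)))" for x
  have A' [measurable]: "A \<in> sets (PiM K (\<lambda>_. borel))" using A by (simp add: sets_gauss)
  have setsL [measurable_cong]: "sets ?L = sets (PiM K (\<lambda>_. borel))" by (rule sets_PiM_cong) auto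
  have \<psi>m [measurable]: "\<psi> \<in> borel_measurable (PiM K (\<lambda>_. borel))" unfolding \<psi>_def by measurable
  have Tm [measurable]: "matvec K t \<in> PiM K (\<lambda>_. borel) \<rightarrow>\<^sub>M PiM K (\<lambda>_. borel)" by (rule matvec_measurable[OF K])
  have Tg: "matvec K t \<in> gauss K \<rightarrow>\<^sub>M gauss K" by (simp add: measurable_cong_sets[OF sets_gauss sets_gauss])
  have \<psi>T: "\<psi> (matvec K t x) = \<psi> x" for x
    unfolding \<psi>_def prod_std_normal_density[OF K] matvec_norm[OF K t] ..
  have "emeasure (distr (gauss K) (gauss K) (matvec K t)) A = (\<integral>\<^sup>+x. indicator A (matvec K t x) \<partial>gauss K)"
    using A Tg by (subst nn_integral_indicator[symmetric], simp, subst nn_integral_distr) auto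
  also have "\<dots> = (\<integral>\<^sup>+x. \<psi> x * indicator A (matvec K t x) \<partial>?L)"
    unfolding gauss_density[OF K] \<psi>_def[symmetric] by (subst nn_integral_density) auto
  also have "\<dots> = (\<integral>\<^sup>+x. \<psi> (matvec K t x) * indicator A (matvec K t x) \<partial>?L)"
    by (simp add: \<psi>T)
  also have "\<dots> = (\<integral>\<^sup>+x. \<psi> x * indicator A x \<partial>?L)"
    by (rule nn_integral_leb_orthmat[OF K t]) measurable
  also have "\<dots> = emeasure (gauss K) A"
    unfolding gauss_density[OF K] \<psi>_def[symmetric] by (subst emeasure_density) auto
  finally show "emeasure (distr (gauss K) (gauss K) (matvec K t)) A = emeasure (gauss K) A" .
qed simp

section \<open>Linear combinations of rows and columns\<close>

lemma gauss_reindex: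
  assumes "inj_on f I" "f \<in> I \<rightarrow> K"
  shows "distr (gauss K) (gauss I) (\<lambda>x. \<lambda>i\<in>I. x (f i)) = gauss I"
  unfolding gauss_def by (rule distr_PiM_reindex[OF prob_space_stdn assms])

lemma orthmat_id: "finite K \<Longrightarrow> orthmat K (\<lambda>k l. if k = l then 1 else 0)"
  by (auto simp: orthmat_def if_distrib[of "\<lambda>c. c * _"] if_distrib[of "\<lambda>c. _ * c"] cong: if_cong)

text \<open>A Gaussian matrix is a Gaussian vector indexed by pairs. With one factor the identity,
  these are the rotations of all rows, or of all columns, at once.\<close>

lemma orthmat_kron:
  assumes "orthmat J a" "orthmat I b"
  shows "orthmat (J \<times> I) (\<lambda>k l. a (fst k) (fst l) * b (snd k) (snd l))"
proof -
  have "(\<Sum>m\<in>J \<times> I. (f (fst m) * g (snd m)) * (f' (fst m) * g' (snd m))) = (\<Sum>j\<in>J. f j * f' j) * (\<Sum>i\<in>I. g i * g' i)"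
    for f f' :: "'a \<Rightarrow> real" and g g' :: "'b \<Rightarrow> real"
    by (simp add: sum_product sum.cartesian_product case_prod_beta' algebra_simps)
  note split = this
  show ?thesis unfolding orthmat_def
  proof (intro conjI ballI)
    fix k l assume kl: "k \<in> J \<times> I" "l \<in> J \<times> I"
    have "(\<Sum>m\<in>J. a (fst k) m * a (fst l) m) * (\<Sum>i\<in>I. b (snd k) i * b (snd l) i) = (if k = l then 1 else 0)"
      "(\<Sum>m\<in>J. a m (fst k) * a m (fst l)) * (\<Sum>i\<in>I. b i (snd k) * b i (snd l)) = (if k = l then 1 else 0)"
      using assms kl by (auto simp: orthmat_def prod_eq_iff)
    thus "(\<Sum>m\<in>J \<times> I. a (fst k) (fst m) * b (snd k) (snd m) * (a (fst l) (fst m) * b (snd l) (snd m))) = (if k = l then 1 else 0)"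
      "(\<Sum>m\<in>J \<times> I. a (fst m) (fst k) * b (snd m) (snd k) * (a (fst m) (fst l) * b (snd m) (snd l))) = (if k = l then 1 else 0)"
      using split[of "a (fst k)" "b (snd k)" "a (fst l)" "b (snd l)"]
        split[of "\<lambda>m. a m (fst k)" "\<lambda>m. b m (snd k)" "\<lambda>m. a m (fst l)" "\<lambda>m. b m (snd l)"] by simp_all
  qed
qed

lemma matvec_kron_id:
  assumes "finite J" "finite I" "j \<in> J" "i \<in> I"
  shows "matvec (J \<times> I) (\<lambda>k l. (if fst k = fst l then 1 else 0) * b (snd k) (snd l)) x (j, i) = (\<Sum>l\<in>I. b i l * x (j, l))"
    and "matvec (J \<times> I) (\<lambda>k l. a (fst k) (fst l) * (if snd k = snd l then 1 else 0)) x (j, i) = (\<Sum>l\<in>J. a j l * x (l, i))"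
proof -
  have "matvec (J \<times> I) (\<lambda>k l. (if fst k = fst l then 1 else 0) * b (snd k) (snd l)) x (j, i)
    = (\<Sum>l\<in>J \<times> I. (if j = fst l then 1 else 0) * b i (snd l) * x l)"
    using assms by (simp add: matvec_def)
  also have "\<dots> = (\<Sum>j'\<in>J. \<Sum>l\<in>I. (if j' = j then b i l * x (j', l) else 0))"
    by (subst sum.cartesian_product) (auto intro!: sum.cong)
  also have "\<dots> = (\<Sum>j'\<in>J. if j' = j then (\<Sum>l\<in>I. b i l * x (j, l)) else 0)"
    by (rule sum.cong) auto
  finally show "matvec (J \<times> I) (\<lambda>k l. (if fst k = fst l then 1 else 0) * b (snd k) (snd l)) x (j, i) = (\<Sum>l\<in>I. b i l * x (j, l))"
    using assms by simp
  have "matvec (J \<times> I) (\<lambda>k l. a (fst k) (fst l) * (if snd k = snd l then 1 else 0)) x (j, i)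
    = (\<Sum>l\<in>J \<times> I. a j (fst l) * (if i = snd l then 1 else 0) * x l)"
    using assms by (simp add: matvec_def)
  also have "\<dots> = (\<Sum>j'\<in>J. \<Sum>l\<in>I. (if l = i then a j j' * x (j', l) else 0))"
    by (subst sum.cartesian_product) (auto intro!: sum.cong)
  also have "\<dots> = (\<Sum>l\<in>J. a j l * x (l, i))"
    using assms by (intro sum.cong) auto
  finally show "matvec (J \<times> I) (\<lambda>k l. a (fst k) (fst l) * (if snd k = snd l then 1 else 0)) x (j, i) = (\<Sum>l\<in>J. a j l * x (l, i))" .
qed

text \<open>A Householder reflection maps a coordinate vector to a given unit vector.\<close>

lemma orthmat_first_row:
  assumes J: "finite J" and j0: "j0 \<in> J" and w: "(\<Sum>j\<in>J. (w j)\<^sup>2) = 1"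
  shows "\<exists>a. orthmat J a \<and> (\<forall>j\<in>J. a j0 j = w j)"
proof (cases "w j0 = 1")
  case True
  have "(\<Sum>j\<in>J - {j0}. (w j)\<^sup>2) = 0" using w True sum.remove[OF J j0, of "\<lambda>j. (w j)\<^sup>2"] by simp
  hence "\<forall>j\<in>J - {j0}. w j = 0" using J by (subst (asm) sum_nonneg_eq_0_iff) auto
  thus ?thesis using True by (intro exI[of _ "\<lambda>k l. if k = l then 1 else 0"] conjI orthmat_id J) auto
next
  case False
  define v where "v j = w j - (if j = j0 then 1 else 0)" for j
  \<comment> \<open>This is 2 / |v|^2, since |v|^2 = 2 (1 - w j0). The case w j0 = 1, where v = 0,
    has been separated.\<close>
  define c where "c = 1 / (1 - w j0)"
  define \<delta> :: "'a \<Rightarrow> 'a \<Rightarrow> real" where "\<delta> k l = (if k = l then 1 else 0)" for k l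
  define a where "a k l = \<delta> k l - c * (v k * v l)" for k l
  have \<delta>sum: "(\<Sum>m\<in>J. \<delta> k m * f m) = f k" if "k \<in> J" for k f
    unfolding \<delta>_def using J that by (simp add: if_distrib[of "\<lambda>c. c * _"] cong: if_cong)
  have v2: "(\<Sum>m\<in>J. v m * v m) = 2 * (1 - w j0)"
  proof -
    have "(\<Sum>m\<in>J. v m * v m) = (\<Sum>m\<in>J. (w m)\<^sup>2) - 2 * (\<Sum>m\<in>J. \<delta> j0 m * w m) + (\<Sum>m\<in>J. \<delta> j0 m * 1)"
      unfolding v_def \<delta>_def sum_distrib_left sum_subtractf[symmetric] sum.distrib[symmetric]
      by (rule sum.cong) (auto simp: power2_eq_square algebra_simps)
    thus ?thesis using w \<delta>sum[OF j0, of w] \<delta>sum[OF j0, of "\<lambda>_. 1"] by simp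
  qed
  have "c * (1 - w j0) = 1" using False by (simp add: c_def)
  hence cv: "c * (c * (\<Sum>m\<in>J. v m * v m)) = 2 * c" unfolding v2 by algebra
  have sym: "a k l = a l k" for k l by (simp add: a_def \<delta>_def mult.commute)
  have row: "(\<Sum>m\<in>J. a k m * a l m) = (if k = l then 1 else 0)" if kl: "k \<in> J" "l \<in> J" for k l
  proof -
    have "(\<Sum>m\<in>J. a k m * a l m) = (\<Sum>m\<in>J. \<delta> k m * \<delta> l m) - c * v l * (\<Sum>m\<in>J. \<delta> k m * v m)
       - c * v k * (\<Sum>m\<in>J. \<delta> l m * v m) + v k * v l * (c * (c * (\<Sum>m\<in>J. v m * v m)))"
      unfolding a_def sum_distrib_left sum_subtractf[symmetric] sum.distrib[symmetric]
      by (rule sum.cong) (auto simp: algebra_simps)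
    also have "\<dots> = \<delta> l k" unfolding \<delta>sum[OF kl(1)] \<delta>sum[OF kl(2)] cv by (simp add: algebra_simps)
    finally show ?thesis by (simp add: \<delta>_def)
  qed
  have "orthmat J a" unfolding orthmat_def using row sym by auto
  moreover have "a j0 j = w j" for j
    using False by (auto simp: a_def \<delta>_def v_def c_def field_simps)
  ultimately show ?thesis by blast
qed

text \<open>Complete \<open>w\<close> to a row of an orthogonal matrix, let this matrix act on the
  row index, and take the marginal at that row.\<close>

lemma gauss_combine_rows:
  assumes J: "finite J" and I: "finite I" and w: "(\<Sum>j\<in>J. (w j)\<^sup>2) = 1"
  shows "distr (gauss (J \<times> I)) (gauss I) (\<lambda>x. \<lambda>i\<in>I. \<Sum>j\<in>J. w j * x (j, i)) = gauss I"
proof -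
  have "J \<noteq> {}" using w by auto
  then obtain j0 where j0: "j0 \<in> J" by auto
  obtain a where a: "orthmat J a" "\<And>j. j \<in> J \<Longrightarrow> a j0 j = w j" using orthmat_first_row[OF J j0 w] by auto
  define t where "t k l = a (fst k) (fst l) * (if snd k = snd l then 1 else 0)" for k l :: "'a \<times> 'b"
  have t: "orthmat (J \<times> I) t" unfolding t_def by (rule orthmat_kron[OF a(1) orthmat_id[OF I]])
  have fin: "finite (J \<times> I)" using J I by simp
  have m1: "matvec (J \<times> I) t \<in> gauss (J \<times> I) \<rightarrow>\<^sub>M gauss (J \<times> I)"
    using matvec_measurable[OF fin, of t] by (simp add: measurable_cong_sets[OF sets_gauss sets_gauss])
  have m2: "(\<lambda>x. \<lambda>i\<in>I. x (j0, i)) \<in> gauss (J \<times> I) \<rightarrow>\<^sub>M gauss I"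
    unfolding gauss_def by (rule measurable_restrict) (use j0 in simp)
  have "gauss I = distr (gauss (J \<times> I)) (gauss I) (\<lambda>x. \<lambda>i\<in>I. x (j0, i))"
    by (rule gauss_reindex[symmetric]) (use j0 in \<open>auto simp: inj_on_def\<close>)
  also have "\<dots> = distr (distr (gauss (J \<times> I)) (gauss (J \<times> I)) (matvec (J \<times> I) t)) (gauss I) (\<lambda>x. \<lambda>i\<in>I. x (j0, i))"
    by (simp add: gauss_orthmat[OF fin t])
  also have "\<dots> = distr (gauss (J \<times> I)) (gauss I) ((\<lambda>x. \<lambda>i\<in>I. x (j0, i)) \<circ> matvec (J \<times> I) t)"
    by (rule distr_distr[OF m2 m1])
  also have "(\<lambda>x. \<lambda>i\<in>I. x (j0, i)) \<circ> matvec (J \<times> I) t = (\<lambda>x. \<lambda>i\<in>I. \<Sum>j\<in>J. w j * x (j, i))"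
    unfolding t_def o_def
    by (intro ext restrict_ext) (simp add: matvec_kron_id(2)[OF J I j0] a(2))
  finally show ?thesis ..
qed

lemma gauss_combine_columns:
  assumes J: "finite J" and I: "finite I" and w: "(\<Sum>i\<in>I. (w i)\<^sup>2) = 1"
  shows "distr (gauss (J \<times> I)) (gauss J) (\<lambda>x. \<lambda>j\<in>J. \<Sum>i\<in>I. w i * x (j, i)) = gauss J"
proof -
  have m1: "(\<lambda>x. \<lambda>k\<in>I \<times> J. x (snd k, fst k)) \<in> gauss (J \<times> I) \<rightarrow>\<^sub>M gauss (I \<times> J)"
    unfolding gauss_def by (rule measurable_restrict) auto
  have m2: "(\<lambda>x. \<lambda>j\<in>J. \<Sum>i\<in>I. w i * x (i, j)) \<in> gauss (I \<times> J) \<rightarrow>\<^sub>M gauss J"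
    unfolding measurable_cong_sets[OF refl sets_gauss] by measurable
  have "gauss J = distr (gauss (I \<times> J)) (gauss J) (\<lambda>x. \<lambda>j\<in>J. \<Sum>i\<in>I. w i * x (i, j))"
    by (rule gauss_combine_rows[OF I J w, symmetric])
  also have "gauss (I \<times> J) = distr (gauss (J \<times> I)) (gauss (I \<times> J)) (\<lambda>x. \<lambda>k\<in>I \<times> J. x (snd k, fst k))"
    by (rule gauss_reindex[symmetric]) (auto simp: inj_on_def)
  also have "distr \<dots> (gauss J) (\<lambda>x. \<lambda>j\<in>J. \<Sum>i\<in>I. w i * x (i, j))
    = distr (gauss (J \<times> I)) (gauss J) ((\<lambda>x. \<lambda>j\<in>J. \<Sum>i\<in>I. w i * x (i, j)) \<circ> (\<lambda>x. \<lambda>k\<in>I \<times> J. x (snd k, fst k)))"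
    by (rule distr_distr[OF m2 m1])
  also have "(\<lambda>x. \<lambda>j\<in>J. \<Sum>i\<in>I. w i * x (i, j)) \<circ> (\<lambda>x. \<lambda>k\<in>I \<times> J. x (snd k, fst k)) = (\<lambda>x. \<lambda>j\<in>J. \<Sum>i\<in>I. w i * x (j, i))"
    unfolding o_def by (intro ext restrict_ext) simp
  finally show ?thesis ..
qed

section \<open>Kernels of Gaussian matrices\<close>


declare One_nat_def [simp del]

text \<open>Gram-Schmidt; as \<open>1 / sqrt 0 = 0\<close>, a row that depends on the previous ones yields the zero vector.\<close>

function gs :: "nat \<Rightarrow> (nat \<Rightarrow> nat \<Rightarrow> real) \<Rightarrow> nat \<Rightarrow> nat \<Rightarrow> real"
  where "gs N g j = (let r = g j - (\<Sum>l\<in>{1..<j}. ip N (g j) (gs N g l) *\<^sub>R gs N g l)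
    in (1 / sqrt (ip N r r)) *\<^sub>R r)"
  by auto
termination by (relation "Wellfounded.measure (\<lambda>(N, g, j). j)") auto

declare gs.simps [simp del]

text \<open>The residual against the first j - 1 Gram-Schmidt vectors. The vector is a separate
  argument because the null set argument also considers the residuals of unit vectors.\<close>

definition gs_res :: "nat \<Rightarrow> (nat \<Rightarrow> nat \<Rightarrow> real) \<Rightarrow> nat \<Rightarrow> (nat \<Rightarrow> real) \<Rightarrow> nat \<Rightarrow> real"
  where "gs_res N g j x = x - (\<Sum>l\<in>{1..<j}. ip N x (gs N g l) *\<^sub>R gs N g l)"

definition kernel :: "nat \<Rightarrow> nat \<Rightarrow> (nat \<Rightarrow> nat \<Rightarrow> real) \<Rightarrow> (nat \<Rightarrow> real) set"
  where "kernel N n g = {x \<in> Rvec N. \<forall>j\<in>{1..n}. ip N (g j) x = 0}"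

text \<open>Linear independence of the first n rows, phrased so that its measurability is
  immediate.\<close>

definition nondegenerate :: "nat \<Rightarrow> nat \<Rightarrow> (nat \<Rightarrow> nat \<Rightarrow> real) \<Rightarrow> bool"
  where "nondegenerate N n g \<longleftrightarrow> (\<forall>j\<in>{1..n}. gs_res N g j (g j) \<noteq> 0)"

definition row_vec :: "nat \<Rightarrow> (nat \<times> nat \<Rightarrow> real) \<Rightarrow> nat \<Rightarrow> nat \<Rightarrow> real"
  where "row_vec N \<omega> j = (\<lambda>i. if i \<in> {1..N} then \<omega> (j, i) else 0)"

lemma gs_eq: "gs N g j = (1 / sqrt (ip N (gs_res N g j (g j)) (gs_res N g j (g j)))) *\<^sub>R gs_res N g j (g j)"
  by (subst gs.simps) (simp add: gs_res_def Let_def)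

lemma gs_cong:
  assumes "\<And>l. l \<le> j \<Longrightarrow> g l = g' l" shows "gs N g j = gs N g' j"
  using assms
proof (induction j rule: less_induct)
  case (less j)
  have "gs N g l = gs N g' l" if "l \<in> {1..<j}" for l
    by (rule less.IH) (use that less.prems in auto)
  hence "(\<Sum>l\<in>{1..<j}. ip N (g j) (gs N g l) *\<^sub>R gs N g l) = (\<Sum>l\<in>{1..<j}. ip N (g j) (gs N g' l) *\<^sub>R gs N g' l)"
    by (intro sum.cong) auto
  thus ?case using less.prems[of j] by (subst (1 2) gs.simps) simp
qed

text \<open>Not an equality, as a dependent row yields 0; the trace comparison behind almost sure
  nondegeneracy has to cover that case.\<close>

lemma gs_norm_le: "ip N (gs N g j) (gs N g j) \<le> 1"
proof -
  let ?r = "gs_res N g j (g j)"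
  have "ip N (gs N g j) (gs N g j) = (1 / sqrt (ip N ?r ?r)) * ((1 / sqrt (ip N ?r ?r)) * ip N ?r ?r)"
    unfolding gs_eq[of N g j] ip_scale by simp
  also have "\<dots> \<le> 1" using ip_self_nonneg[of N ?r] by (cases "ip N ?r ?r = 0") (auto simp: field_simps)
  finally show ?thesis .
qed

lemma gs_orthonormal:
  assumes g: "\<And>j. j \<in> {1..n} \<Longrightarrow> g j \<in> Rvec N" and nd: "nondegenerate N n g" and "m \<le> n"
  shows "orthonormal N (gs N g ` {1..m}) \<and> inj_on (gs N g) {1..m}"
  using \<open>m \<le> n\<close>
proof (induction m)
  case 0
  show ?case by (simp add: orthonormal_def)
next
  case (Suc m)
  hence IH: "orthonormal N (gs N g ` {1..m})" "inj_on (gs N g) {1..m}" by auto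
  have in1: "Suc m \<in> {1..n}" using Suc.prems by auto
  have r: "gs_res N g (Suc m) (g (Suc m)) = g (Suc m) - proj N (gs N g ` {1..m}) (g (Suc m))"
    unfolding gs_res_def proj_def sum.reindex[OF IH(2)] by (simp add: atLeastLessThanSuc_atLeastAtMost)
  note ins = orthonormal_insert[OF IH(1) g[OF in1] r]
  have ne: "gs_res N g (Suc m) (g (Suc m)) \<noteq> 0" using nd in1 by (auto simp: nondegenerate_def)
  have set: "{1..Suc m} = insert (Suc m) {1..m}" by auto
  show ?case using ins[OF ne] IH(2) unfolding set gs_eq[symmetric] by auto
qed

text \<open>Each Gram-Schmidt vector is a nonzero multiple of its row minus a combination of earlier
  ones, so the two systems of equations agree step by step.\<close>

lemma kernel_gs: "kernel N n g = kernel N n (gs N g)" if nd: "nondegenerate N n g" and g: "\<And>j. j \<in> {1..n} \<Longrightarrow> g j \<in> Rvec N"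
proof -
  have "(\<forall>j\<in>{1..m}. ip N (g j) x = 0) \<longleftrightarrow> (\<forall>j\<in>{1..m}. ip N (gs N g j) x = 0)" if "m \<le> n" for m x
    using that
  proof (induction m)
    case (Suc m)
    have in1: "Suc m \<in> {1..n}" using Suc.prems by auto
    have set: "{1..Suc m} = insert (Suc m) {1..m}" by auto
    have IH: "(\<forall>j\<in>{1..m}. ip N (g j) x = 0) \<longleftrightarrow> (\<forall>j\<in>{1..m}. ip N (gs N g j) x = 0)" using Suc by auto
    have "ip N (g (Suc m)) x = 0 \<longleftrightarrow> ip N (gs N g (Suc m)) x = 0" if all: "\<forall>j\<in>{1..m}. ip N (gs N g j) x = 0"
    proof -
      let ?r = "gs_res N g (Suc m) (g (Suc m))"
      have oB: "orthonormal N (gs N g ` {1..Suc m})" using gs_orthonormal[OF g nd] Suc.prems by blast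
      have "?r \<noteq> 0" using nd in1 by (auto simp: nondegenerate_def)
      moreover have "ip N ?r ?r \<noteq> 0"
      proof
        assume "ip N ?r ?r = 0"
        hence "gs N g (Suc m) = 0" unfolding gs_eq[of N g "Suc m"] by simp
        moreover have "ip N (gs N g (Suc m)) (gs N g (Suc m)) = 1" using orthonormal_ip[OF oB, of "gs N g (Suc m)" "gs N g (Suc m)"] by auto
        ultimately show False by simp
      qed
      ultimately have "ip N (gs N g (Suc m)) x = 0 \<longleftrightarrow> ip N ?r x = 0" unfolding gs_eq[of N g "Suc m"] ip_scale by simp
      also have "ip N ?r x = ip N (g (Suc m)) x"
        unfolding gs_res_def ip_diff ip_sum ip_scale using all by simp
      finally show ?thesis by simp
    qed
    thus ?case using IH unfolding set by auto
  qed simp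
  thus ?thesis by (auto simp: kernel_def)
qed

lemma subspace_kernel: "subspace (kernel N n g)" "kernel N n g \<subseteq> Rvec N"
proof -
  show "subspace (kernel N n g)"
    unfolding subspace_def kernel_def
    using subspace_Rvec[of N] by (auto simp: ip_add ip_scale subspace_def)
qed (auto simp: kernel_def)

text \<open>The projection onto the kernel is the identity minus the projection onto the span of the
  rows. Its trace gives the dimension; its entries give measurability in the matrix.\<close>

lemma kernel_orthonormal:
  assumes q: "orthonormal N (q ` {1..n})" "inj_on q {1..n}"
  shows "kernel N n q \<in> grassmannian N n"
    and "i \<in> {1..N} \<Longrightarrow> j \<in> {1..N} \<Longrightarrow> proj_entry N (kernel N n q) i j = (if i = j then 1 else 0) - (\<Sum>l=1..n. q l i * q l j)"
proof -
  let ?E = "kernel N n q" and ?Q = "q ` {1..n}"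
  obtain B where B: "onb N ?E B" using onb_exists[OF subspace_kernel] by blast
  have oB: "orthonormal N B" "B \<subseteq> ?E" using B by (auto simp: onb_def)
  have QR: "?Q \<subseteq> Rvec N" using q by (auto simp: orthonormal_def)
  have pB: "proj N B x = x - proj N ?Q x" if x: "x \<in> Rvec N" for x
  proof -
    have 1: "x - proj N ?Q x \<in> ?E" unfolding kernel_def
    proof (intro CollectI conjI ballI)
      show "x - proj N ?Q x \<in> Rvec N" by (intro subspace_diff subspace_Rvec x proj_in_subspace QR)
      fix j assume "j \<in> {1..n}"
      hence "q j \<in> ?Q" by auto
      thus "ip N (q j) (x - proj N ?Q x) = 0" using ip_proj[OF q(1), of "q j" x] by (simp add: ip_diff ip_commute)
    qed
    have "ip N (proj N ?Q x) b = 0" if "b \<in> B" for b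
      unfolding ip_proj_left using that oB(2) by (intro sum.neutral) (auto simp: kernel_def)
    hence "ip N (x - proj N ?Q x) b = ip N x b" if "b \<in> B" for b using that by (simp add: ip_diff)
    hence "proj N B (x - proj N ?Q x) = proj N B x" unfolding proj_def[of N B] by (intro sum.cong) auto
    thus ?thesis using B 1 by (simp add: onb_def)
  qed
  have "real (card B) = (\<Sum>j=1..N. \<Sum>b\<in>B. (ip N (unit_vec j) b)\<^sup>2)" by (rule card_eq_trace[OF oB(1)])
  also have "\<dots> = (\<Sum>j=1..N. 1 - (\<Sum>b\<in>?Q. (ip N (unit_vec j) b)\<^sup>2))"
  proof (rule sum.cong[OF refl])
    fix j assume j: "j \<in> {1..N}"
    have "(\<Sum>b\<in>B. (ip N (unit_vec j) b)\<^sup>2) = ip N (proj N B (unit_vec j)) (unit_vec j)"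
      unfolding ip_proj_left by (simp add: power2_eq_square ip_commute)
    also have "\<dots> = ip N (unit_vec j) (unit_vec j) - ip N (proj N ?Q (unit_vec j)) (unit_vec j)"
      by (simp add: pB[OF unit_vec_Rvec[OF j]] ip_diff)
    also have "ip N (unit_vec j) (unit_vec j) = 1" using j by (simp add: ip_unit_vec(1)) (simp add: unit_vec_def)
    also have "ip N (proj N ?Q (unit_vec j)) (unit_vec j) = (\<Sum>b\<in>?Q. (ip N (unit_vec j) b)\<^sup>2)"
      unfolding ip_proj_left by (simp add: power2_eq_square ip_commute)
    finally show "(\<Sum>b\<in>B. (ip N (unit_vec j) b)\<^sup>2) = 1 - (\<Sum>b\<in>?Q. (ip N (unit_vec j) b)\<^sup>2)" .
  qed
  also have "\<dots> = real N - real (card ?Q)" unfolding card_eq_trace[OF q(1)] by (simp add: sum_subtractf)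
  also have "card ?Q = n" using q(2) by (simp add: card_image)
  finally have "card B = N - n" by linarith
  thus "?E \<in> grassmannian N n" using dim_orthonormal[OF _ B] subspace_kernel[of N n q] by (simp add: grassmannian_def)
  assume ij: "i \<in> {1..N}" "j \<in> {1..N}"
  have "proj_entry N ?E i j = proj N B (unit_vec j) i"
    by (simp add: proj_entry_def orth_proj_eq_proj[OF subspace_kernel B])
  also have "\<dots> = unit_vec j i - proj N ?Q (unit_vec j) i"
    by (simp add: pB[OF unit_vec_Rvec[OF ij(2)]] fun_apply_simps)
  also have "proj N ?Q (unit_vec j) i = (\<Sum>l=1..n. q l i * q l j)"
    unfolding proj_apply sum.reindex[OF q(2)] using ij by (simp add: ip_unit_vec mult.commute)
  finally show "proj_entry N ?E i j = (if i = j then 1 else 0) - (\<Sum>l=1..n. q l i * q l j)"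
    by (simp add: unit_vec_def)
qed

lemma unit_vec_eq_iff: "unit_vec i = unit_vec j \<longleftrightarrow> i = j"
  by (metis unit_vec_def zero_neq_one)

lemma inj_on_unit_vec: "inj_on unit_vec A"
  by (simp add: inj_on_def unit_vec_eq_iff)

lemma orthonormal_unit_vec:
  assumes n: "n \<le> N" shows "orthonormal N (unit_vec ` {1..n})"
proof -
  have "ip N (unit_vec i) (unit_vec j) = (if unit_vec i = unit_vec j then 1 else 0)" if "i \<in> {1..n}" "j \<in> {1..n}" for i j
  proof -
    have "ip N (unit_vec i) (unit_vec j) = unit_vec i j" by (rule ip_unit_vec(1)) (use that n in auto)
    also have "\<dots> = (if i = j then 1 else 0)" by (auto simp: unit_vec_def)
    finally show ?thesis by (simp add: unit_vec_eq_iff)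
  qed
  thus "orthonormal N (unit_vec ` {1..n})" unfolding orthonormal_def using n by (auto intro: unit_vec_Rvec)
qed

text \<open>The default for degenerate matrices is an arbitrary element of the Grassmannian: it
  makes the map total and measurable, and it is taken with probability 0.\<close>

definition kernel_space :: "nat \<Rightarrow> nat \<Rightarrow> (nat \<times> nat \<Rightarrow> real) \<Rightarrow> (nat \<Rightarrow> real) set"
  where "kernel_space N n \<omega> =
    (if nondegenerate N n (row_vec N \<omega>) then kernel N n (row_vec N \<omega>) else kernel N n unit_vec)"

lemma row_Rvec: "row_vec N \<omega> j \<in> Rvec N"
  by (auto simp: row_vec_def Rvec_def)

lemma kernel_space_grassmannian:
  assumes "n \<le> N" shows "kernel_space N n \<omega> \<in> grassmannian N n"
proof (cases "nondegenerate N n (row_vec N \<omega>)")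
  case True
  thus ?thesis using kernel_orthonormal(1)[of N "gs N (row_vec N \<omega>)" n] gs_orthonormal[OF row_Rvec True order_refl] kernel_gs[OF True row_Rvec]
    by (simp add: kernel_space_def)
next
  case False
  thus ?thesis using kernel_orthonormal(1)[OF orthonormal_unit_vec[OF assms] inj_on_unit_vec] by (simp add: kernel_space_def)
qed

abbreviation gauss_matrix :: "nat \<Rightarrow> nat \<Rightarrow> (nat \<times> nat \<Rightarrow> real) measure"
  where "gauss_matrix n N \<equiv> gauss ({1..n} \<times> {1..N})"

lemma measurable_if_const:
  "(c \<Longrightarrow> f \<in> borel_measurable M) \<Longrightarrow> (\<lambda>x. if c then f x else (0::real)) \<in> borel_measurable M"
proof (cases c)
  case True
  assume "c \<Longrightarrow> f \<in> borel_measurable M"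
  from this[OF True] show ?thesis unfolding if_P[OF True] .
next
  case False
  show ?thesis unfolding if_not_P[OF False] by (rule borel_measurable_const)
qed

lemma row_measurable: "j \<in> {1..n} \<Longrightarrow> (\<lambda>\<omega>. row_vec N \<omega> j i) \<in> borel_measurable (gauss_matrix n N)"
  unfolding row_vec_def by (intro measurable_if_const gauss_component_measurable) simp

lemma gs_measurable:
  assumes "j \<in> {1..n}" shows "(\<lambda>\<omega>. gs N (row_vec N \<omega>) j i) \<in> borel_measurable (gauss_matrix n N)"
  using assms
proof (induction j arbitrary: i rule: less_induct)
  case (less j)
  note [measurable] = row_measurable[OF less.prems]
  have IH [measurable]: "(\<lambda>\<omega>. gs N (row_vec N \<omega>) l i) \<in> borel_measurable (gauss_matrix n N)" if "l \<in> {1..<j}" for l i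
    using less.IH[of l] less.prems that by auto
  have r [measurable]: "(\<lambda>\<omega>. gs_res N (row_vec N \<omega>) j (row_vec N \<omega> j) i) \<in> borel_measurable (gauss_matrix n N)" for i
    unfolding gs_res_def fun_apply_simps sum_fun_apply scaleR_fun_apply ip_def by measurable
  show ?case unfolding gs_eq[of N "row_vec N _" j] scaleR_fun_apply ip_def by measurable
qed

lemma gs_res_measurable:
  assumes j: "j \<in> {1..n}" and x: "\<And>i. (\<lambda>\<omega>. x \<omega> i) \<in> borel_measurable (gauss_matrix n N)"
  shows "(\<lambda>\<omega>. gs_res N (row_vec N \<omega>) j (x \<omega>) i) \<in> borel_measurable (gauss_matrix n N)"
proof -
  note [measurable] = x
  have [measurable]: "(\<lambda>\<omega>. gs N (row_vec N \<omega>) l i) \<in> borel_measurable (gauss_matrix n N)" if "l \<in> {1..<j}" for l i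
    by (rule gs_measurable) (use that j in auto)
  show ?thesis unfolding gs_res_def fun_apply_simps sum_fun_apply scaleR_fun_apply ip_def by measurable
qed

lemma fun_zero_iff: "f = 0 \<longleftrightarrow> (\<forall>i. f i = (0::real))" for f :: "nat \<Rightarrow> real"
  by (auto simp: fun_eq_iff zero_fun_def)

lemma gs_res_zero_set:
  assumes j: "j \<in> {1..n}" and x: "\<And>i. (\<lambda>\<omega>. x \<omega> i) \<in> borel_measurable (gauss_matrix n N)"
  shows "{\<omega>\<in>space (gauss_matrix n N). gs_res N (row_vec N \<omega>) j (x \<omega>) = 0} \<in> sets (gauss_matrix n N)"
proof -
  note [measurable] = gs_res_measurable[OF assms]
  show ?thesis unfolding fun_zero_iff by measurable
qed

lemma nondegenerate_set:
  "{\<omega>\<in>space (gauss_matrix n N). nondegenerate N n (row_vec N \<omega>)} \<in> sets (gauss_matrix n N)"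
proof -
  have "{\<omega>\<in>space (gauss_matrix n N). nondegenerate N n (row_vec N \<omega>)} =
    space (gauss_matrix n N) - (\<Union>j\<in>{1..n}. {\<omega>\<in>space (gauss_matrix n N). gs_res N (row_vec N \<omega>) j (row_vec N \<omega> j) = 0})"
    by (auto simp: nondegenerate_def)
  also have "\<dots> \<in> sets (gauss_matrix n N)"
    by (intro sets.Diff sets.top sets.finite_UN gs_res_zero_set row_measurable) auto
  finally show ?thesis .
qed

lemma kernel_space_measurable:
  assumes "n \<le> N" shows "kernel_space N n \<in> gauss_matrix n N \<rightarrow>\<^sub>M grassmannian_borel N n"
proof (rule measurable_grassmannian_borelI)
  show "kernel_space N n \<omega> \<in> grassmannian N n" for \<omega> by (rule kernel_space_grassmannian[OF assms])
  fix i j assume ij: "i \<in> {1..N}" "j \<in> {1..N}"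
  have e: "proj_entry N (kernel_space N n \<omega>) i j = (if nondegenerate N n (row_vec N \<omega>) then
     (if i = j then 1 else 0) - (\<Sum>l=1..n. gs N (row_vec N \<omega>) l i * gs N (row_vec N \<omega>) l j)
     else proj_entry N (kernel N n unit_vec) i j)" for \<omega>
  proof (cases "nondegenerate N n (row_vec N \<omega>)")
    case True
    have "proj_entry N (kernel N n (gs N (row_vec N \<omega>))) i j = (if i = j then 1 else 0) - (\<Sum>l=1..n. gs N (row_vec N \<omega>) l i * gs N (row_vec N \<omega>) l j)"
      by (rule kernel_orthonormal(2)[OF _ _ ij]) (use gs_orthonormal[OF row_Rvec True order_refl] in blast)+
    thus ?thesis using True kernel_gs[OF True row_Rvec] by (simp add: kernel_space_def)
  qed (simp add: kernel_space_def)
  note [measurable] = gs_measurable nondegenerate_set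
  show "(\<lambda>\<omega>. proj_entry N (kernel_space N n \<omega>) i j) \<in> borel_measurable (gauss_matrix n N)"
    unfolding e by measurable
qed

lemma stdn_singleton: "emeasure stdn {a} = 0"
proof -
  have "AE x in lborel. x \<in> {a} \<longrightarrow> ennreal (std_normal_density x) = 0"
    by (rule AE_mp[OF AE_lborel_singleton[of a]]) auto
  hence "{a} \<in> null_sets stdn" unfolding stdn_def by (subst null_sets_density_iff) auto
  thus ?thesis by auto
qed

text \<open>
  If the unit vector \<open>e\<^sub>i\<close> is not in the span of the previous rows, then moving the entry
  \<open>(j, i)\<close> moves row \<open>j\<close> out of that span; comparing traces, such an \<open>i\<close> exists since \<open>j \<le> N\<close>.
\<close>

lemma AE_nondegenerate:
  assumes nN: "n \<le> N"
  shows "AE \<omega> in gauss_matrix n N. nondegenerate N n (row_vec N \<omega>)"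
proof -
  let ?K = "{1..n} \<times> {1..N}"
  interpret S: product_sigma_finite "\<lambda>_::nat\<times>nat. stdn"
    unfolding product_sigma_finite_def using prob_space_stdn by (auto intro: prob_space_imp_sigma_finite)
  \<comment> \<open>Row j is dependent on its predecessors although the unit vector i is not: these
    finitely many events cover the degenerate matrices.\<close>
  define Bad where "Bad j i = {\<omega>\<in>space (gauss_matrix n N). gs_res N (row_vec N \<omega>) j (row_vec N \<omega> j) = 0 \<and> gs_res N (row_vec N \<omega>) j (unit_vec i) \<noteq> 0}" for j i
  have null: "emeasure (gauss_matrix n N) (Bad j i) = 0" and BadM: "Bad j i \<in> sets (gauss_matrix n N)" if j: "j \<in> {1..n}" and i: "i \<in> {1..N}" for i j
  proof -
    have "Bad j i = {\<omega>\<in>space (gauss_matrix n N). gs_res N (row_vec N \<omega>) j (row_vec N \<omega> j) = 0} - {\<omega>\<in>space (gauss_matrix n N). gs_res N (row_vec N \<omega>) j (unit_vec i) = 0}"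
      by (auto simp: Bad_def)
    also have "\<dots> \<in> sets (gauss_matrix n N)"
      by (intro sets.Diff gs_res_zero_set j row_measurable) auto
    finally show BM: "Bad j i \<in> sets (gauss_matrix n N)" .
    have K: "insert (j, i) (?K - {(j, i)}) = ?K" using i j by auto
    have row_upd: "row_vec N (fun_upd \<omega> (j, i) y) l = (if l = j then row_vec N (fun_upd \<omega> (j, i) 0) j + y *\<^sub>R unit_vec i else row_vec N \<omega> l)" for \<omega> y l
      using i by (auto simp: row_vec_def fun_eq_iff fun_apply_simps unit_vec_def)
    \<comment> \<open>Changing the entry (j, i) affects row j only, hence none of the earlier
      Gram-Schmidt vectors.\<close>
    have gs_upd: "gs N (row_vec N (fun_upd \<omega> (j, i) y)) l = gs N (row_vec N \<omega>) l" if "l \<in> {1..<j}" for \<omega> y l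
      by (rule gs_cong) (use that in \<open>simp add: row_upd\<close>)
    have res_upd: "gs_res N (row_vec N (fun_upd \<omega> (j, i) y)) j x = gs_res N (row_vec N \<omega>) j x" for \<omega> y x
      unfolding gs_res_def by (simp add: gs_upd)
    have res_add: "gs_res N g j (x + y *\<^sub>R z) = gs_res N g j x + y *\<^sub>R gs_res N g j z" for g x y z
      unfolding gs_res_def ip_add ip_scale
      by (simp add: scaleR_add_left sum.distrib algebra_simps scaleR_sum_right)
    \<comment> \<open>As a function of the entry (j, i) the residual of row j is affine with nonzero
      slope, so at most one value is bad, and points have measure 0.\<close>
    have one: "(\<integral>\<^sup>+y. indicator (Bad j i) (fun_upd \<omega> (j, i) y) \<partial>stdn) = 0" for \<omega>
    proof -
      have "\<exists>a. \<forall>y. fun_upd \<omega> (j, i) y \<in> Bad j i \<longrightarrow> y = a"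
      proof (rule ccontr)
        assume "\<nexists>a. \<forall>y. fun_upd \<omega> (j, i) y \<in> Bad j i \<longrightarrow> y = a"
        then obtain y y' where y: "fun_upd \<omega> (j, i) y \<in> Bad j i" "fun_upd \<omega> (j, i) y' \<in> Bad j i" "y \<noteq> y'" by metis
        let ?v = "gs_res N (row_vec N \<omega>) j (unit_vec i)" and ?r = "gs_res N (row_vec N \<omega>) j (row_vec N (fun_upd \<omega> (j, i) 0) j)"
        have z: "?r + t *\<^sub>R ?v = 0" if "fun_upd \<omega> (j, i) t \<in> Bad j i" for t
        proof -
          have "gs_res N (row_vec N (fun_upd \<omega> (j, i) t)) j (row_vec N (fun_upd \<omega> (j, i) t) j) = 0" using that by (simp add: Bad_def)
          thus ?thesis unfolding res_upd row_upd[of \<omega> t j] by (simp add: res_add)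
        qed
        have "(y - y') *\<^sub>R ?v = (?r + y *\<^sub>R ?v) - (?r + y' *\<^sub>R ?v)" by (simp add: scaleR_diff_left)
        also have "\<dots> = 0" using z y by simp
        finally have "?v = 0" using y(3) by simp
        moreover have "?v \<noteq> 0" using y(1) by (simp add: Bad_def res_upd)
        ultimately show False by simp
      qed
      then obtain a where a: "\<And>y. fun_upd \<omega> (j, i) y \<in> Bad j i \<Longrightarrow> y = a" by blast
      have "(\<integral>\<^sup>+y. indicator (Bad j i) (fun_upd \<omega> (j, i) y) \<partial>stdn) \<le> (\<integral>\<^sup>+y. indicator {a} y \<partial>stdn)"
        by (rule nn_integral_mono) (use a in \<open>auto simp: indicator_def\<close>)
      also have "\<dots> = 0" by (simp add: stdn_singleton)
      finally show ?thesis by simp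
    qed
    have "emeasure (gauss_matrix n N) (Bad j i) = (\<integral>\<^sup>+\<omega>. indicator (Bad j i) \<omega> \<partial>PiM (insert (j, i) (?K - {(j, i)})) (\<lambda>_. stdn))"
      unfolding K using BM by (simp add: gauss_def)
    also have "\<dots> = (\<integral>\<^sup>+\<omega>. \<integral>\<^sup>+y. indicator (Bad j i) (fun_upd \<omega> (j, i) y) \<partial>stdn \<partial>PiM (?K - {(j, i)}) (\<lambda>_. stdn))"
    proof (rule S.product_nn_integral_insert)
      show "(indicator (Bad j i) :: _ \<Rightarrow> ennreal) \<in> borel_measurable (PiM (insert (j, i) (?K - {(j, i)})) (\<lambda>_. stdn))"
        unfolding K gauss_def[symmetric] using BM by (rule borel_measurable_indicator)
    qed auto
    also have "\<dots> = 0" by (simp add: one)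
    finally show "emeasure (gauss_matrix n N) (Bad j i) = 0" .
  qed
  have "(\<Union>j\<in>{1..n}. \<Union>i\<in>{1..N}. Bad j i) \<in> null_sets (gauss_matrix n N)"
    by (intro null_sets_UN' countable_finite) (use null BadM in auto)
  moreover have "{\<omega>\<in>space (gauss_matrix n N). \<not> nondegenerate N n (row_vec N \<omega>)} \<subseteq> (\<Union>j\<in>{1..n}. \<Union>i\<in>{1..N}. Bad j i)"
  proof
    fix \<omega> assume "\<omega> \<in> {\<omega>\<in>space (gauss_matrix n N). \<not> nondegenerate N n (row_vec N \<omega>)}"
    then obtain j where \<omega>: "\<omega> \<in> space (gauss_matrix n N)" and j: "j \<in> {1..n}" "gs_res N (row_vec N \<omega>) j (row_vec N \<omega> j) = 0"
      by (auto simp: nondegenerate_def)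
    have "\<exists>i\<in>{1..N}. gs_res N (row_vec N \<omega>) j (unit_vec i) \<noteq> 0"
    proof (rule ccontr)
      let ?q = "gs N (row_vec N \<omega>)"
      assume "\<not> (\<exists>i\<in>{1..N}. gs_res N (row_vec N \<omega>) j (unit_vec i) \<noteq> 0)"
      hence z: "gs_res N (row_vec N \<omega>) j (unit_vec i) = 0" if "i \<in> {1..N}" for i using that by blast
      have "1 = (\<Sum>l\<in>{1..<j}. ?q l i * ?q l i)" if i: "i \<in> {1..N}" for i
      proof -
        have "0 = gs_res N (row_vec N \<omega>) j (unit_vec i) i" using z[OF i] by (simp add: fun_apply_simps)
        also have "\<dots> = unit_vec i i - (\<Sum>l\<in>{1..<j}. ip N (unit_vec i) (?q l) * ?q l i)"
          unfolding gs_res_def fun_apply_simps sum_fun_apply scaleR_fun_apply by simp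
        also have "\<dots> = 1 - (\<Sum>l\<in>{1..<j}. ?q l i * ?q l i)" using i by (simp only: ip_unit_vec(2)) (simp add: unit_vec_def)
        finally show ?thesis by simp
      qed
      hence "real N = (\<Sum>i=1..N. \<Sum>l\<in>{1..<j}. ?q l i * ?q l i)" by simp
      also have "\<dots> = (\<Sum>l\<in>{1..<j}. ip N (?q l) (?q l))" unfolding ip_def by (rule sum.swap)
      also have "\<dots> \<le> (\<Sum>l\<in>{1..<j}. 1)" by (intro sum_mono gs_norm_le)
      also have "\<dots> < real N" using j nN by auto
      finally show False by simp
    qed
    thus "\<omega> \<in> (\<Union>j\<in>{1..n}. \<Union>i\<in>{1..N}. Bad j i)" using \<omega> j by (auto simp: Bad_def)
  qed
  ultimately show ?thesis by (intro AE_I') auto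
qed

section \<open>Equivariance of the kernel under orthogonal maps\<close>

lemma orthogonal_maps_onb:
  assumes U: "U \<in> orthogonal_maps N"
  shows "onb N (Rvec N) (U ` unit_vec ` {1..N})"
proof -
  let ?B = "U ` unit_vec ` {1..N}"
  have o: "orthonormal N ?B" by (rule orthonormal_image(1)[OF U orthonormal_unit_vec]) simp
  have c: "card ?B = N"
    using card_image[OF orthonormal_image(2)[OF U orthonormal_unit_vec[of N N]]] card_image[OF inj_on_unit_vec, of "{1..N}"] by simp
  obtain B where B: "onb N (Rvec N) B" "?B \<subseteq> B"
    using onb_extend[OF subspace_Rvec order_refl o] o by (auto simp: orthonormal_def)
  have "?B = B" using c onb_Rvec_card[OF B(1)] B by (intro card_subset_eq) (auto simp: onb_def orthonormal_def)
  thus ?thesis using B by simp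
qed

lemma orthogonal_maps_surj:
  assumes U: "U \<in> orthogonal_maps N" shows "U ` Rvec N = Rvec N"
proof
  show "U ` Rvec N \<subseteq> Rvec N" using U by (auto simp: orthogonal_maps_def)
  have lin: "linear U" using U by (simp add: orthogonal_maps_def)
  show "Rvec N \<subseteq> U ` Rvec N"
  proof
    fix x assume x: "x \<in> Rvec N"
    let ?V = "unit_vec ` {1..N}"
    have "x = proj N (U ` ?V) x" using orthogonal_maps_onb[OF U] x by (simp add: onb_def)
    also have "\<dots> = (\<Sum>b\<in>?V. ip N x (U b) *\<^sub>R U b)"
      unfolding proj_def using sum.reindex[OF orthonormal_image(2)[OF U orthonormal_unit_vec[of N N]]] by simp
    also have "\<dots> = U (\<Sum>b\<in>?V. ip N x (U b) *\<^sub>R b)" by (simp add: linear_sum[OF lin] linear_scale[OF lin])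
    finally have "x = U (\<Sum>b\<in>?V. ip N x (U b) *\<^sub>R b)" .
    moreover have "(\<Sum>b\<in>?V. ip N x (U b) *\<^sub>R b) \<in> Rvec N"
      by (intro subspace_sum subspace_scale subspace_Rvec) (auto intro: unit_vec_Rvec)
    ultimately show "x \<in> U ` Rvec N" by blast
  qed
qed

text \<open>The columns are the images of the unit vectors; orthonormality of the rows is the
  expansion of a unit vector in the image basis.\<close>

lemma orthogonal_maps_orthmat:
  assumes U: "U \<in> orthogonal_maps N" shows "orthmat {1..N} (\<lambda>i k. U (unit_vec k) i)"
  unfolding orthmat_def
proof (intro conjI ballI)
  fix k l assume kl: "k \<in> {1..N}" "l \<in> {1..N}"
  have "(\<Sum>m=1..N. U (unit_vec k) m * U (unit_vec l) m) = ip N (U (unit_vec k)) (U (unit_vec l))" by (simp add: ip_def)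
  also have "\<dots> = ip N (unit_vec k) (unit_vec l)" by (rule orthogonal_maps_ip[OF U]) (use kl in \<open>auto intro: unit_vec_Rvec\<close>)
  also have "\<dots> = unit_vec k l" by (rule ip_unit_vec(1)[OF kl(2)])
  finally show "(\<Sum>m=1..N. U (unit_vec k) m * U (unit_vec l) m) = (if k = l then 1 else 0)" by (simp add: unit_vec_def)
  have inj: "inj_on U (unit_vec ` {1..N})" by (rule orthonormal_image(2)[OF U orthonormal_unit_vec]) simp
  have "unit_vec k l = proj N (U ` unit_vec ` {1..N}) (unit_vec k) l"
    using orthogonal_maps_onb[OF U] unit_vec_Rvec[OF kl(1)] by (simp add: onb_def)
  also have "\<dots> = (\<Sum>m=1..N. ip N (unit_vec k) (U (unit_vec m)) * U (unit_vec m) l)"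
    unfolding proj_apply sum.reindex[OF inj] sum.reindex[OF inj_on_unit_vec] by simp
  also have "\<dots> = (\<Sum>m=1..N. U (unit_vec m) k * U (unit_vec m) l)" by (simp only: ip_unit_vec(2)[OF kl(1)])
  finally show "(\<Sum>m=1..N. U (unit_vec m) k * U (unit_vec m) l) = (if k = l then 1 else 0)" by (auto simp: unit_vec_def)
qed

lemma orthogonal_maps_apply:
  assumes U: "U \<in> orthogonal_maps N" and x: "x \<in> Rvec N"
  shows "U x i = (\<Sum>k=1..N. U (unit_vec k) i * x k)"
proof -
  have lin: "linear U" using U by (simp add: orthogonal_maps_def)
  have "U x = U (\<Sum>k=1..N. x k *\<^sub>R unit_vec k)" using Rvec_expand[OF x] by simp
  also have "\<dots> = (\<Sum>k=1..N. x k *\<^sub>R U (unit_vec k))" by (simp add: linear_sum[OF lin] linear_scale[OF lin])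
  finally show ?thesis by (simp add: sum_fun_apply mult.commute)
qed

lemma kernel_image:
  assumes U: "U \<in> orthogonal_maps N" and g: "\<And>j. j \<in> {1..n} \<Longrightarrow> g j \<in> Rvec N"
  shows "kernel N n (\<lambda>j. U (g j)) = U ` kernel N n g"
proof
  show "U ` kernel N n g \<subseteq> kernel N n (\<lambda>j. U (g j))"
    using U g by (auto simp: kernel_def orthogonal_maps_def orthogonal_maps_ip[OF U])
  show "kernel N n (\<lambda>j. U (g j)) \<subseteq> U ` kernel N n g"
  proof
    fix x assume x: "x \<in> kernel N n (\<lambda>j. U (g j))"
    hence "x \<in> U ` Rvec N" using orthogonal_maps_surj[OF U] by (auto simp: kernel_def)
    then obtain y where y: "y \<in> Rvec N" "x = U y" by blast
    hence "y \<in> kernel N n g" using x g by (auto simp: kernel_def orthogonal_maps_ip[OF U])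
    thus "x \<in> U ` kernel N n g" using y by blast
  qed
qed

lemma kernel_cong: "(\<And>j. j \<in> {1..n} \<Longrightarrow> g j = g' j) \<Longrightarrow> kernel N n g = kernel N n g'"
  by (auto simp: kernel_def)

definition vec_of :: "nat \<Rightarrow> (nat \<Rightarrow> real) \<Rightarrow> nat \<Rightarrow> real"
  where "vec_of N h = (\<lambda>i. if i \<in> {1..N} then h i else 0)"

lemma vec_of_Rvec: "vec_of N h \<in> Rvec N"
  by (auto simp: vec_of_def Rvec_def)

lemma orthogonal_maps_vec_of:
  assumes U: "U \<in> orthogonal_maps N"
  shows "U (vec_of N h) = vec_of N (\<lambda>i. \<Sum>l=1..N. U (unit_vec l) i * h l)"
proof
  fix i
  have UR: "U (vec_of N h) \<in> Rvec N" using U vec_of_Rvec by (auto simp: orthogonal_maps_def)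
  have "U (vec_of N h) i = (\<Sum>l=1..N. U (unit_vec l) i * vec_of N h l)" by (rule orthogonal_maps_apply[OF U vec_of_Rvec])
  also have "\<dots> = (\<Sum>l=1..N. U (unit_vec l) i * h l)" by (rule sum.cong) (auto simp: vec_of_def)
  finally show "U (vec_of N h) i = vec_of N (\<lambda>i. \<Sum>l=1..N. U (unit_vec l) i * h l) i"
    using UR unfolding vec_of_def Rvec_def by auto
qed

text \<open>Equivariance carries the invariance of \<open>G\<close> over to the image law, and
  uniqueness identifies that law. The identity is asked for almost surely, so that default values on
  null sets do no harm.\<close>

lemma haar_grassmannian_eq_distr:
  assumes G: "prob_space G" and f: "f \<in> G \<rightarrow>\<^sub>M grassmannian_borel N n"
    and T: "\<And>U. U \<in> orthogonal_maps N \<Longrightarrow> T U \<in> G \<rightarrow>\<^sub>M G" "\<And>U. U \<in> orthogonal_maps N \<Longrightarrow> distr G G (T U) = G"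
    and eq: "\<And>U. U \<in> orthogonal_maps N \<Longrightarrow> AE x in G. U ` f x = f (T U x)"
  shows "haar_grassmannian N n = distr G (grassmannian_borel N n) f"
proof (rule haar_grassmannian_eqI)
  let ?B = "grassmannian_borel N n" and ?D = "distr G (grassmannian_borel N n) f"
  show "prob_space ?D" by (rule prob_space.prob_space_distr[OF G f])
  fix U assume U: "U \<in> orthogonal_maps N"
  have Um: "(\<lambda>E. U ` E) \<in> ?B \<rightarrow>\<^sub>M ?B" by (rule image_measurable[OF U])
  have "distr ?D ?D (\<lambda>E. U ` E) = distr ?D ?B (\<lambda>E. U ` E)" by (rule distr_cong) auto
  also have "\<dots> = distr G ?B ((\<lambda>E. U ` E) \<circ> f)" by (rule distr_distr[OF Um f])
  also have "\<dots> = distr G ?B (f \<circ> T U)"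
    by (rule distr_cong_AE) (use eq[OF U] measurable_comp[OF f Um] measurable_comp[OF T(1)[OF U] f] in auto)
  also have "\<dots> = distr (distr G G (T U)) ?B f" by (rule distr_distr[OF f T(1)[OF U], symmetric])
  finally show "distr ?D ?D (\<lambda>E. U ` E) = ?D" by (simp add: T(2)[OF U])
qed simp

lemma haar_kernel:
  assumes nN: "n \<le> N"
  shows "haar_grassmannian N n = distr (gauss_matrix n N) (grassmannian_borel N n) (kernel_space N n)"
proof -
  let ?G = "gauss_matrix n N"
  \<comment> \<open>The Kronecker product of the identity with \<open>U\<close>: every row of the
    matrix is rotated by \<open>U\<close>.\<close>
  define t where "t U k l = (if fst k = fst l then 1 else 0) * U (unit_vec (snd l)) (snd k)"
    for U :: "(nat \<Rightarrow> real) \<Rightarrow> nat \<Rightarrow> real" and k l :: "nat \<times> nat"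
  define T where "T U = matvec ({1..n} \<times> {1..N}) (t U)" for U
  have fin: "finite ({1..n} \<times> {1..N})" by simp
  have t: "orthmat ({1..n} \<times> {1..N}) (t U)" if "U \<in> orthogonal_maps N" for U
    unfolding t_def by (rule orthmat_kron[OF orthmat_id orthogonal_maps_orthmat[OF that]]) simp
  have Tm: "T U \<in> ?G \<rightarrow>\<^sub>M ?G" for U
    using matvec_measurable[OF fin, of "t U"] by (simp add: T_def measurable_cong_sets[OF sets_gauss sets_gauss])
  have TG: "distr ?G ?G (T U) = ?G" if "U \<in> orthogonal_maps N" for U unfolding T_def by (rule gauss_orthmat[OF fin t[OF that]])
  have rowT: "row_vec N (T U \<omega>) j = U (row_vec N \<omega> j)" if U: "U \<in> orthogonal_maps N" and j: "j \<in> {1..n}" for U \<omega> j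
  proof -
    have "T U \<omega> (j, i) = (\<Sum>l=1..N. U (unit_vec l) i * \<omega> (j, l))" if "i \<in> {1..N}" for i
      unfolding T_def t_def by (rule matvec_kron_id(1)) (use j that in auto)
    hence "row_vec N (T U \<omega>) j = vec_of N (\<lambda>i. \<Sum>l=1..N. U (unit_vec l) i * \<omega> (j, l))"
      unfolding row_vec_def vec_of_def by auto
    also have "\<dots> = U (row_vec N \<omega> j)" unfolding orthogonal_maps_vec_of[OF U, symmetric] by (simp add: row_vec_def vec_of_def)
    finally show ?thesis .
  qed
  have AE1: "AE \<omega> in ?G. nondegenerate N n (row_vec N \<omega>)" by (rule AE_nondegenerate[OF nN])
  show ?thesis
  proof (rule haar_grassmannian_eq_distr[OF prob_space_gauss kernel_space_measurable[OF nN] Tm TG])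
    fix U assume U: "U \<in> orthogonal_maps N"
    \<comment> \<open>The rotated matrix has the same law, so it too is almost surely
      nondegenerate.\<close>
    have "AE \<omega> in distr ?G ?G (T U). nondegenerate N n (row_vec N \<omega>)" unfolding TG[OF U] by (rule AE1)
    hence "AE \<omega> in ?G. nondegenerate N n (row_vec N (T U \<omega>))" by (subst (asm) AE_distr_iff[OF Tm nondegenerate_set])
    with AE1 show "AE \<omega> in ?G. U ` kernel_space N n \<omega> = kernel_space N n (T U \<omega>)"
    proof eventually_elim
      case (elim \<omega>)
      have "U ` kernel N n (row_vec N \<omega>) = kernel N n (\<lambda>j. U (row_vec N \<omega> j))"
        by (rule kernel_image[OF U row_Rvec, symmetric])
      also have "\<dots> = kernel N n (row_vec N (T U \<omega>))" by (rule kernel_cong) (rule rowT[OF U, symmetric])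
      finally show ?case using elim by (simp add: kernel_space_def)
    qed
  qed
qed

section \<open>Lines spanned by a Gaussian vector\<close>

text \<open>The zero vector spans no line; \<open>unit_vec 1\<close> is the default on this null
  event.\<close>

definition line_space :: "nat \<Rightarrow> (nat \<Rightarrow> real) \<Rightarrow> (nat \<Rightarrow> real) set"
  where "line_space N h = span {if vec_of N h = 0 then unit_vec 1 else vec_of N h}"

lemma line_onb:
  assumes x: "x \<in> Rvec N" "x \<noteq> 0"
  shows "onb N (span {x}) {(1 / sqrt (ip N x x)) *\<^sub>R x}" "span {x} \<subseteq> Rvec N"
    "ip N x x > 0"
proof -
  show pos: "ip N x x > 0" using ip_self_eq_0[OF x(1)] x(2) ip_self_nonneg[of N x] by force
  show sub: "span {x} \<subseteq> Rvec N" by (rule span_minimal) (use x subspace_Rvec in auto)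
  have sq: "1 / sqrt (ip N x x) * (1 / sqrt (ip N x x)) = 1 / ip N x x" using pos by (simp add: field_simps)
  show "onb N (span {x}) {(1 / sqrt (ip N x x)) *\<^sub>R x}" unfolding onb_def
  proof (intro conjI ballI)
    show "{(1 / sqrt (ip N x x)) *\<^sub>R x} \<subseteq> span {x}" by (auto intro: span_scale span_base)
    thus "orthonormal N {(1 / sqrt (ip N x x)) *\<^sub>R x}" using sub pos sq unfolding orthonormal_def
      by (auto simp: ip_scale field_simps)
    fix y assume "y \<in> span {x}"
    then obtain k where k: "y = k *\<^sub>R x" by (auto simp: span_singleton)
    show "proj N {(1 / sqrt (ip N x x)) *\<^sub>R x} y = y"
      unfolding proj_def k using pos sq by (simp add: ip_scale field_simps)
  qed
qed

lemma line_space_vec: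
  assumes "N \<ge> 1"
  defines "v h \<equiv> (if vec_of N h = 0 then unit_vec 1 else vec_of N h)"
  shows "v h \<in> Rvec N" "v h \<noteq> 0" "line_space N h = span {v h}"
proof -
  show "v h \<in> Rvec N" using assms vec_of_Rvec by (auto intro: unit_vec_Rvec)
  show "v h \<noteq> 0"
  proof (cases "vec_of N h = 0")
    case True
    have "unit_vec 1 1 \<noteq> (0 :: nat \<Rightarrow> real) 1" by (simp add: unit_vec_def fun_apply_simps)
    thus ?thesis using True unfolding v_def by metis
  qed (simp add: v_def)
  show "line_space N h = span {v h}" by (simp add: line_space_def v_def)
qed

lemma line_space_grassmannian:
  assumes "N \<ge> 1" shows "line_space N h \<in> grassmannian N (N - 1)"
  using line_onb[OF line_space_vec(1,2)[OF assms, of h]] dim_orthonormal[OF subspace_span] assms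
  unfolding grassmannian_def line_space_vec(3)[OF assms] by auto

lemma gauss_vec_zero_set: "{h\<in>space (gauss {1..N}). vec_of N h = 0} \<in> sets (gauss {1..N})"
proof -
  have [measurable]: "(\<lambda>h. vec_of N h i) \<in> borel_measurable (gauss {1..N})" for i
    unfolding vec_of_def by (intro measurable_if_const gauss_component_measurable)
  show ?thesis unfolding fun_zero_iff by measurable
qed

lemma line_space_measurable:
  assumes N: "N \<ge> 1" shows "line_space N \<in> gauss {1..N} \<rightarrow>\<^sub>M grassmannian_borel N (N - 1)"
proof (rule measurable_grassmannian_borelI)
  show "line_space N h \<in> grassmannian N (N - 1)" for h by (rule line_space_grassmannian[OF N])
  fix i j assume ij: "i \<in> {1..N}" "j \<in> {1..N}"
  define v where "v h = (if vec_of N h = 0 then unit_vec 1 else vec_of N h)" for h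
  note lv = line_space_vec[OF N, folded v_def]
  have e: "proj_entry N (line_space N h) i j = v h i * v h j / ip N (v h) (v h)" for h
    unfolding lv(3) proj_entry_onb[OF subspace_span line_onb(2,1)[OF lv(1,2)]] using line_onb(3)[OF lv(1,2), of h]
    by (simp add: field_simps abs_of_pos)
  note [measurable] = gauss_vec_zero_set
  have [measurable]: "(\<lambda>h. vec_of N h i) \<in> borel_measurable (gauss {1..N})" for i
    unfolding vec_of_def by (intro measurable_if_const gauss_component_measurable)
  have [measurable]: "(\<lambda>h. v h i) \<in> borel_measurable (gauss {1..N})" for i
    unfolding v_def if_distrib[of "\<lambda>f. f i"] by measurable
  show "(\<lambda>h. proj_entry N (line_space N h) i j) \<in> borel_measurable (gauss {1..N})"
    unfolding e ip_def by measurable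
qed

lemma AE_gauss_vec_nonzero:
  assumes N: "N \<ge> 1" shows "AE h in gauss {1..N}. vec_of N h \<noteq> 0"
proof -
  interpret S: product_prob_space "\<lambda>_::nat. stdn" "{1..N}"
    unfolding product_prob_space_def product_prob_space_axioms_def product_sigma_finite_def
    using prob_space_stdn by (auto intro: prob_space_imp_sigma_finite)
  have d: "distr (gauss {1..N}) stdn (\<lambda>h. h 1) = stdn"
    unfolding gauss_def by (rule distr_PiM_component) (use N prob_space_stdn in auto)
  have m: "(\<lambda>h. h 1) \<in> gauss {1..N} \<rightarrow>\<^sub>M stdn"
    unfolding gauss_def by (rule measurable_component_singleton) (use N in auto)
  have "AE x in stdn. x \<noteq> 0" by (rule AE_I[of _ _ "{0}"]) (auto simp: stdn_singleton)
  hence "AE x in distr (gauss {1..N}) stdn (\<lambda>h. h 1). x \<noteq> 0" by (subst d)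
  hence "AE h in gauss {1..N}. h 1 \<noteq> 0" by (subst (asm) AE_distr_iff[OF m]) auto
  thus ?thesis
  proof eventually_elim
    case (elim h)
    show "vec_of N h \<noteq> 0"
    proof
      assume "vec_of N h = 0"
      hence "vec_of N h 1 = 0" by (simp add: fun_apply_simps)
      thus False using elim N by (simp add: vec_of_def)
    qed
  qed
qed

lemma haar_line:
  assumes N: "N \<ge> 1"
  shows "haar_grassmannian N (N - 1) = distr (gauss {1..N}) (grassmannian_borel N (N - 1)) (line_space N)"
proof -
  let ?G = "gauss {1..N}"
  define T where "T U = matvec {1..N} (\<lambda>i k. U (unit_vec k) i)" for U :: "(nat \<Rightarrow> real) \<Rightarrow> nat \<Rightarrow> real"
  have fin: "finite {1..N}" by simp
  have Tm: "T U \<in> ?G \<rightarrow>\<^sub>M ?G" for U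
    using matvec_measurable[OF fin, of "\<lambda>i k. U (unit_vec k) i"] by (simp add: T_def measurable_cong_sets[OF sets_gauss sets_gauss])
  have TG: "distr ?G ?G (T U) = ?G" if "U \<in> orthogonal_maps N" for U
    unfolding T_def by (rule gauss_orthmat[OF fin orthogonal_maps_orthmat[OF that]])
  have vT: "vec_of N (T U h) = U (vec_of N h)" if "U \<in> orthogonal_maps N" for U h
    unfolding orthogonal_maps_vec_of[OF that] by (auto simp: T_def matvec_def vec_of_def)
  have AE1: "AE h in ?G. vec_of N h \<noteq> 0" by (rule AE_gauss_vec_nonzero[OF N])
  have s: "{h\<in>space ?G. vec_of N h \<noteq> 0} \<in> sets ?G"
    using sets.compl_sets[OF gauss_vec_zero_set[of N]]
    by (rule back_subst[of "\<lambda>A. A \<in> sets ?G"]) auto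
  show ?thesis
  proof (rule haar_grassmannian_eq_distr[OF prob_space_gauss line_space_measurable[OF N] Tm TG])
    fix U assume U: "U \<in> orthogonal_maps N"
    hence lin: "linear U" by (simp add: orthogonal_maps_def)
    have "AE h in distr ?G ?G (T U). vec_of N h \<noteq> 0" unfolding TG[OF U] by (rule AE1)
    hence "AE h in ?G. vec_of N (T U h) \<noteq> 0" by (subst (asm) AE_distr_iff[OF Tm s])
    with AE1 show "AE h in ?G. U ` line_space N h = line_space N (T U h)"
      by eventually_elim (simp add: line_space_def vT[OF U] linear_span_image[OF lin, symmetric])
  qed
qed

section \<open>Measurability of the section radius\<close>


lemma p_ellipsoid_coord_le:
  assumes p: "p > 0" and \<sigma>: "\<forall>i\<in>{1..N}. \<sigma> i > 0" and x: "x \<in> p_ellipsoid N p \<sigma>" and i: "i \<in> {1..N}"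
  shows "\<bar>x i\<bar> \<le> \<sigma> i"
proof -
  have "(\<bar>x i\<bar> / \<sigma> i) powr p \<le> (\<Sum>i=1..N. (\<bar>x i\<bar> / \<sigma> i) powr p)"
    by (rule member_le_sum[OF i]) auto
  also have "\<dots> \<le> 1" using x by (simp add: p_ellipsoid_def)
  finally have "\<not> \<bar>x i\<bar> / \<sigma> i > 1" using powr_less_mono2[of p 1 "\<bar>x i\<bar> / \<sigma> i"] p
    by (smt (verit) powr_one_eq_one)
  thus ?thesis using bspec[OF \<sigma> i] by (simp add: field_simps not_less)
qed

lemma zero_in_ellipsoid: "0 \<in> p_ellipsoid N p \<sigma>"
  by (simp add: p_ellipsoid_def subspace_0[OF subspace_Rvec] fun_apply_simps)

lemma section_bdd:
  assumes p: "p > 0" and \<sigma>: "\<forall>i\<in>{1..N}. \<sigma> i > 0"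
  shows "bdd_above ((\<lambda>y. L2_set y {1..N}) ` (E \<inter> p_ellipsoid N p \<sigma>))"
proof (rule bdd_aboveI2)
  fix y assume "y \<in> E \<inter> p_ellipsoid N p \<sigma>"
  hence "\<bar>y i\<bar> \<le> \<sigma> i" if "i \<in> {1..N}" for i using p_ellipsoid_coord_le[OF p \<sigma>] that by blast
  hence "(\<Sum>i=1..N. \<bar>y i\<bar>) \<le> (\<Sum>i=1..N. \<sigma> i)" by (intro sum_mono) auto
  thus "L2_set y {1..N} \<le> (\<Sum>i=1..N. \<sigma> i)" using L2_set_le_sum_abs[of y "{1..N}"] by linarith
qed

lemma section_radius_greater_iff:
  assumes "p > 0" "\<forall>i\<in>{1..N}. \<sigma> i > 0" and "0 \<in> E"
  shows "t < section_radius N (p_ellipsoid N p \<sigma>) E \<longleftrightarrow> (\<exists>y\<in>E \<inter> p_ellipsoid N p \<sigma>. t < L2_set y {1..N})"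
  unfolding section_radius_def
  by (rule less_cSUP_iff) (use assms zero_in_ellipsoid section_bdd[OF assms(1,2)] in auto)

lemma section_radius_ge:
  assumes "p > 0" "\<forall>i\<in>{1..N}. \<sigma> i > 0" "y \<in> E" "y \<in> p_ellipsoid N p \<sigma>"
  shows "L2_set y {1..N} \<le> section_radius N (p_ellipsoid N p \<sigma>) E"
  unfolding section_radius_def
  by (rule cSUP_upper) (use assms section_bdd[OF assms(1,2)] in auto)

lemma section_radius_le:
  assumes "0 \<in> E" and "\<And>y. y \<in> E \<Longrightarrow> y \<in> p_ellipsoid N p \<sigma> \<Longrightarrow> L2_set y {1..N} \<le> c"
  shows "section_radius N (p_ellipsoid N p \<sigma>) E \<le> c"
  unfolding section_radius_def
  by (rule cSUP_least) (use assms zero_in_ellipsoid in auto)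

lemma L2_set_scale: "L2_set (\<lambda>i. c * x i) A = \<bar>c\<bar> * L2_set x A"
  by (simp add: L2_set_def power_mult_distrib sum_distrib_left[symmetric] real_sqrt_mult)

text \<open>Shrinking a point slightly makes the constraint strict. Both conditions are then open,
  so they can be tested on a countable dense set.\<close>

lemma section_radius_greater_iff_interior:
  assumes p: "p > 0" and \<sigma>: "\<forall>i\<in>{1..N}. \<sigma> i > 0" and E: "subspace E" "E \<subseteq> Rvec N" and t: "t \<ge> 0"
  shows "t < section_radius N (p_ellipsoid N p \<sigma>) E \<longleftrightarrow>
    (\<exists>y\<in>E. (\<Sum>i=1..N. (\<bar>y i\<bar> / \<sigma> i) powr p) < 1 \<and> t < L2_set y {1..N})"
    (is "?L \<longleftrightarrow> ?R")
proof
  assume ?R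
  thus ?L using E by (subst section_radius_greater_iff[OF p \<sigma>]) (auto simp: p_ellipsoid_def subspace_0 intro!: bexI)
next
  assume ?L
  then obtain y where y: "y \<in> E" "y \<in> p_ellipsoid N p \<sigma>" "t < L2_set y {1..N}"
    using section_radius_greater_iff[OF p \<sigma>, where E = E and t = t] E by (auto simp: subspace_0)
  define L where "L = L2_set y {1..N}"
  \<comment> \<open>The shrunk vector has norm (t + L) / 2, halfway between t and L.\<close>
  define c where "c = (t + L) / (2 * L)"
  have L: "L > t" using y by (simp add: L_def)
  have c: "0 < c" "c < 1" "t < c * L" using L t by (auto simp: c_def field_simps)
  have "(\<Sum>i=1..N. (\<bar>(c *\<^sub>R y) i\<bar> / \<sigma> i) powr p) = c powr p * (\<Sum>i=1..N. (\<bar>y i\<bar> / \<sigma> i) powr p)"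
    unfolding sum_distrib_left
  proof (rule sum.cong[OF refl])
    fix i assume i: "i \<in> {1..N}"
    have "\<bar>(c *\<^sub>R y) i\<bar> / \<sigma> i = c * (\<bar>y i\<bar> / \<sigma> i)" using c by (simp add: abs_mult)
    thus "(\<bar>(c *\<^sub>R y) i\<bar> / \<sigma> i) powr p = c powr p * (\<bar>y i\<bar> / \<sigma> i) powr p"
      by (simp only: powr_mult)
  qed
  also have "\<dots> \<le> c powr p * 1" using y(2) by (intro mult_left_mono) (auto simp: p_ellipsoid_def)
  also have "c powr p < 1 powr p" using c p by (intro powr_less_mono2) auto
  finally have "(\<Sum>i=1..N. (\<bar>(c *\<^sub>R y) i\<bar> / \<sigma> i) powr p) < 1" by simp
  moreover have "L2_set (c *\<^sub>R y) {1..N} = c * L" using L2_set_scale[of c y] c by (simp add: L_def scaleR_fun_def)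
  moreover have "c *\<^sub>R y \<in> E" by (intro subspace_scale E y)
  ultimately show ?R using c(3) by metis
qed

lemma orth_proj_entry:
  assumes E: "E \<in> grassmannian N n"
  shows "orth_proj N E x i = (\<Sum>j=1..N. proj_entry N E i j * x j)"
proof -
  note E' = grassmannianD[OF E]
  obtain B where B: "onb N E B" by (rule grassmannian_onb[OF E])
  have "orth_proj N E x i = (\<Sum>b\<in>B. \<Sum>j=1..N. x j * b j * b i)"
    unfolding orth_proj_eq_proj[OF E'(1,2) B] proj_apply ip_def sum_distrib_right ..
  also have "\<dots> = (\<Sum>j=1..N. \<Sum>b\<in>B. x j * b j * b i)" by (rule sum.swap)
  also have "\<dots> = (\<Sum>j=1..N. proj_entry N E i j * x j)"
    unfolding proj_entry_onb[OF E'(1,2) B] sum_distrib_right by (intro sum.cong) (auto simp: mult_ac)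
  finally show ?thesis .
qed

lemma orth_proj_fixed: assumes E: "E \<in> grassmannian N n" and y: "y \<in> E" shows "orth_proj N E y = y"
proof -
  obtain B where B: "onb N E B" by (rule grassmannian_onb[OF E])
  show ?thesis using orth_proj_eq_proj[OF grassmannianD(1,2)[OF E] B] B y by (simp add: onb_def)
qed

lemma orth_proj_in: assumes E: "E \<in> grassmannian N n" shows "orth_proj N E y \<in> E"
proof -
  obtain B where B: "onb N E B" by (rule grassmannian_onb[OF E])
  show ?thesis unfolding orth_proj_eq_proj[OF grassmannianD(1,2)[OF E] B]
    by (rule proj_in_subspace[OF grassmannianD(1)[OF E]]) (use B in \<open>simp add: onb_def\<close>)
qed

text \<open>Points with a common denominator, countably many in all. Their projections are dense in
  each subspace and have coordinates linear in the projection matrix.\<close>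

definition grid_vec :: "nat \<Rightarrow> (nat \<Rightarrow> int) \<Rightarrow> nat \<Rightarrow> nat \<Rightarrow> real"
  where "grid_vec N z k j = (if j \<in> {1..N} then real_of_int (z j) / real (Suc k) else 0)"

lemma floor_approx: "(\<lambda>k. real_of_int \<lfloor>real (Suc k) * a\<rfloor> / real (Suc k)) \<longlonglongrightarrow> a"
proof (rule tendsto_sandwich)
  show "eventually (\<lambda>k. a - 1 / real (Suc k) \<le> real_of_int \<lfloor>real (Suc k) * a\<rfloor> / real (Suc k)) sequentially"
  proof (intro always_eventually allI)
    fix k
    have "real (Suc k) * a - 1 \<le> real_of_int \<lfloor>real (Suc k) * a\<rfloor>" by linarith
    hence "(real (Suc k) * a - 1) / real (Suc k) \<le> real_of_int \<lfloor>real (Suc k) * a\<rfloor> / real (Suc k)"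
      by (intro divide_right_mono) auto
    thus "a - 1 / real (Suc k) \<le> real_of_int \<lfloor>real (Suc k) * a\<rfloor> / real (Suc k)" by (simp add: diff_divide_distrib)
  qed
  show "eventually (\<lambda>k. real_of_int \<lfloor>real (Suc k) * a\<rfloor> / real (Suc k) \<le> a) sequentially"
  proof (intro always_eventually allI)
    fix k
    have "real_of_int \<lfloor>real (Suc k) * a\<rfloor> \<le> real (Suc k) * a" by linarith
    hence "real_of_int \<lfloor>real (Suc k) * a\<rfloor> / real (Suc k) \<le> real (Suc k) * a / real (Suc k)"
      by (intro divide_right_mono) auto
    thus "real_of_int \<lfloor>real (Suc k) * a\<rfloor> / real (Suc k) \<le> a" by simp
  qed
  show "(\<lambda>k. a - 1 / real (Suc k)) \<longlonglongrightarrow> a"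
    using tendsto_diff[OF tendsto_const LIMSEQ_Suc[OF lim_1_over_n], of a] by simp
qed simp

lemma section_radius_greater_iff_grid:
  assumes p: "p > 0" and \<sigma>: "\<forall>i\<in>{1..N}. \<sigma> i > 0" and E: "E \<in> grassmannian N n" and t: "t \<ge> 0"
  shows "t < section_radius N (p_ellipsoid N p \<sigma>) E \<longleftrightarrow>
    (\<exists>z\<in>{1..N} \<rightarrow>\<^sub>E UNIV. \<exists>k. (\<Sum>i=1..N. (\<bar>orth_proj N E (grid_vec N z k) i\<bar> / \<sigma> i) powr p) < 1 \<and>
       t < L2_set (orth_proj N E (grid_vec N z k)) {1..N})"
    (is "?L \<longleftrightarrow> ?R")
proof
  note iff = section_radius_greater_iff_interior[OF p \<sigma> grassmannianD(1,2)[OF E] t]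
  show ?L if ?R unfolding iff using orth_proj_in[OF E] that by blast
  assume ?L
  then obtain y where y: "y \<in> E" "(\<Sum>i=1..N. (\<bar>y i\<bar> / \<sigma> i) powr p) < 1" "t < L2_set y {1..N}"
    using iff by blast
  \<comment> \<open>Rounding down (k + 1) y coordinatewise gives grid points converging to y; their
    projections converge to y too, because y lies in \<open>E\<close>.\<close>
  define z where "z k = (\<lambda>j\<in>{1..N}. \<lfloor>real (Suc k) * y j\<rfloor>)" for k
  have g: "(\<lambda>k. grid_vec N (z k) k j) \<longlonglongrightarrow> y j" if "j \<in> {1..N}" for j
    unfolding grid_vec_def z_def using that floor_approx[of "y j"] by simp
  have P: "(\<lambda>k. orth_proj N E (grid_vec N (z k) k) i) \<longlonglongrightarrow> y i" for i
  proof -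
    have "(\<lambda>k. \<Sum>j=1..N. proj_entry N E i j * grid_vec N (z k) k j) \<longlonglongrightarrow> (\<Sum>j=1..N. proj_entry N E i j * y j)"
      by (intro tendsto_sum tendsto_mult tendsto_const g)
    thus ?thesis unfolding orth_proj_entry[OF E, symmetric] orth_proj_fixed[OF E y(1)] .
  qed
  have "(\<lambda>k. \<Sum>i=1..N. (\<bar>orth_proj N E (grid_vec N (z k) k) i\<bar> / \<sigma> i) powr p) \<longlonglongrightarrow> (\<Sum>i=1..N. (\<bar>y i\<bar> / \<sigma> i) powr p)"
  proof (rule tendsto_sum)
    fix i assume i: "i \<in> {1..N}"
    have "(\<lambda>k. \<bar>orth_proj N E (grid_vec N (z k) k) i\<bar> / \<sigma> i) \<longlonglongrightarrow> \<bar>y i\<bar> / \<sigma> i"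
      by (intro tendsto_divide tendsto_rabs P tendsto_const) (use bspec[OF \<sigma> i] in simp)
    thus "(\<lambda>k. (\<bar>orth_proj N E (grid_vec N (z k) k) i\<bar> / \<sigma> i) powr p) \<longlonglongrightarrow> (\<bar>y i\<bar> / \<sigma> i) powr p"
      by (rule tendsto_powr') (use p bspec[OF \<sigma> i] in \<open>auto intro!: always_eventually\<close>)
  qed
  from order_tendstoD(2)[OF this y(2)]
  have 1: "eventually (\<lambda>k. (\<Sum>i=1..N. (\<bar>orth_proj N E (grid_vec N (z k) k) i\<bar> / \<sigma> i) powr p) < 1) sequentially" .
  have "(\<lambda>k. L2_set (orth_proj N E (grid_vec N (z k) k)) {1..N}) \<longlonglongrightarrow> L2_set y {1..N}"
    unfolding L2_set_def by (intro tendsto_real_sqrt tendsto_sum tendsto_power P)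
  from order_tendstoD(1)[OF this y(3)]
  have 2: "eventually (\<lambda>k. t < L2_set (orth_proj N E (grid_vec N (z k) k)) {1..N}) sequentially" .
  obtain k where "(\<Sum>i=1..N. (\<bar>orth_proj N E (grid_vec N (z k) k) i\<bar> / \<sigma> i) powr p) < 1"
    "t < L2_set (orth_proj N E (grid_vec N (z k) k)) {1..N}"
    using eventually_happens[OF eventually_conj[OF 1 2]] by auto
  moreover have "z k \<in> {1..N} \<rightarrow>\<^sub>E UNIV" by (auto simp: z_def)
  ultimately show ?R by blast
qed

lemma section_radius_measurable:
  assumes p: "p > 0" and \<sigma>: "\<forall>i\<in>{1..N}. \<sigma> i > 0"
  shows "(\<lambda>E. section_radius N (p_ellipsoid N p \<sigma>) E) \<in> borel_measurable (grassmannian_borel N n)"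
proof (rule borel_measurableI_greater)
  fix t
  let ?R = "section_radius N (p_ellipsoid N p \<sigma>)" and ?G = "grassmannian_borel N n"
  show "{E \<in> space ?G. t < ?R E} \<in> sets ?G"
  proof (cases "t \<ge> 0")
    case False
    have "t < ?R E" if E: "E \<in> grassmannian N n" for E
    proof -
      have "L2_set 0 {1..N} \<le> ?R E"
        by (rule section_radius_ge[OF p \<sigma>]) (use subspace_0[OF grassmannianD(1)[OF E]] zero_in_ellipsoid in auto)
      thus ?thesis using False by (simp add: L2_set_def fun_apply_simps)
    qed
    hence "{E \<in> space ?G. t < ?R E} = space ?G" by auto
    thus ?thesis by (simp only: sets.top)
  next
    case True
    define S where "S z k = {E \<in> grassmannian N n. (\<Sum>i=1..N. (\<bar>\<Sum>j=1..N. proj_entry N E i j * grid_vec N z k j\<bar> / \<sigma> i) powr p) < 1 \<and>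
       t < L2_set (\<lambda>i. \<Sum>j=1..N. proj_entry N E i j * grid_vec N z k j) {1..N}}" for z k
    have S: "S z k \<in> sets ?G" for z k
    proof -
      have "S z k = {E \<in> space ?G. (\<Sum>i=1..N. (\<bar>\<Sum>j=1..N. proj_entry N E i j * grid_vec N z k j\<bar> / \<sigma> i) powr p) < 1 \<and>
       t < L2_set (\<lambda>i. \<Sum>j=1..N. proj_entry N E i j * grid_vec N z k j) {1..N}}" by (simp add: S_def)
      also have "\<dots> \<in> sets ?G" unfolding L2_set_def by measurable
      finally show ?thesis .
    qed
    have cnt: "countable ({1..N} \<rightarrow>\<^sub>E (UNIV :: int set))" by (rule countable_PiE) auto
    have "{E \<in> space ?G. t < ?R E} = (\<Union>z\<in>{1..N} \<rightarrow>\<^sub>E UNIV. \<Union>k. S z k)"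
      using section_radius_greater_iff_grid[OF p \<sigma> _ True, where n = n]
      by (auto simp: S_def L2_set_def orth_proj_entry)
    also have "\<dots> \<in> sets ?G"
      by (rule sets.countable_UN'[OF cnt]) (use S in auto)
    finally show ?thesis .
  qed
qed

section \<open>Nets of spheres\<close>


lemma sum_half_power_abs_le: "(\<Sum>v\<in>{-T..T}. (1/2::real) ^ nat \<bar>v\<bar>) \<le> 4" for T :: int
proof -
  have geo: "(\<Sum>n\<le>m. (1/2::real) ^ n) \<le> 2" for m
  proof -
    have "(\<Sum>n\<le>m. (1/2::real) ^ n) = 2 - (1/2) ^ m" by (induction m) auto
    thus ?thesis by simp
  qed
  define m where "m = nat T"
  let ?A = "int ` {..m}" and ?B = "(\<lambda>n. - int n) ` {..m}"
  have sub: "{-T..T} \<subseteq> ?A \<union> ?B"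
  proof
    fix v assume v: "v \<in> {-T..T}"
    show "v \<in> ?A \<union> ?B"
    proof (cases "v \<ge> 0")
      case True thus ?thesis using v by (intro UnI1 image_eqI[of _ _ "nat v"]) (auto simp: m_def)
    next
      case False thus ?thesis using v by (intro UnI2 image_eqI[of _ _ "nat (- v)"]) (auto simp: m_def)
    qed
  qed
  have "(\<Sum>v\<in>{-T..T}. (1/2::real) ^ nat \<bar>v\<bar>) \<le> (\<Sum>v\<in>?A \<union> ?B. (1/2::real) ^ nat \<bar>v\<bar>)"
    by (rule sum_mono2[OF _ sub]) auto
  also have "\<dots> \<le> (\<Sum>v\<in>?A. (1/2::real) ^ nat \<bar>v\<bar>) + (\<Sum>v\<in>?B. (1/2::real) ^ nat \<bar>v\<bar>)"
    using sum.union_inter[of ?A ?B "\<lambda>v. (1/2::real) ^ nat \<bar>v\<bar>"]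
      sum_nonneg[of "?A \<inter> ?B" "\<lambda>v. (1/2::real) ^ nat \<bar>v\<bar>"] by simp
  also have "(\<Sum>v\<in>?A. (1/2::real) ^ nat \<bar>v\<bar>) = (\<Sum>n\<le>m. (1/2::real) ^ n)"
    by (subst sum.reindex) (auto simp: inj_on_def)
  also have "(\<Sum>v\<in>?B. (1/2::real) ^ nat \<bar>v\<bar>) = (\<Sum>n\<le>m. (1/2::real) ^ n)"
    by (subst sum.reindex) (auto simp: inj_on_def)
  finally show ?thesis using geo[of m] by linarith
qed

text \<open>
  Every point of the ball has weight \<open>2 powr - (\<Sum> \<bar>z i\<bar>) \<ge> 2 powr - (L m)\<close>, \<open>m = card A\<close>, and the sum of
  the weights over the whole lattice factorizes.
\<close>

lemma card_lattice_ball_le: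
  fixes A :: "'k set"
  assumes A: "finite A" and L: "L \<ge> 0"
  defines "Z \<equiv> {z \<in> A \<rightarrow>\<^sub>E (UNIV :: int set). real_of_int (\<Sum>i\<in>A. \<bar>z i\<bar>) \<le> L * real (card A)}"
  shows "finite Z" "real (card Z) \<le> (4 * 2 powr L) ^ card A"
proof -
  define T where "T = \<lfloor>L * real (card A)\<rfloor>"
  let ?P = "A \<rightarrow>\<^sub>E {-T..T}"
  have sub: "Z \<subseteq> ?P"
  proof
    fix z assume z: "z \<in> Z"
    have "z i \<in> {-T..T}" if i: "i \<in> A" for i
    proof -
      have "\<bar>z i\<bar> \<le> (\<Sum>i\<in>A. \<bar>z i\<bar>)" by (rule member_le_sum[OF i]) (use A in auto)
      also have "\<dots> \<le> T" unfolding T_def using z by (simp add: Z_def le_floor_iff)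
      finally show ?thesis by auto
    qed
    thus "z \<in> ?P" using z by (auto simp: Z_def PiE_def Pi_def)
  qed
  have finP: "finite ?P" using A by (intro finite_PiE) auto
  show "finite Z" by (rule finite_subset[OF sub finP])
  have "real (card Z) = (\<Sum>z\<in>Z. 1)" by simp
  also have "\<dots> \<le> (\<Sum>z\<in>Z. (2 powr L) ^ card A * (\<Prod>i\<in>A. (1/2::real) ^ nat \<bar>z i\<bar>))"
  proof (rule sum_mono)
    fix z assume z: "z \<in> Z"
    have "(\<Prod>i\<in>A. (1/2::real) ^ nat \<bar>z i\<bar>) = (1/2) ^ (\<Sum>i\<in>A. nat \<bar>z i\<bar>)" by (rule power_sum[symmetric])
    also have "(\<Sum>i\<in>A. nat \<bar>z i\<bar>) = nat (\<Sum>i\<in>A. \<bar>z i\<bar>)"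
    proof -
      have "int (\<Sum>i\<in>A. nat \<bar>z i\<bar>) = (\<Sum>i\<in>A. \<bar>z i\<bar>)" by simp
      thus ?thesis by linarith
    qed
    also have "(1/2::real) ^ nat (\<Sum>i\<in>A. \<bar>z i\<bar>) = 2 powr (- real_of_int (\<Sum>i\<in>A. \<bar>z i\<bar>))"
      by (simp add: powr_minus powr_realpow[symmetric] sum_nonneg power_one_over field_simps)
    also have "\<dots> \<ge> 2 powr (- (L * real (card A)))" using z by (intro powr_mono) (auto simp: Z_def)
    finally have "(2 powr L) ^ card A * 2 powr (- (L * real (card A))) \<le> (2 powr L) ^ card A * (\<Prod>i\<in>A. (1/2::real) ^ nat \<bar>z i\<bar>)"
      by (intro mult_left_mono) auto
    moreover have "(2 powr L) ^ card A * 2 powr (- (L * real (card A))) = (1::real)"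
      by (simp add: powr_power powr_add[symmetric] mult.commute)
    ultimately show "1 \<le> (2 powr L) ^ card A * (\<Prod>i\<in>A. (1/2::real) ^ nat \<bar>z i\<bar>)" by simp
  qed
  also have "\<dots> \<le> (\<Sum>z\<in>?P. (2 powr L) ^ card A * (\<Prod>i\<in>A. (1/2::real) ^ nat \<bar>z i\<bar>))"
    by (rule sum_mono2[OF finP sub]) (auto intro!: mult_nonneg_nonneg prod_nonneg)
  also have "\<dots> = (2 powr L) ^ card A * (\<Prod>i\<in>A. \<Sum>v\<in>{-T..T}. (1/2::real) ^ nat \<bar>v\<bar>)"
    unfolding sum_distrib_left[symmetric] by (subst prod_sum_PiE) (use A in auto)
  also have "\<dots> \<le> (2 powr L) ^ card A * (\<Prod>i\<in>A. 4)"
    by (intro mult_left_mono prod_mono conjI sum_half_power_abs_le sum_nonneg) auto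
  also have "\<dots> = (4 * 2 powr L) ^ card A" by (simp add: power_mult_distrib mult.commute)
  finally show "real (card Z) \<le> (4 * 2 powr L) ^ card A" .
qed

lemma sum_abs_le_sqrt_card:
  assumes "(\<Sum>i\<in>A. (x i)\<^sup>2) = (1::real)" shows "(\<Sum>i\<in>A. \<bar>x i\<bar>) \<le> sqrt (real (card A))"
proof -
  have "(\<Sum>i\<in>A. \<bar>x i\<bar> * \<bar>1\<bar>) \<le> L2_set x A * L2_set (\<lambda>_. 1) A" by (rule L2_set_mult_ineq)
  thus ?thesis using assms by (simp add: L2_set_def)
qed

definition unit_on :: "'k set \<Rightarrow> ('k \<Rightarrow> real) \<Rightarrow> bool"
  where "unit_on A x \<longleftrightarrow> (\<forall>i. i \<notin> A \<longrightarrow> x i = 0) \<and> (\<Sum>i\<in>A. (x i)\<^sup>2) = 1"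

text \<open>Net points lie on the sphere itself, since a Gaussian combination is standard only for
  unit coefficient vectors.\<close>

definition is_net :: "'k set \<Rightarrow> real \<Rightarrow> ('k \<Rightarrow> real) set \<Rightarrow> bool"
  where "is_net A e W \<longleftrightarrow> finite W \<and> (\<forall>y\<in>W. unit_on A y) \<and>
    (\<forall>x. unit_on A x \<longrightarrow> (\<exists>y\<in>W. (\<Sum>i\<in>A. (x i - y i)\<^sup>2) \<le> e\<^sup>2))"

text \<open>Coordinates are rounded to multiples of e / sqrt m, where m is the cardinality of
  \<open>A\<close>. By Cauchy-Schwarz the integer vectors have absolute values summing to at most
  (1/e + 1) m, so the lattice count applies; one point of the sphere is kept per cell.\<close>

lemma unit_net_exists:
  fixes A :: "'k set"
  assumes e: "e > 0" and A: "finite A"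
  shows "\<exists>W. is_net A e W \<and> real (card W) \<le> (4 * 2 powr (1 / e + 1)) ^ card A"
proof (cases "A = {}")
  case True
  thus ?thesis by (intro exI[of _ "{}"]) (auto simp: is_net_def unit_on_def)
next
  case False
  define m where "m = card A"
  have m: "m > 0" using False A by (simp add: m_def card_gt_0_iff)
  define h where "h = e / sqrt (real m)"
  have h: "h > 0" using e m by (simp add: h_def)
  define q where "q x = (\<lambda>i\<in>A. \<lfloor>x i / h\<rfloor>)" for x :: "'k \<Rightarrow> real"
  define L where "L = 1 / e + 1"
  have L: "L \<ge> 0" using e by (simp add: L_def)
  define Z where "Z = {z \<in> A \<rightarrow>\<^sub>E (UNIV :: int set). real_of_int (\<Sum>i\<in>A. \<bar>z i\<bar>) \<le> L * real (card A)}"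
  note Z = card_lattice_ball_le[OF A L, folded Z_def]
  have qZ: "q x \<in> Z" if x: "unit_on A x" for x
  proof -
    have "real_of_int (\<Sum>i\<in>A. \<bar>q x i\<bar>) = (\<Sum>i\<in>A. real_of_int \<bar>q x i\<bar>)" by simp
    also have "\<dots> \<le> (\<Sum>i\<in>A. \<bar>x i\<bar> / h + 1)"
    proof (rule sum_mono)
      fix i assume "i \<in> A"
      hence "q x i = \<lfloor>x i / h\<rfloor>" by (simp add: q_def)
      moreover have "\<bar>x i / h\<bar> = \<bar>x i\<bar> / h" using h by simp
      ultimately show "real_of_int \<bar>q x i\<bar> \<le> \<bar>x i\<bar> / h + 1" by linarith
    qed
    also have "\<dots> = (\<Sum>i\<in>A. \<bar>x i\<bar>) / h + real m" by (simp add: sum.distrib sum_divide_distrib m_def)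
    also have "\<dots> \<le> sqrt (real m) / h + real m"
      using sum_abs_le_sqrt_card[where A = A and x = x] x h by (intro add_right_mono divide_right_mono) (auto simp: unit_on_def m_def)
    also have "sqrt (real m) / h = real m / e" using m e by (simp add: h_def field_simps)
    also have "real m / e + real m = L * real (card A)" by (simp add: L_def m_def field_simps)
    finally show ?thesis by (auto simp: Z_def q_def)
  qed
  define r where "r z = (SOME x. unit_on A x \<and> q x = z)" for z
  define W where "W = r ` (q ` {x. unit_on A x})"
  have r: "unit_on A (r (q x))" "q (r (q x)) = q x" if "unit_on A x" for x
    using someI[of "\<lambda>y. unit_on A y \<and> q y = q x" x] that by (auto simp: r_def)
  have sub: "q ` {x. unit_on A x} \<subseteq> Z" using qZ by auto
  have finq: "finite (q ` {x. unit_on A x})" by (rule finite_subset[OF sub Z(1)])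
  have "card W \<le> card Z" unfolding W_def
    using card_image_le[OF finq, of r] card_mono[OF Z(1) sub] by linarith
  moreover have "is_net A e W" unfolding is_net_def
  proof (intro conjI ballI allI impI)
    show "finite W" unfolding W_def using finq by simp
    show "unit_on A y" if "y \<in> W" for y using that r by (auto simp: W_def)
    fix x assume x: "unit_on A x"
    have "(x i - r (q x) i)\<^sup>2 \<le> h\<^sup>2" if i: "i \<in> A" for i
    proof -
      have "\<lfloor>x i / h\<rfloor> = \<lfloor>r (q x) i / h\<rfloor>" using fun_cong[OF r(2)[OF x], of i] i by (simp add: q_def)
      hence "\<bar>x i / h - r (q x) i / h\<bar> \<le> 1" by linarith
      hence "\<bar>x i - r (q x) i\<bar> / h \<le> 1" using h by (simp add: diff_divide_distrib[symmetric])
      hence "\<bar>x i - r (q x) i\<bar> \<le> \<bar>h\<bar>" using h by simp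
      thus ?thesis by (simp add: abs_le_square_iff)
    qed
    hence "(\<Sum>i\<in>A. (x i - r (q x) i)\<^sup>2) \<le> (\<Sum>i\<in>A. h\<^sup>2)" by (intro sum_mono) auto
    also have "\<dots> = e\<^sup>2" using m by (simp add: h_def power_divide m_def)
    finally show "\<exists>y\<in>W. (\<Sum>i\<in>A. (x i - y i)\<^sup>2) \<le> e\<^sup>2" using x by (intro bexI[of _ "r (q x)"]) (auto simp: W_def)
  qed
  ultimately show ?thesis using Z(2) unfolding L_def by (intro exI[of _ W]) linarith
qed

section \<open>Exponential moments\<close>


lemma measure_le_nn_integral:
  assumes "\<And>x. x \<in> A \<Longrightarrow> 1 \<le> f x" "(\<integral>\<^sup>+x. f x \<partial>M) \<le> ennreal c" "c \<ge> 0"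
  shows "measure M A \<le> c"
proof (cases "A \<in> sets M")
  case True
  have "emeasure M A = (\<integral>\<^sup>+x. indicator A x \<partial>M)" using True by simp
  also have "\<dots> \<le> (\<integral>\<^sup>+x. f x \<partial>M)" by (rule nn_integral_mono) (use assms(1) in \<open>auto simp: indicator_def\<close>)
  also have "\<dots> \<le> ennreal c" by (rule assms(2))
  finally show ?thesis using assms(3) unfolding measure_def by (rule enn2real_leI[rotated])
qed (use assms in \<open>simp add: measure_notin_sets\<close>)

lemma measure_zero_of_AE:
  assumes "AE x in M. P x" shows "measure M {x\<in>space M. \<not> P x} = 0"
proof (cases "{x\<in>space M. \<not> P x} \<in> sets M")
  case True
  thus ?thesis using AE_iff_measurable[OF True, of P] assms by (simp add: measure_def)
qed (simp add: measure_notin_sets)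

lemma finite_Bex_event:
  assumes I: "finite I" and P: "\<And>i. i \<in> I \<Longrightarrow> {x\<in>space M. P i x} \<in> sets M"
    and c: "\<And>i. i \<in> I \<Longrightarrow> measure M {x\<in>space M. P i x} \<le> c"
  shows "{x\<in>space M. \<exists>i\<in>I. P i x} \<in> sets M" "measure M {x\<in>space M. \<exists>i\<in>I. P i x} \<le> real (card I) * c"
proof -
  have e: "{x\<in>space M. \<exists>i\<in>I. P i x} = (\<Union>i\<in>I. {x\<in>space M. P i x})" by auto
  show "{x\<in>space M. \<exists>i\<in>I. P i x} \<in> sets M" unfolding e using I P by (intro sets.finite_UN) auto
  have "measure M {x\<in>space M. \<exists>i\<in>I. P i x} \<le> (\<Sum>i\<in>I. measure M {x\<in>space M. P i x})"
    unfolding e by (rule measure_UNION_le[OF I P])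
  also have "\<dots> \<le> (\<Sum>i\<in>I. c)" by (rule sum_mono[OF c])
  finally show "measure M {x\<in>space M. \<exists>i\<in>I. P i x} \<le> real (card I) * c" by simp
qed

lemma nn_integral_gauss_prod:
  assumes "finite K" "\<And>k. k \<in> K \<Longrightarrow> f k \<in> borel_measurable borel"
  shows "(\<integral>\<^sup>+x. (\<Prod>k\<in>K. f k (x k)) \<partial>gauss K) = (\<Prod>k\<in>K. \<integral>\<^sup>+y. f k y \<partial>stdn)"
proof -
  interpret S: product_sigma_finite "\<lambda>_. stdn"
    unfolding product_sigma_finite_def using prob_space_stdn by (auto intro: prob_space_imp_sigma_finite)
  show ?thesis unfolding gauss_def
    by (rule S.product_nn_integral_prod) (use assms in \<open>auto simp: measurable_cong_sets[OF sets_stdn refl]\<close>)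
qed

text \<open>The factor turns the standard density into s times the centred normal density of
  standard deviation s = 1 / sqrt (1 - 2 a).\<close>

lemma nn_integral_stdn_exp_square:
  assumes a: "a < 1 / 2"
  shows "(\<integral>\<^sup>+x. ennreal (exp (a * x\<^sup>2)) \<partial>stdn) = ennreal (1 / sqrt (1 - 2 * a))"
proof -
  define s where "s = 1 / sqrt (1 - 2 * a)"
  have pos: "1 - 2 * a > 0" using a by simp
  have s: "s > 0" using pos by (simp add: s_def)
  have s2: "s\<^sup>2 = 1 / (1 - 2 * a)" using pos by (simp add: s_def power_divide)
  have e: "std_normal_density x * exp (a * x\<^sup>2) = s * normal_density 0 s x" for x
  proof -
    have "sqrt (2 * pi * s\<^sup>2) = sqrt (2 * pi) * s" using s by (simp add: real_sqrt_mult)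
    moreover have "- x\<^sup>2 / 2 + a * x\<^sup>2 = - (x - 0)\<^sup>2 / (2 * s\<^sup>2)" using pos unfolding s2 by (simp add: field_simps)
    ultimately show ?thesis using s unfolding std_normal_density_def normal_density_def
      by (simp add: exp_add[symmetric])
  qed
  have "(\<integral>\<^sup>+x. ennreal (exp (a * x\<^sup>2)) \<partial>stdn) = (\<integral>\<^sup>+x. ennreal (std_normal_density x) * ennreal (exp (a * x\<^sup>2)) \<partial>lborel)"
    unfolding stdn_def by (subst nn_integral_density) auto
  also have "\<dots> = (\<integral>\<^sup>+x. ennreal s * ennreal (normal_density 0 s x) \<partial>lborel)"
    by (rule nn_integral_cong) (use s in \<open>simp add: ennreal_mult'[symmetric] e\<close>)
  also have "\<dots> = ennreal s * (\<integral>\<^sup>+x. ennreal (normal_density 0 s x) \<partial>lborel)"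
    by (rule nn_integral_cmult) simp
  also have "(\<integral>\<^sup>+x. ennreal (normal_density 0 s x) \<partial>lborel) = 1"
    using prob_space.emeasure_space_1[OF prob_space_normal_density[OF s, of 0]] by (simp add: emeasure_density)
  finally show ?thesis by (simp add: s_def)
qed

lemma exp_sum_indicator_prod:
  assumes "finite K" "A \<subseteq> K"
  shows "exp (\<Sum>i\<in>A. f i) = (\<Prod>i\<in>K. if i \<in> A then exp (f i) else (1::real))"
proof -
  have "(\<Prod>i\<in>K. if i \<in> A then exp (f i) else 1) = (\<Prod>i\<in>A. exp (f i))"
    using assms by (simp add: prod.If_cases Int_absorb1)
  thus ?thesis using assms by (simp add: exp_sum finite_subset)
qed

lemma prod_mono_ennreal:
  fixes f g :: "'a \<Rightarrow> ennreal"
  assumes "\<And>i. i \<in> K \<Longrightarrow> f i \<le> g i" shows "prod f K \<le> prod g K"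
  using assms by (induction K rule: infinite_finite_induct) (auto intro!: mult_mono)

text \<open>Exponential Markov inequality with independence. Coordinates outside \<open>A\<close>
  contribute the factor 1, which covers partial sums without passing to a marginal.\<close>

lemma gauss_exp_moment:
  fixes f :: "'k \<Rightarrow> real \<Rightarrow> real"
  assumes K: "finite K" "A \<subseteq> K" and f: "\<And>i. i \<in> A \<Longrightarrow> f i \<in> borel_measurable borel"
    and m: "\<And>i. i \<in> A \<Longrightarrow> (\<integral>\<^sup>+y. ennreal (exp (f i y)) \<partial>stdn) \<le> ennreal (m i)" "\<And>i. i \<in> A \<Longrightarrow> m i \<ge> 0"
  shows "measure (gauss K) {x\<in>space (gauss K). (\<Sum>i\<in>A. f i (x i)) \<ge> t} \<le> exp (- t) * (\<Prod>i\<in>A. m i)"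
proof (rule measure_le_nn_integral[where f = "\<lambda>x. ennreal (exp (- t) * exp (\<Sum>i\<in>A. f i (x i)))"])
  show "0 \<le> exp (- t) * (\<Prod>i\<in>A. m i)" using m by (intro mult_nonneg_nonneg prod_nonneg) auto
  fix x assume "x \<in> {x\<in>space (gauss K). (\<Sum>i\<in>A. f i (x i)) \<ge> t}"
  thus "1 \<le> ennreal (exp (- t) * exp (\<Sum>i\<in>A. f i (x i)))" by (simp add: exp_add[symmetric])
next
  have e: "ennreal (exp (- t) * exp (\<Sum>i\<in>A. f i (x i))) = ennreal (exp (- t)) * (\<Prod>i\<in>K. ennreal (if i \<in> A then exp (f i (x i)) else 1))" for x
  proof -
    have 1: "exp (\<Sum>i\<in>A. f i (x i)) = (\<Prod>i\<in>K. if i \<in> A then exp (f i (x i)) else 1)"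
      by (rule exp_sum_indicator_prod[OF K])
    have 2: "ennreal (\<Prod>i\<in>K. if i \<in> A then exp (f i (x i)) else 1) = (\<Prod>i\<in>K. ennreal (if i \<in> A then exp (f i (x i)) else 1))"
      by (rule prod_ennreal[symmetric]) auto
    have "ennreal (exp (- t) * exp (\<Sum>i\<in>A. f i (x i))) = ennreal (exp (- t)) * ennreal (exp (\<Sum>i\<in>A. f i (x i)))"
      by (rule ennreal_mult') simp
    thus ?thesis by (simp only: 1 2)
  qed
  have fm: "(\<lambda>y. ennreal (if i \<in> A then exp (f i y) else 1)) \<in> borel_measurable borel" for i
    using f[of i] by (cases "i \<in> A") auto
  have pm: "(\<lambda>x. \<Prod>i\<in>K. ennreal (if i \<in> A then exp (f i (x i)) else 1)) \<in> borel_measurable (gauss K)"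
    by (intro borel_measurable_prod_ennreal measurable_compose[OF gauss_component_measurable fm])
  have "(\<integral>\<^sup>+x. ennreal (exp (- t) * exp (\<Sum>i\<in>A. f i (x i))) \<partial>gauss K)
    = ennreal (exp (- t)) * (\<integral>\<^sup>+x. (\<Prod>i\<in>K. ennreal (if i \<in> A then exp (f i (x i)) else 1)) \<partial>gauss K)"
    unfolding e by (rule nn_integral_cmult[OF pm])
  also have "(\<integral>\<^sup>+x. (\<Prod>i\<in>K. ennreal (if i \<in> A then exp (f i (x i)) else 1)) \<partial>gauss K)
     = (\<Prod>i\<in>K. \<integral>\<^sup>+y. ennreal (if i \<in> A then exp (f i y) else 1) \<partial>stdn)"
    by (rule nn_integral_gauss_prod[OF K(1) fm])
  also have "\<dots> \<le> (\<Prod>i\<in>K. ennreal (if i \<in> A then m i else 1))"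
    by (rule prod_mono_ennreal) (use m prob_space.emeasure_space_1[OF prob_space_stdn] in auto)
  also have "\<dots> = ennreal (\<Prod>i\<in>K. if i \<in> A then m i else 1)"
    by (rule prod_ennreal) (use m in auto)
  also have "(\<Prod>i\<in>K. if i \<in> A then m i else 1) = (\<Prod>i\<in>A. m i)"
    using K by (simp add: prod.If_cases Int_absorb1)
  finally show "(\<integral>\<^sup>+x. ennreal (exp (- t) * exp (\<Sum>i\<in>A. f i (x i))) \<partial>gauss K) \<le> ennreal (exp (- t) * (\<Prod>i\<in>A. m i))"
    by (simp add: ennreal_mult' mult_left_mono)
qed

lemma chi_square_upper:
  assumes K: "finite K" "A \<subseteq> K"
  shows "measure (gauss K) {x\<in>space (gauss K). (\<Sum>i\<in>A. (x i)\<^sup>2) \<ge> t} \<le> exp (- t / 4) * sqrt 2 ^ card A"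
proof -
  \<comment> \<open>With the factor 1/4 each square has the exponential moment 1 / sqrt (1 - 1/2) =
    sqrt 2.\<close>
  have "measure (gauss K) {x\<in>space (gauss K). (\<Sum>i\<in>A. (1 / 4) * (x i)\<^sup>2) \<ge> t / 4} \<le> exp (- (t / 4)) * (\<Prod>i\<in>A. sqrt 2)"
  proof (rule gauss_exp_moment[OF K])
    show "(\<integral>\<^sup>+y. ennreal (exp ((1 / 4) * y\<^sup>2)) \<partial>stdn) \<le> ennreal (sqrt 2)"
      by (subst nn_integral_stdn_exp_square) (auto simp: real_sqrt_divide)
  qed auto
  thus ?thesis unfolding sum_distrib_left[symmetric] by simp
qed

lemma chi_square_lower:
  assumes K: "finite K" and lam: "lam > 0"
  shows "measure (gauss K) {x\<in>space (gauss K). (\<Sum>i\<in>K. (x i)\<^sup>2) \<le> t} \<le> exp (lam * t) * (1 / sqrt (1 + 2 * lam)) ^ card K"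
proof -
  have "measure (gauss K) {x\<in>space (gauss K). (\<Sum>i\<in>K. - lam * (x i)\<^sup>2) \<ge> - (lam * t)} \<le> exp (- (- (lam * t))) * (\<Prod>i\<in>K. 1 / sqrt (1 + 2 * lam))"
  proof (rule gauss_exp_moment[OF K order_refl])
    show "(\<integral>\<^sup>+y. ennreal (exp (- lam * y\<^sup>2)) \<partial>stdn) \<le> ennreal (1 / sqrt (1 + 2 * lam))"
      using nn_integral_stdn_exp_square[of "- lam"] lam by simp
  qed (use lam in auto)
  thus ?thesis using lam unfolding sum_distrib_left[symmetric] by simp
qed

section \<open>Moments of truncated powers\<close>

lemma abs_powr_le_exp: "p > 0 \<Longrightarrow> \<bar>y\<bar> powr p \<le> exp (p * \<bar>y\<bar>)" for y p :: real
proof (cases "y = 0")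
  case False
  assume "p > 0"
  hence "\<bar>y\<bar> powr p \<le> exp \<bar>y\<bar> powr p"
    using exp_ge_add_one_self[of "\<bar>y\<bar>"] by (intro powr_mono2) linarith+
  thus ?thesis by (simp add: powr_def)
qed simp

lemma mult_abs_le_square: "a * \<bar>y\<bar> \<le> c * a\<^sup>2 + y\<^sup>2 / (4 * c)" if "c > 0" for a y c :: real
proof -
  have "0 \<le> (2 * c * a - \<bar>y\<bar>)\<^sup>2 / (4 * c)" using that by simp
  also have "\<dots> = c * a\<^sup>2 + y\<^sup>2 / (4 * c) - a * \<bar>y\<bar>" using that by (simp add: power2_diff power_mult_distrib field_simps power2_eq_square)
  finally show ?thesis by simp
qed

lemma powr_exp_le_exp_square:
  fixes y :: real
  assumes "q > 0" "D \<ge> 0"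
  shows "\<bar>y\<bar> powr q * exp (D * \<bar>y\<bar>) \<le> exp ((q + D)\<^sup>2) * exp (y\<^sup>2 / 4)"
proof -
  have "\<bar>y\<bar> powr q * exp (D * \<bar>y\<bar>) \<le> exp (q * \<bar>y\<bar>) * exp (D * \<bar>y\<bar>)"
    by (intro mult_right_mono abs_powr_le_exp assms) simp
  also have "\<dots> = exp ((q + D) * \<bar>y\<bar>)" by (simp add: exp_add[symmetric] algebra_simps)
  also have "(q + D) * \<bar>y\<bar> \<le> (q + D)\<^sup>2 + y\<^sup>2 / 4" using mult_abs_le_square[of 1 "q + D" y] by simp
  finally show ?thesis by (simp add: exp_add[symmetric])
qed

lemma exp_le_one_plus: "exp x \<le> 1 + x * exp x" for x :: real
  using mult_right_mono[OF exp_ge_add_one_self[of "- x"], of "exp x"] by (simp add: algebra_simps exp_minus)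

text \<open>From exp x \<le> 1 + x exp x: the moment is 1 plus a multiple of l, not merely finite.
  The product over N coordinates is then governed by the sum of the l, uniformly in N.\<close>

lemma exp_moment_le:
  assumes f: "\<And>y. f y * exp (f y) \<le> l * exp (y\<^sup>2 / 4)" and l: "l \<ge> 0"
  shows "(\<integral>\<^sup>+y. ennreal (exp (f y)) \<partial>stdn) \<le> ennreal (exp (2 * l))"
proof -
  have "(\<integral>\<^sup>+y. ennreal (exp (f y)) \<partial>stdn) \<le> (\<integral>\<^sup>+y. 1 + ennreal l * ennreal (exp ((1 / 4) * y\<^sup>2)) \<partial>stdn)"
  proof (rule nn_integral_mono)
    fix y
    have "exp (f y) \<le> 1 + l * exp ((1 / 4) * y\<^sup>2)" using exp_le_one_plus[of "f y"] f[of y] by simp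
    hence "ennreal (exp (f y)) \<le> ennreal (1 + l * exp ((1 / 4) * y\<^sup>2))" by (rule ennreal_leI)
    also have "\<dots> = ennreal 1 + ennreal (l * exp ((1 / 4) * y\<^sup>2))"
      by (rule ennreal_plus) (use l in auto)
    also have "\<dots> = 1 + ennreal l * ennreal (exp ((1 / 4) * y\<^sup>2))"
      by (subst ennreal_mult'[symmetric]) (use l in auto)
    finally show "ennreal (exp (f y)) \<le> 1 + ennreal l * ennreal (exp ((1 / 4) * y\<^sup>2))" .
  qed
  also have "\<dots> = 1 + ennreal l * (\<integral>\<^sup>+y. ennreal (exp ((1 / 4) * y\<^sup>2)) \<partial>stdn)"
    by (subst nn_integral_add)
       (auto simp: nn_integral_cmult prob_space.emeasure_space_1[OF prob_space_stdn, simplified] measurable_cong_sets[OF sets_stdn refl])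
  also have "(\<integral>\<^sup>+y. ennreal (exp ((1 / 4) * y\<^sup>2)) \<partial>stdn) = ennreal (sqrt 2)"
    by (subst nn_integral_stdn_exp_square) (auto simp: real_sqrt_divide)
  also have "1 + ennreal l * ennreal (sqrt 2) = ennreal 1 + ennreal (l * sqrt 2)"
    by (subst ennreal_mult'[symmetric]) (use l in auto)
  also have "\<dots> = ennreal (1 + l * sqrt 2)"
    by (rule ennreal_plus[symmetric]) (use l in auto)
  also have "\<dots> \<le> ennreal (exp (2 * l))"
  proof (rule ennreal_leI)
    have "l * sqrt 2 \<le> l * 2"
      by (intro mult_left_mono) (auto simp: l real_le_lsqrt)
    hence "1 + l * sqrt 2 \<le> 1 + 2 * l" by simp
    also have "\<dots> \<le> exp (2 * l)" by (rule exp_ge_add_one_self)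
    finally show "1 + l * sqrt 2 \<le> exp (2 * l)" .
  qed
  finally show ?thesis .
qed

text \<open>
  \<open>trunc q D r g\<close> bounds \<open>\<bar>g\<bar> * (r * t) - t powr p\<close> over all \<open>t\<close> with \<open>r * t \<le> D\<close>, where \<open>1/p + 1/q = 1\<close>.
\<close>

definition trunc :: "real \<Rightarrow> real \<Rightarrow> real \<Rightarrow> real \<Rightarrow> real"
  where "trunc q D r y = min ((r * \<bar>y\<bar>) powr q) (D * \<bar>y\<bar>)"

text \<open>In the product of \<open>trunc\<close> and its exponential, the power branch bounds the
  first factor and the linear branch the exponent: the former supplies \<open>r powr q\<close>, the
  latter keeps the moment finite for every q.\<close>

lemma trunc_exp_moment:
  assumes q: "q > 0" and D: "D \<ge> 0" and r: "r \<ge> 0"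
  shows "(\<integral>\<^sup>+y. ennreal (exp (trunc q D r y)) \<partial>stdn) \<le> ennreal (exp (2 * (r powr q * exp ((q + D)\<^sup>2))))"
proof (rule exp_moment_le)
  fix y
  have nn: "0 \<le> trunc q D r y" using D by (simp add: trunc_def)
  have "trunc q D r y * exp (trunc q D r y) \<le> (r * \<bar>y\<bar>) powr q * exp (D * \<bar>y\<bar>)"
    using nn by (intro mult_mono) (auto simp: trunc_def)
  also have "\<dots> = r powr q * (\<bar>y\<bar> powr q * exp (D * \<bar>y\<bar>))" using r by (simp add: powr_mult)
  also have "\<dots> \<le> r powr q * (exp ((q + D)\<^sup>2) * exp (y\<^sup>2 / 4))"
    by (intro mult_left_mono powr_exp_le_exp_square q D) simp
  finally show "trunc q D r y * exp (trunc q D r y) \<le> r powr q * exp ((q + D)\<^sup>2) * exp (y\<^sup>2 / 4)" by simp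
qed simp

lemma trunc_measurable: "trunc q D r \<in> borel_measurable borel"
  unfolding trunc_def by measurable

lemma trunc_sum_tail:
  assumes K: "finite K" "A \<subseteq> K" and q: "q > 0" and D: "D \<ge> 0" and r: "\<And>i. i \<in> A \<Longrightarrow> r i \<ge> 0"
  shows "measure (gauss K) {x\<in>space (gauss K). (\<Sum>i\<in>A. trunc q D (r i) (x i)) \<ge> t}
    \<le> exp (2 * exp ((q + D)\<^sup>2) * (\<Sum>i\<in>A. r i powr q) - t)"
proof -
  have "measure (gauss K) {x\<in>space (gauss K). (\<Sum>i\<in>A. trunc q D (r i) (x i)) \<ge> t}
    \<le> exp (- t) * (\<Prod>i\<in>A. exp (2 * (r i powr q * exp ((q + D)\<^sup>2))))"
    by (rule gauss_exp_moment[OF K trunc_measurable trunc_exp_moment[OF q D r]]) auto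
  also have "(\<Prod>i\<in>A. exp (2 * (r i powr q * exp ((q + D)\<^sup>2)))) = exp (\<Sum>i\<in>A. 2 * (r i powr q * exp ((q + D)\<^sup>2)))"
    by (rule exp_sum[symmetric]) (use K finite_subset in auto)
  also have "(\<Sum>i\<in>A. 2 * (r i powr q * exp ((q + D)\<^sup>2))) = 2 * exp ((q + D)\<^sup>2) * (\<Sum>i\<in>A. r i powr q)"
    unfolding sum_distrib_left by (rule sum.cong) simp_all
  finally show ?thesis by (simp add: exp_add[symmetric])
qed

section \<open>Counting supports, Young's inequality, duality\<close>

text \<open>A Chernoff bound for counting: each counted S has weight exp (t - v(S)) \<ge> 1, and the
  weights of all subsets add up to a product over \<open>I\<close>.\<close>

lemma card_weighted_subsets_le:
  fixes v :: "'a \<Rightarrow> real"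
  assumes I: "finite I"
  shows "real (card {S \<in> Pow I. (\<Sum>i\<in>S. v i) \<le> t}) \<le> exp (t + (\<Sum>i\<in>I. exp (- v i)))"
proof -
  have "real (card {S \<in> Pow I. (\<Sum>i\<in>S. v i) \<le> t}) = (\<Sum>S\<in>{S \<in> Pow I. (\<Sum>i\<in>S. v i) \<le> t}. 1)" by simp
  also have "\<dots> \<le> (\<Sum>S\<in>{S \<in> Pow I. (\<Sum>i\<in>S. v i) \<le> t}. exp t * (\<Prod>i\<in>S. exp (- v i)))"
  proof (rule sum_mono)
    fix S assume S: "S \<in> {S \<in> Pow I. (\<Sum>i\<in>S. v i) \<le> t}"
    hence "finite S" using I finite_subset by auto
    hence "exp t * (\<Prod>i\<in>S. exp (- v i)) = exp (t - (\<Sum>i\<in>S. v i))" by (simp add: exp_sum[symmetric] sum_negf exp_add[symmetric])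
    thus "1 \<le> exp t * (\<Prod>i\<in>S. exp (- v i))" using S by simp
  qed
  also have "\<dots> \<le> (\<Sum>S\<in>Pow I. exp t * (\<Prod>i\<in>S. exp (- v i)))"
    by (rule sum_mono2) (use I in \<open>auto intro!: mult_nonneg_nonneg prod_nonneg\<close>)
  also have "\<dots> = exp t * (\<Prod>i\<in>I. exp (- v i) + 1)"
    by (simp add: sum_distrib_left[symmetric] prod_add[OF I])
  also have "\<dots> \<le> exp t * (\<Prod>i\<in>I. exp (exp (- v i)))"
    by (intro mult_left_mono prod_mono) (auto simp: add.commute exp_ge_add_one_self add_nonneg_nonneg)
  also have "\<dots> = exp (t + (\<Sum>i\<in>I. exp (- v i)))" using I by (simp add: exp_sum exp_add)
  finally show ?thesis .
qed

lemma exp_minus_le_powr: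
  fixes r v :: real
  assumes r: "r > 0" and v: "v > 0" shows "exp (- v) \<le> r powr r * v powr (- r)"
proof -
  have "v / r \<le> exp (v / r)" using exp_ge_add_one_self[of "v / r"] by linarith
  hence "(v / r) powr r \<le> exp (v / r) powr r" using r v by (intro powr_mono2) auto
  also have "\<dots> = exp v" using r by (simp add: powr_def)
  finally have "v powr r \<le> r powr r * exp v" using r v by (simp add: powr_divide field_simps)
  thus ?thesis using v by (simp add: powr_minus exp_minus field_simps)
qed

text \<open>At a = t powr (p - 1) both terms on the right equal a t; on either side of this value
  one of them alone dominates. Dropping the factors 1/p and 1/q only costs constants.\<close>

lemma young_simple:
  fixes a t :: real
  assumes p: "p > 1" and t: "t \<ge> 0" and a: "a \<ge> 0"
  shows "a * t \<le> t powr p + a powr (p / (p - 1))"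
proof (cases "a \<le> t powr (p - 1)")
  case True
  show ?thesis
  proof (cases "t = 0")
    case False
    have "a * t \<le> t powr (p - 1) * t powr 1" using True t by (simp add: mult_right_mono)
    also have "\<dots> = t powr ((p - 1) + 1)" by (simp only: powr_add)
    finally show ?thesis by (simp add: add_increasing2)
  qed (use p in simp)
next
  case False
  hence "a > 0" using a by (metis not_less order_less_le powr_ge_zero)
  have "t = (t powr (p - 1)) powr (1 / (p - 1))" using p t by (cases "t = 0") (auto simp: powr_powr)
  also have "\<dots> \<le> a powr (1 / (p - 1))" using False p by (intro powr_mono2) auto
  finally have "a * t \<le> a powr 1 * a powr (1 / (p - 1))" using a by (simp add: mult_left_mono)
  also have "\<dots> = a powr (p / (p - 1))"
    unfolding powr_add[symmetric] using p by (intro arg_cong[where f = "\<lambda>e. a powr e"]) (simp add: field_simps)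
  finally show ?thesis by (simp add: add_increasing)
qed

text \<open>For unit vectors, |u - w| \<le> 1 means that the inner product is at least 1/2. A net of
  resolution 1 thus computes the norm up to the factor 2.\<close>

lemma net_dual:
  assumes J: "finite J" and W: "is_net J 1 W" and le: "\<And>w. w \<in> W \<Longrightarrow> (\<Sum>j\<in>J. w j * z j) \<le> t" and t: "t \<ge> 0"
  shows "L2_set z J \<le> 2 * t"
proof (cases "L2_set z J = 0")
  case False
  define L where "L = L2_set z J"
  have L: "L > 0" using False by (simp add: L_def less_le)
  define u where "u j = (if j \<in> J then z j / L else 0)" for j
  have sq: "(\<Sum>j\<in>J. (z j)\<^sup>2) = L\<^sup>2" by (simp add: L_def L2_set_def sum_nonneg)
  have u2: "(\<Sum>j\<in>J. (u j)\<^sup>2) = 1"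
  proof -
    have "(\<Sum>j\<in>J. (u j)\<^sup>2) = (\<Sum>j\<in>J. (z j)\<^sup>2) / L\<^sup>2" by (simp add: u_def power_divide sum_divide_distrib)
    thus ?thesis using sq L by simp
  qed
  hence "unit_on J u" by (simp add: unit_on_def u_def)
  then obtain w where w: "w \<in> W" "(\<Sum>j\<in>J. (u j - w j)\<^sup>2) \<le> 1" using W by (auto simp: is_net_def)
  have w2: "(\<Sum>j\<in>J. (w j)\<^sup>2) = 1" using W w by (auto simp: is_net_def unit_on_def)
  have "(\<Sum>j\<in>J. (u j - w j)\<^sup>2) = (\<Sum>j\<in>J. (u j)\<^sup>2) + (\<Sum>j\<in>J. (w j)\<^sup>2) - 2 * (\<Sum>j\<in>J. w j * u j)"
    by (simp add: power2_diff sum.distrib sum_subtractf sum_distrib_left mult_ac)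
  hence "1 / 2 \<le> (\<Sum>j\<in>J. w j * u j)" using w(2) u2 w2 by linarith
  also have "(\<Sum>j\<in>J. w j * u j) = (\<Sum>j\<in>J. w j * z j) / L" by (simp add: u_def sum_divide_distrib)
  also have "\<dots> \<le> t / L" using le[OF w(1)] L by (intro divide_right_mono) auto
  finally show ?thesis using L by (simp add: field_simps L_def)
qed (use t in simp)

section \<open>Vectors in the kernel\<close>


definition mat_app :: "nat \<Rightarrow> (nat \<times> nat \<Rightarrow> real) \<Rightarrow> (nat \<Rightarrow> real) \<Rightarrow> nat \<Rightarrow> real"
  where "mat_app N \<omega> x j = (\<Sum>i=1..N. x i * \<omega> (j, i))"

text \<open>The transposed matrix applied to \<open>w\<close>; for a unit vector \<open>w\<close> it
  is a standard Gaussian vector in dimension N.\<close>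

definition row_comb :: "nat \<Rightarrow> (nat \<times> nat \<Rightarrow> real) \<Rightarrow> (nat \<Rightarrow> real) \<Rightarrow> nat \<Rightarrow> real"
  where "row_comb n \<omega> w i = (\<Sum>j=1..n. w j * \<omega> (j, i))"

lemma mat_app_dual: "(\<Sum>j=1..n. w j * mat_app N \<omega> x j) = (\<Sum>i=1..N. x i * row_comb n \<omega> w i)"
proof -
  have "(\<Sum>j=1..n. w j * mat_app N \<omega> x j) = (\<Sum>j=1..n. \<Sum>i=1..N. x i * (w j * \<omega> (j, i)))"
    by (simp add: mat_app_def sum_distrib_left mult_ac)
  also have "\<dots> = (\<Sum>i=1..N. \<Sum>j=1..n. x i * (w j * \<omega> (j, i)))" by (rule sum.swap)
  finally show ?thesis by (simp add: row_comb_def sum_distrib_left)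
qed

lemma mat_app_add: "mat_app N \<omega> (\<lambda>i. x i + y i) j = mat_app N \<omega> x j + mat_app N \<omega> y j"
  by (simp add: mat_app_def sum.distrib algebra_simps)

lemma mat_app_scale: "mat_app N \<omega> (\<lambda>i. c * x i) j = c * mat_app N \<omega> x j"
  by (simp add: mat_app_def sum_distrib_left algebra_simps)

lemma distr_event:
  assumes h: "h \<in> M \<rightarrow>\<^sub>M M'" "distr M M' h = M'" and P: "{x\<in>space M'. P x} \<in> sets M'"
  shows "{\<omega>\<in>space M. P (h \<omega>)} \<in> sets M" "measure M {\<omega>\<in>space M. P (h \<omega>)} = measure M' {x\<in>space M'. P x}"
proof -
  have e: "{\<omega>\<in>space M. P (h \<omega>)} = h -` {x\<in>space M'. P x} \<inter> space M"
    using measurable_space[OF h(1)] by auto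
  show "{\<omega>\<in>space M. P (h \<omega>)} \<in> sets M" unfolding e by (rule measurable_sets[OF h(1) P])
  show "measure M {\<omega>\<in>space M. P (h \<omega>)} = measure M' {x\<in>space M'. P x}"
    unfolding e using measure_distr[OF h(1) P] h(2) by simp
qed

lemma row_comb_event:
  assumes w: "unit_on {1..n} w" and P: "{x\<in>space (gauss {1..N}). P x} \<in> sets (gauss {1..N})"
  shows "{\<omega>\<in>space (gauss_matrix n N). P (\<lambda>i\<in>{1..N}. row_comb n \<omega> w i)} \<in> sets (gauss_matrix n N)"
    and "measure (gauss_matrix n N) {\<omega>\<in>space (gauss_matrix n N). P (\<lambda>i\<in>{1..N}. row_comb n \<omega> w i)}
      = measure (gauss {1..N}) {x\<in>space (gauss {1..N}). P x}"
proof -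
  have "(\<lambda>\<omega>. \<lambda>i\<in>{1..N}. row_comb n \<omega> w i) \<in> gauss_matrix n N \<rightarrow>\<^sub>M gauss {1..N}"
    unfolding measurable_cong_sets[OF refl sets_gauss] row_comb_def by measurable
  moreover have "distr (gauss_matrix n N) (gauss {1..N}) (\<lambda>\<omega>. \<lambda>i\<in>{1..N}. row_comb n \<omega> w i) = gauss {1..N}"
    unfolding row_comb_def by (rule gauss_combine_rows) (use w in \<open>auto simp: unit_on_def\<close>)
  ultimately show "{\<omega>\<in>space (gauss_matrix n N). P (\<lambda>i\<in>{1..N}. row_comb n \<omega> w i)} \<in> sets (gauss_matrix n N)"
    "measure (gauss_matrix n N) {\<omega>\<in>space (gauss_matrix n N). P (\<lambda>i\<in>{1..N}. row_comb n \<omega> w i)}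
      = measure (gauss {1..N}) {x\<in>space (gauss {1..N}). P x}" by (fact distr_event[OF _ _ P])+
qed

lemma mat_app_event:
  assumes y: "(\<Sum>i=1..N. (y i)\<^sup>2) = 1" and P: "{x\<in>space (gauss {1..n}). P x} \<in> sets (gauss {1..n})"
  shows "{\<omega>\<in>space (gauss_matrix n N). P (\<lambda>j\<in>{1..n}. mat_app N \<omega> y j)} \<in> sets (gauss_matrix n N)"
    and "measure (gauss_matrix n N) {\<omega>\<in>space (gauss_matrix n N). P (\<lambda>j\<in>{1..n}. mat_app N \<omega> y j)}
      = measure (gauss {1..n}) {x\<in>space (gauss {1..n}). P x}"
proof -
  have "(\<lambda>\<omega>. \<lambda>j\<in>{1..n}. mat_app N \<omega> y j) \<in> gauss_matrix n N \<rightarrow>\<^sub>M gauss {1..n}"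
    unfolding measurable_cong_sets[OF refl sets_gauss] mat_app_def by measurable
  moreover have "distr (gauss_matrix n N) (gauss {1..n}) (\<lambda>\<omega>. \<lambda>j\<in>{1..n}. mat_app N \<omega> y j) = gauss {1..n}"
    unfolding mat_app_def by (rule gauss_combine_columns) (use y in auto)
  ultimately show "{\<omega>\<in>space (gauss_matrix n N). P (\<lambda>j\<in>{1..n}. mat_app N \<omega> y j)} \<in> sets (gauss_matrix n N)"
    "measure (gauss_matrix n N) {\<omega>\<in>space (gauss_matrix n N). P (\<lambda>j\<in>{1..n}. mat_app N \<omega> y j)}
      = measure (gauss {1..n}) {x\<in>space (gauss {1..n}). P x}" by (fact distr_event[OF _ _ P])+
qed

text \<open>The operator norm of the columns in \<open>A\<close>, by duality: 6 sqrt n at each net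
  point, doubled in passing from the net to the sphere.\<close>

lemma mat_app_upper:
  assumes W: "is_net {1..n} 1 W" and A: "A \<subseteq> {1..N}"
    and b1: "\<And>w. w \<in> W \<Longrightarrow> (\<Sum>i\<in>A. (row_comb n \<omega> w i)\<^sup>2) \<le> 36 * real n"
    and v: "\<And>i. i \<notin> A \<Longrightarrow> v i = 0"
  shows "L2_set (mat_app N \<omega> v) {1..n} \<le> 12 * sqrt (real n) * L2_set v A"
proof -
  have "L2_set (mat_app N \<omega> v) {1..n} \<le> 2 * (L2_set v A * (6 * sqrt (real n)))"
  proof (rule net_dual[OF _ W])
    fix w assume w: "w \<in> W"
    have "(\<Sum>j=1..n. w j * mat_app N \<omega> v j) = (\<Sum>i\<in>A. v i * row_comb n \<omega> w i)"
      unfolding mat_app_dual by (rule sum.mono_neutral_right) (use A v in auto)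
    also have "\<dots> \<le> (\<Sum>i\<in>A. \<bar>v i\<bar> * \<bar>row_comb n \<omega> w i\<bar>)"
      by (intro sum_mono) (metis abs_ge_self abs_mult)
    also have "\<dots> \<le> L2_set v A * L2_set (row_comb n \<omega> w) A" by (rule L2_set_mult_ineq)
    also have "\<dots> \<le> L2_set v A * (6 * sqrt (real n))"
    proof (rule mult_left_mono)
      have "L2_set (row_comb n \<omega> w) A \<le> sqrt (36 * real n)"
        unfolding L2_set_def by (rule real_sqrt_le_mono[OF b1[OF w]])
      also have "sqrt (36 * real n) = 6 * sqrt (real n)" by (simp add: real_sqrt_mult)
      finally show "L2_set (row_comb n \<omega> w) A \<le> 6 * sqrt (real n)" .
    qed simp
    finally show "(\<Sum>j=1..n. w j * mat_app N \<omega> v j) \<le> L2_set v A * (6 * sqrt (real n))" .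
  qed auto
  thus ?thesis by (simp add: mult_ac)
qed

text \<open>The resolution c/24 is matched to the operator bound 12 sqrt n: replacing a unit vector
  by a net point costs at most (c/2) sqrt n, half of what the net point provides.\<close>

lemma mat_app_lower:
  assumes W: "is_net {1..n} 1 W" and A: "A \<subseteq> {1..N}" "finite A" and c: "c > 0"
    and Net: "is_net A (c / 24) Y"
    and b1: "\<And>w. w \<in> W \<Longrightarrow> (\<Sum>i\<in>A. (row_comb n \<omega> w i)\<^sup>2) \<le> 36 * real n"
    and b2: "\<And>y. y \<in> Y \<Longrightarrow> (\<Sum>j=1..n. (mat_app N \<omega> y j)\<^sup>2) \<ge> c\<^sup>2 * real n"
    and v: "\<And>i. i \<notin> A \<Longrightarrow> v i = 0"
  shows "c / 2 * sqrt (real n) * L2_set v A \<le> L2_set (mat_app N \<omega> v) {1..n}"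
proof (cases "L2_set v A = 0")
  case False
  define L where "L = L2_set v A"
  have L: "L > 0" using False by (simp add: L_def less_le)
  define u where "u i = (1 / L) * v i" for i
  have "L2_set u A = 1" unfolding u_def L2_set_scale using L by (simp add: L_def)
  hence u: "unit_on A u" by (simp add: unit_on_def u_def v L2_set_def)
  then obtain y where y: "y \<in> Y" "(\<Sum>i\<in>A. (u i - y i)\<^sup>2) \<le> (c / 24)\<^sup>2" using Net by (auto simp: is_net_def)
  have y0: "y i = 0" if "i \<notin> A" for i using Net y that by (auto simp: is_net_def unit_on_def)
  define d where "d i = y i - u i" for i
  have "L2_set d A \<le> c / 24" unfolding L2_set_def d_def
    using y(2) c by (intro real_le_lsqrt) (auto simp: power2_commute sum_nonneg)
  have "L2_set (mat_app N \<omega> d) {1..n} \<le> 12 * sqrt (real n) * L2_set d A"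
    by (rule mat_app_upper[OF W A(1) b1]) (use u y0 in \<open>auto simp: d_def unit_on_def\<close>)
  also have "\<dots> \<le> 12 * sqrt (real n) * (c / 24)"
    using \<open>L2_set d A \<le> c / 24\<close> by (intro mult_left_mono) auto
  finally have d: "L2_set (mat_app N \<omega> d) {1..n} \<le> c / 2 * sqrt (real n)" by (simp add: mult_ac)
  have "c * sqrt (real n) = sqrt (c\<^sup>2 * real n)" using c by (simp add: real_sqrt_mult)
  also have "\<dots> \<le> L2_set (mat_app N \<omega> y) {1..n}" unfolding L2_set_def by (rule real_sqrt_le_mono[OF b2[OF y(1)]])
  also have "mat_app N \<omega> y = (\<lambda>j. mat_app N \<omega> u j + mat_app N \<omega> d j)"
    using mat_app_add[of N \<omega> u d] by (auto simp: d_def)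
  also have "L2_set (\<lambda>j. mat_app N \<omega> u j + mat_app N \<omega> d j) {1..n} \<le> L2_set (mat_app N \<omega> u) {1..n} + L2_set (mat_app N \<omega> d) {1..n}"
    by (rule L2_set_triangle_ineq)
  finally have "c / 2 * sqrt (real n) \<le> L2_set (mat_app N \<omega> u) {1..n}" using d by linarith
  also have "mat_app N \<omega> u = (\<lambda>j. (1 / L) * mat_app N \<omega> v j)" unfolding u_def by (rule ext) (rule mat_app_scale)
  also have "L2_set (\<lambda>j. (1 / L) * mat_app N \<omega> v j) {1..n} = L2_set (mat_app N \<omega> v) {1..n} / L"
    unfolding L2_set_scale using L by simp
  finally show ?thesis using L by (simp add: L_def[symmetric] field_simps)
qed simp

text \<open>
  A vector in the kernel is split into a sparse part \<open>a\<close> (the first \<open>k\<close> coordinates and the large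
  ones) and a flat part \<open>b\<close>. As \<open>G a = - G b\<close>, and \<open>G\<close> is bounded below on sparse vectors, both parts
  are controlled by the bound for the flat part.
\<close>

lemma kernel_vector_bound:
  fixes x :: "nat \<Rightarrow> real"
  assumes p: "p > 1" and q: "q = p / (p - 1)" and D: "D > 0" and n: "n \<ge> 1" and k: "k \<le> N" and c: "c > 0"
    and C3: "C3 \<ge> 0" and b: "b \<ge> 0" and \<tau>: "\<tau> > 0"
    and AA: "\<A> = (\<lambda>S. {1..k} \<union> S) ` {S \<in> Pow {k+1..N}. (\<Sum>i\<in>S. (D / \<rho> i) powr p) \<le> real n}"
    and W: "is_net {1..n} 1 W" and Net: "\<And>A. A \<in> \<A> \<Longrightarrow> is_net A (c / 24) (Net A)"
    and b1: "\<And>w A. w \<in> W \<Longrightarrow> A \<in> \<A> \<Longrightarrow> (\<Sum>i\<in>A. (row_comb n \<omega> w i)\<^sup>2) \<le> 36 * real n"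
    and b2: "\<And>A y. A \<in> \<A> \<Longrightarrow> y \<in> Net A \<Longrightarrow> (\<Sum>j=1..n. (mat_app N \<omega> y j)\<^sup>2) \<ge> c\<^sup>2 * real n"
    and b3: "\<And>w. w \<in> W \<Longrightarrow> (\<Sum>i\<in>{k+1..N}. trunc q D (\<rho> i) (row_comb n \<omega> w i)) \<le> C3 * real n"
    and \<rho>: "\<And>i. i \<in> {1..N} \<Longrightarrow> \<rho> i > 0" and t: "\<And>i. t i \<ge> 0" and tp: "(\<Sum>i=1..N. t i powr p) \<le> real n"
    and x: "\<And>i. i \<in> {1..N} \<Longrightarrow> \<bar>x i\<bar> = \<tau> * (\<rho> i * t i)"
    and ker: "\<And>j. j \<in> {1..n} \<Longrightarrow> mat_app N \<omega> x j = 0"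
    and \<rho>q: "(\<Sum>i\<in>{k+1..N}. \<rho> i powr q) \<le> b * real n"
  shows "L2_set x {1..N} \<le> \<tau> * sqrt (real n) * (4 * (1 + C3) / c + sqrt (D * (1 + b)))"
proof -
  have tpsub: "(\<Sum>i\<in>B. t i powr p) \<le> real n" if "B \<subseteq> {1..N}" for B
    using sum_mono2[OF _ that, of "\<lambda>i. t i powr p"] tp by simp
  define S where "S = {i\<in>{k+1..N}. \<rho> i * t i > D}"
  define A where "A = {1..k} \<union> S"
  define B where "B = {k+1..N} - S"
  have S1: "S \<subseteq> {k+1..N}" by (auto simp: S_def)
  have S2: "S \<subseteq> {1..N}" using S1 by auto
  have B1: "B \<subseteq> {1..N}" by (auto simp: B_def)
  have A1: "A \<subseteq> {1..N}" using S2 k by (auto simp: A_def)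
  have finA: "finite A" using A1 finite_subset by blast
  have BA: "{1..N} - A = B" "A \<inter> B = {}" using k by (auto simp: A_def B_def S_def)
  \<comment> \<open>A large coordinate has \<open>t i \<ge> D / \<rho> i\<close>, so the ellipsoid
    constraint bounds the weight of \<open>S\<close> and makes the support admissible.\<close>
  have "(\<Sum>i\<in>S. (D / \<rho> i) powr p) \<le> (\<Sum>i\<in>S. t i powr p)"
  proof (rule sum_mono)
    fix i assume i: "i \<in> S"
    hence "\<rho> i > 0" "D < \<rho> i * t i" using S2 \<rho> by (auto simp: S_def)
    hence "D / \<rho> i \<le> t i" by (simp add: field_simps)
    thus "(D / \<rho> i) powr p \<le> t i powr p" using D p \<open>\<rho> i > 0\<close> by (intro powr_mono2) auto
  qed
  also have "\<dots> \<le> real n" by (rule tpsub[OF S2])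
  finally have AinA: "A \<in> \<A>" unfolding AA A_def using S1 by auto
  define a where "a i = (if i \<in> A then x i else 0)" for i
  define d where "d i = (if i \<in> B then x i else 0)" for i
  have split: "x i = a i + d i" if "i \<in> {1..N}" for i using that BA by (auto simp: a_def d_def)
  have Gad: "mat_app N \<omega> a j = - mat_app N \<omega> d j" if "j \<in> {1..n}" for j
  proof -
    have "0 = mat_app N \<omega> x j" using ker[OF that] by simp
    also have "\<dots> = mat_app N \<omega> (\<lambda>i. a i + d i) j" unfolding mat_app_def by (rule sum.cong) (use split in auto)
    finally show ?thesis by (simp add: mat_app_add)
  qed
  have yb: "\<rho> i * t i \<le> D" if "i \<in> B" for i using that by (auto simp: B_def S_def)
  have Gd: "L2_set (mat_app N \<omega> d) {1..n} \<le> 2 * (\<tau> * ((1 + C3) * real n))"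
  proof (rule net_dual[OF _ W])
    show "0 \<le> \<tau> * ((1 + C3) * real n)" using \<tau> C3 by simp
    fix w assume w: "w \<in> W"
    let ?h = "row_comb n \<omega> w"
    have "(\<Sum>j=1..n. w j * mat_app N \<omega> d j) = (\<Sum>i\<in>B. d i * ?h i)"
      unfolding mat_app_dual by (rule sum.mono_neutral_right) (use B1 in \<open>auto simp: d_def\<close>)
    also have "\<dots> \<le> (\<Sum>i\<in>B. \<tau> * (t i powr p + trunc q D (\<rho> i) (?h i)))"
    proof (rule sum_mono)
      fix i assume i: "i \<in> B"
      have iN: "i \<in> {1..N}" using i B1 by auto
      have "d i * ?h i \<le> \<bar>x i\<bar> * \<bar>?h i\<bar>" using i by (simp add: d_def) (metis abs_ge_self abs_mult)
      also have "\<dots> = \<tau> * (\<rho> i * t i * \<bar>?h i\<bar>)" using x[OF iN] by simp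
      also have "\<rho> i * t i * \<bar>?h i\<bar> \<le> t i powr p + trunc q D (\<rho> i) (?h i)"
      proof -
        \<comment> \<open>Young's inequality gives the power branch of \<open>trunc\<close>, the cap
          \<open>\<rho> i * t i \<le> D\<close> the linear one.\<close>
        have 1: "(\<rho> i * \<bar>?h i\<bar>) * t i \<le> t i powr p + (\<rho> i * \<bar>?h i\<bar>) powr q"
          unfolding q by (rule young_simple[OF p t]) (use \<rho>[OF iN] in simp)
        have 2: "\<rho> i * t i * \<bar>?h i\<bar> \<le> t i powr p + D * \<bar>?h i\<bar>"
          using mult_right_mono[OF yb[OF i], of "\<bar>?h i\<bar>"] by (simp add: add_increasing)
        show ?thesis using 1 2 unfolding trunc_def by (simp add: mult_ac min_def)
      qed
      finally show "d i * ?h i \<le> \<tau> * (t i powr p + trunc q D (\<rho> i) (?h i))" using \<tau> by (simp add: mult_left_mono)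
    qed
    also have "\<dots> = \<tau> * ((\<Sum>i\<in>B. t i powr p) + (\<Sum>i\<in>B. trunc q D (\<rho> i) (?h i)))"
      by (simp add: sum_distrib_left[symmetric] sum.distrib)
    also have "\<dots> \<le> \<tau> * (real n + C3 * real n)"
    proof (intro mult_left_mono add_mono tpsub B1)
      have "(\<Sum>i\<in>B. trunc q D (\<rho> i) (?h i)) \<le> (\<Sum>i\<in>{k+1..N}. trunc q D (\<rho> i) (?h i))"
        by (rule sum_mono2) (use D in \<open>auto simp: B_def trunc_def\<close>)
      also have "\<dots> \<le> C3 * real n" by (rule b3[OF w])
      finally show "(\<Sum>i\<in>B. trunc q D (\<rho> i) (?h i)) \<le> C3 * real n" .
    qed (use \<tau> in simp)
    finally show "(\<Sum>j=1..n. w j * mat_app N \<omega> d j) \<le> \<tau> * ((1 + C3) * real n)" by (simp add: algebra_simps)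
  qed simp
  have "c / 2 * sqrt (real n) * L2_set a A \<le> L2_set (mat_app N \<omega> a) {1..n}"
    by (rule mat_app_lower[OF W A1 finA c Net[OF AinA] b1 b2]) (use AinA in \<open>auto simp: a_def\<close>)
  also have "L2_set (mat_app N \<omega> a) {1..n} = L2_set (mat_app N \<omega> d) {1..n}"
    unfolding L2_set_def using Gad by (intro arg_cong[where f = sqrt] sum.cong) auto
  also note Gd
  finally have "c / 2 * sqrt (real n) * L2_set a A \<le> 2 * (\<tau> * ((1 + C3) * real n))" .
  moreover have "2 * (\<tau> * ((1 + C3) * real n)) = sqrt (real n) * (2 * (\<tau> * ((1 + C3) * sqrt (real n))))"
  proof -
    have "sqrt (real n) * (2 * (\<tau> * ((1 + C3) * sqrt (real n)))) = 2 * (\<tau> * ((1 + C3) * (sqrt (real n) * sqrt (real n))))"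
      by (simp only: mult_ac)
    thus ?thesis by simp
  qed
  moreover have "sqrt (real n) * (c / 2 * L2_set a A) = c / 2 * sqrt (real n) * L2_set a A" by (simp only: mult_ac)
  ultimately have "sqrt (real n) * (c / 2 * L2_set a A) \<le> sqrt (real n) * (2 * (\<tau> * ((1 + C3) * sqrt (real n))))"
    by (simp only:)
  hence "c / 2 * L2_set a A \<le> 2 * (\<tau> * ((1 + C3) * sqrt (real n)))" using n by simp
  hence La: "L2_set a A \<le> \<tau> * sqrt (real n) * (4 * (1 + C3) / c)" using c by (simp add: field_simps)
  have LaN: "L2_set a {1..N} = L2_set a A" unfolding L2_set_def
    by (intro arg_cong[where f = sqrt] sum.mono_neutral_right) (use A1 in \<open>auto simp: a_def\<close>)
  \<comment> \<open>The norm of the flat part is bounded deterministically: in the square of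
    \<open>\<rho> i * t i\<close> one factor is at most D, and Young's inequality sums the
    other.\<close>
  have "(\<Sum>i=1..N. (d i)\<^sup>2) = (\<Sum>i\<in>B. (d i)\<^sup>2)"
    by (rule sum.mono_neutral_right) (use B1 in \<open>auto simp: d_def\<close>)
  also have "\<dots> \<le> (\<Sum>i\<in>B. \<tau>\<^sup>2 * (D * (t i powr p + \<rho> i powr q)))"
  proof (rule sum_mono)
    fix i assume i: "i \<in> B"
    have iN: "i \<in> {1..N}" using i B1 by auto
    have nn: "0 \<le> \<rho> i * t i" using \<rho>[OF iN] t[of i] by simp
    have "(d i)\<^sup>2 = \<bar>x i\<bar>\<^sup>2" using i by (simp add: d_def)
    also have "\<dots> = \<tau>\<^sup>2 * ((\<rho> i * t i) * (\<rho> i * t i))" unfolding x[OF iN] by (simp add: power2_eq_square mult_ac)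
    also have "\<dots> \<le> \<tau>\<^sup>2 * (D * (\<rho> i * t i))" using yb[OF i] nn by (intro mult_left_mono mult_right_mono) auto
    also have "\<dots> \<le> \<tau>\<^sup>2 * (D * (t i powr p + \<rho> i powr q))"
      unfolding q using young_simple[OF p t, of "\<rho> i" i] \<rho>[OF iN] D by (intro mult_left_mono) auto
    finally show "(d i)\<^sup>2 \<le> \<tau>\<^sup>2 * (D * (t i powr p + \<rho> i powr q))" .
  qed
  also have "\<dots> = \<tau>\<^sup>2 * (D * ((\<Sum>i\<in>B. t i powr p) + (\<Sum>i\<in>B. \<rho> i powr q)))"
    by (simp add: sum_distrib_left[symmetric] sum.distrib)
  also have "\<dots> \<le> \<tau>\<^sup>2 * (D * (real n + b * real n))"
  proof (intro mult_left_mono add_mono tpsub B1)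
    have "(\<Sum>i\<in>B. \<rho> i powr q) \<le> (\<Sum>i\<in>{k+1..N}. \<rho> i powr q)" by (rule sum_mono2) (auto simp: B_def)
    thus "(\<Sum>i\<in>B. \<rho> i powr q) \<le> b * real n" using \<rho>q by linarith
  qed (use D in auto)
  also have "\<dots> = \<tau>\<^sup>2 * (real n * (D * (1 + b)))" by (simp add: algebra_simps)
  finally have "L2_set d {1..N} \<le> sqrt (\<tau>\<^sup>2 * (real n * (D * (1 + b))))"
    unfolding L2_set_def by (rule real_sqrt_le_mono)
  also have "\<dots> = \<tau> * sqrt (real n) * sqrt (D * (1 + b))" using \<tau> by (simp add: real_sqrt_mult)
  finally have Ld: "L2_set d {1..N} \<le> \<tau> * sqrt (real n) * sqrt (D * (1 + b))" .
  have "L2_set x {1..N} = L2_set (\<lambda>i. a i + d i) {1..N}" by (rule L2_set_cong) (use split in auto)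
  also have "\<dots> \<le> L2_set a {1..N} + L2_set d {1..N}" by (rule L2_set_triangle_ineq)
  also have "\<dots> \<le> \<tau> * sqrt (real n) * (4 * (1 + C3) / c) + \<tau> * sqrt (real n) * sqrt (D * (1 + b))"
    using La LaN Ld by simp
  finally show ?thesis by (simp add: algebra_simps)
qed

section \<open>The upper tail\<close>


text \<open>
  \<open>net_const ^ d\<close> bounds the cardinality of a net of resolution \<open>exp (- 6) / 24\<close> of a \<open>d\<close>-dimensional
  sphere; \<open>sparsity\<close> is such that it is at most \<open>exp n\<close> for \<open>d \<le> 2 * sparsity * n\<close>.
\<close>

definition net_const :: real
  where "net_const = 4 * 2 powr (24 * exp 6 + 1)"

definition sparsity :: real
  where "sparsity = 1 / (2 * ln net_const)"

lemma net_const_ge: "net_const \<ge> 8"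
proof -
  have "(2::real) powr 1 \<le> 2 powr (24 * exp 6 + 1)" by (rule powr_mono) auto
  thus ?thesis by (simp add: net_const_def)
qed

lemma sparsity_bounds: "0 < sparsity" "sparsity \<le> 1 / 2"
proof -
  have "exp 1 \<le> (8::real)" using exp_le by linarith
  hence "1 \<le> ln (8::real)" by (simp add: ln_ge_iff)
  also have "\<dots> \<le> ln net_const" using net_const_ge by simp
  finally have l: "1 \<le> ln net_const" .
  show "0 < sparsity" "sparsity \<le> 1 / 2" using l by (auto simp: sparsity_def field_simps)
qed

lemma exp_two_sixteen: "(16::real) \<le> exp 4" "sqrt 2 \<le> exp (1::real)"
proof -
  have 2: "(2::real) \<le> exp 1" using exp_ge_add_one_self[of "1::real"] by simp
  have "(2::real) ^ 4 \<le> exp 1 ^ 4" by (rule power_mono[OF 2]) simp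
  also have "exp 1 ^ 4 = exp (4::real)" by (simp flip: exp_of_nat_mult)
  finally show "(16::real) \<le> exp 4" by simp
  have "sqrt 2 \<le> (2::real)" by (simp add: real_le_lsqrt)
  thus "sqrt 2 \<le> exp (1::real)" using 2 by linarith
qed

lemma gauss_sum_squares_set:
  assumes "finite K" "A \<subseteq> K"
  shows "{x\<in>space (gauss K). (\<Sum>i\<in>A. (x i)\<^sup>2) \<ge> t} \<in> sets (gauss K)"
    and "{x\<in>space (gauss K). (\<Sum>i\<in>A. (x i)\<^sup>2) \<le> t} \<in> sets (gauss K)"
proof -
  have [measurable]: "(\<lambda>x. x i) \<in> borel_measurable (gauss K)" if "i \<in> A" for i
    by (rule gauss_component_measurable) (use that assms in auto)
  show "{x\<in>space (gauss K). (\<Sum>i\<in>A. (x i)\<^sup>2) \<ge> t} \<in> sets (gauss K)"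
    "{x\<in>space (gauss K). (\<Sum>i\<in>A. (x i)\<^sup>2) \<le> t} \<in> sets (gauss K)" by measurable
qed

lemma gauss_trunc_set:
  assumes "A \<subseteq> K"
  shows "{x\<in>space (gauss K). (\<Sum>i\<in>A. trunc q D (r i) (x i)) \<ge> t} \<in> sets (gauss K)"
proof -
  have [measurable]: "(\<lambda>x. trunc q D (r i) (x i)) \<in> borel_measurable (gauss K)" if "i \<in> A" for i
    by (rule measurable_compose[OF gauss_component_measurable trunc_measurable]) (use that assms in auto)
  show ?thesis by measurable
qed

text \<open>Union bound: exp (4 n) net points and exp (2 n) supports against exp (- 8 n) for one
  pair. The threshold 36 n yields exp (- 9 n), of which the moment of at most n squares takes back
  exp n.\<close>

lemma bad_sparse_large:
  assumes W: "is_net {1..n} 1 W" "real (card W) \<le> 16 ^ n"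
    and fin: "finite \<A>" and cA: "real (card \<A>) \<le> exp (2 * real n)"
    and A: "\<And>A. A \<in> \<A> \<Longrightarrow> A \<subseteq> {1..N}" "\<And>A. A \<in> \<A> \<Longrightarrow> card A \<le> n"
  defines "X \<equiv> {\<omega>\<in>space (gauss_matrix n N). \<exists>z\<in>W \<times> \<A>. (\<Sum>i\<in>snd z. (row_comb n \<omega> (fst z) i)\<^sup>2) \<ge> 36 * real n}"
  shows "X \<in> sets (gauss_matrix n N)" "measure (gauss_matrix n N) X \<le> exp (- real n)"
proof -
  define P where "P z x \<longleftrightarrow> (\<Sum>i\<in>snd z. (x i)\<^sup>2) \<ge> 36 * real n" for z :: "(nat \<Rightarrow> real) \<times> nat set" and x :: "nat \<Rightarrow> real"
  have e: "X = {\<omega>\<in>space (gauss_matrix n N). \<exists>z\<in>W \<times> \<A>. P z (\<lambda>i\<in>{1..N}. row_comb n \<omega> (fst z) i)}"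
  proof -
    have "P z (\<lambda>i\<in>{1..N}. row_comb n \<omega> (fst z) i) \<longleftrightarrow> (\<Sum>i\<in>snd z. (row_comb n \<omega> (fst z) i)\<^sup>2) \<ge> 36 * real n"
      if "z \<in> W \<times> \<A>" for z \<omega>
    proof -
      have "(\<Sum>i\<in>snd z. ((\<lambda>i\<in>{1..N}. row_comb n \<omega> (fst z) i) i)\<^sup>2) = (\<Sum>i\<in>snd z. (row_comb n \<omega> (fst z) i)\<^sup>2)"
      proof (rule sum.cong[OF refl])
        fix i assume "i \<in> snd z"
        moreover have "snd z \<in> \<A>" using that by auto
        ultimately have "i \<in> {1..N}" using A(1) by blast
        thus "((\<lambda>i\<in>{1..N}. row_comb n \<omega> (fst z) i) i)\<^sup>2 = (row_comb n \<omega> (fst z) i)\<^sup>2" by simp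
      qed
      thus ?thesis by (simp add: P_def)
    qed
    thus ?thesis unfolding X_def by blast
  qed
  have finI: "finite (W \<times> \<A>)" using W fin by (auto simp: is_net_def)
  have ev: "{\<omega>\<in>space (gauss_matrix n N). P z (\<lambda>i\<in>{1..N}. row_comb n \<omega> (fst z) i)} \<in> sets (gauss_matrix n N)"
    "measure (gauss_matrix n N) {\<omega>\<in>space (gauss_matrix n N). P z (\<lambda>i\<in>{1..N}. row_comb n \<omega> (fst z) i)} \<le> exp (- 8 * real n)"
    if z: "z \<in> W \<times> \<A>" for z
  proof -
    have u: "unit_on {1..n} (fst z)" using W z by (auto simp: is_net_def)
    have "snd z \<in> \<A>" using z by auto
    note Az = A[OF this]
    have s: "{x\<in>space (gauss {1..N}). P z x} \<in> sets (gauss {1..N})"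
      unfolding P_def by (rule gauss_sum_squares_set(1)[OF _ Az(1)]) simp
    show "{\<omega>\<in>space (gauss_matrix n N). P z (\<lambda>i\<in>{1..N}. row_comb n \<omega> (fst z) i)} \<in> sets (gauss_matrix n N)"
      by (rule row_comb_event(1)[OF u s])
    have "measure (gauss {1..N}) {x\<in>space (gauss {1..N}). P z x} \<le> exp (- (36 * real n) / 4) * sqrt 2 ^ card (snd z)"
      unfolding P_def by (rule chi_square_upper[OF _ Az(1)]) simp
    also have "sqrt 2 ^ card (snd z) \<le> sqrt 2 ^ n" by (rule power_increasing[OF Az(2)]) simp
    also have "sqrt 2 ^ n \<le> exp 1 ^ n" by (rule power_mono[OF exp_two_sixteen(2)]) simp
    also have "exp 1 ^ n = exp (real n)" by (simp flip: exp_of_nat_mult)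
    also have "exp (- (36 * real n) / 4) * exp (real n) = exp (- 8 * real n)" by (simp flip: exp_add)
    finally show "measure (gauss_matrix n N) {\<omega>\<in>space (gauss_matrix n N). P z (\<lambda>i\<in>{1..N}. row_comb n \<omega> (fst z) i)} \<le> exp (- 8 * real n)"
      unfolding row_comb_event(2)[OF u s] by simp
  qed
  note fb = finite_Bex_event[OF finI ev]
  show "X \<in> sets (gauss_matrix n N)" unfolding e by (rule fb(1))
  have "measure (gauss_matrix n N) X \<le> real (card (W \<times> \<A>)) * exp (- 8 * real n)" unfolding e by (rule fb(2))
  also have "real (card (W \<times> \<A>)) = real (card W) * real (card \<A>)" by (simp add: card_cartesian_product)
  also have "\<dots> \<le> exp 4 ^ n * exp (2 * real n)"
  proof (rule mult_mono[OF _ cA])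
    show "real (card W) \<le> exp 4 ^ n" using W(2) power_mono[OF exp_two_sixteen(1), of n] by linarith
  qed auto
  also have "exp 4 ^ n * exp (2 * real n) = exp (6 * real n)" by (simp flip: exp_of_nat_mult exp_add)
  also have "exp (6 * real n) * exp (- 8 * real n) = exp (- 2 * real n)" by (simp flip: exp_add)
  also have "\<dots> \<le> exp (- real n)" by simp
  finally show "measure (gauss_matrix n N) X \<le> exp (- real n)" by (simp add: mult_right_mono)
qed

text \<open>Union bound: exp (2 n) supports with exp n net points each, against exp (- 5 n) for one
  point.\<close>

lemma bad_sparse_small:
  assumes n: "n \<ge> 1" and fin: "finite \<A>" and cA: "real (card \<A>) \<le> exp (2 * real n)"
    and A: "\<And>A. A \<in> \<A> \<Longrightarrow> A \<subseteq> {1..N}" "\<And>A. A \<in> \<A> \<Longrightarrow> real (card A) \<le> 2 * sparsity * real n"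
    and Net: "\<And>A. A \<in> \<A> \<Longrightarrow> is_net A (exp (- 6) / 24) (Net A)"
    and cN: "\<And>A. A \<in> \<A> \<Longrightarrow> real (card (Net A)) \<le> net_const ^ card A"
  defines "X \<equiv> {\<omega>\<in>space (gauss_matrix n N). \<exists>z\<in>Sigma \<A> Net. (\<Sum>j=1..n. (mat_app N \<omega> (snd z) j)\<^sup>2) \<le> (exp (- 6))\<^sup>2 * real n}"
  shows "X \<in> sets (gauss_matrix n N)" "measure (gauss_matrix n N) X \<le> exp (- real n)"
proof -
  define P where "P x \<longleftrightarrow> (\<Sum>j=1..n. (x j)\<^sup>2) \<le> (exp (- 6))\<^sup>2 * real n" for x :: "nat \<Rightarrow> real"
  have e: "X = {\<omega>\<in>space (gauss_matrix n N). \<exists>z\<in>Sigma \<A> Net. P (\<lambda>j\<in>{1..n}. mat_app N \<omega> (snd z) j)}"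
    by (simp add: X_def P_def)
  have finI: "finite (Sigma \<A> Net)" using Net fin by (auto simp: is_net_def)
  have ev: "{\<omega>\<in>space (gauss_matrix n N). P (\<lambda>j\<in>{1..n}. mat_app N \<omega> (snd z) j)} \<in> sets (gauss_matrix n N)"
    "measure (gauss_matrix n N) {\<omega>\<in>space (gauss_matrix n N). P (\<lambda>j\<in>{1..n}. mat_app N \<omega> (snd z) j)} \<le> exp (- 5 * real n)"
    if z: "z \<in> Sigma \<A> Net" for z
  proof -
    have z1: "fst z \<in> \<A>" "snd z \<in> Net (fst z)" using z by auto
    have u: "unit_on (fst z) (snd z)" using Net z1 by (auto simp: is_net_def)
    have "(\<Sum>i=1..N. (snd z i)\<^sup>2) = (\<Sum>i\<in>fst z. (snd z i)\<^sup>2)"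
      by (rule sum.mono_neutral_right) (use A(1)[OF z1(1)] u in \<open>auto simp: unit_on_def\<close>)
    hence u1: "(\<Sum>i=1..N. (snd z i)\<^sup>2) = 1" using u by (simp add: unit_on_def)
    have s: "{x\<in>space (gauss {1..n}). P x} \<in> sets (gauss {1..n})"
      unfolding P_def by (rule gauss_sum_squares_set(2)) auto
    show "{\<omega>\<in>space (gauss_matrix n N). P (\<lambda>j\<in>{1..n}. mat_app N \<omega> (snd z) j)} \<in> sets (gauss_matrix n N)"
      by (rule mat_app_event(1)[OF u1 s])
    \<comment> \<open>The reciprocal of the threshold per coordinate: the first factor of the bound
      becomes exp n, and the second is at most (1 / sqrt lam)^n = exp (- 6 n).\<close>
    define lam where "lam = 1 / (exp (- 6 :: real))\<^sup>2"
    have lam: "lam > 0" by (simp add: lam_def)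
    have "measure (gauss {1..n}) {x\<in>space (gauss {1..n}). P x} \<le> exp (lam * ((exp (- 6))\<^sup>2 * real n)) * (1 / sqrt (1 + 2 * lam)) ^ card {1..n}"
      unfolding P_def by (rule chi_square_lower[OF _ lam]) simp
    also have "lam * ((exp (- 6))\<^sup>2 * real n) = real n" by (simp add: lam_def)
    also have "1 / sqrt (1 + 2 * lam) \<le> exp (- 6)"
    proof -
      have "sqrt lam \<le> sqrt (1 + 2 * lam)" using lam by simp
      moreover have "lam = (exp 6)\<^sup>2" unfolding lam_def exp_minus by (simp add: divide_inverse power_inverse)
      hence "sqrt lam = exp 6" by simp
      ultimately have "1 / sqrt (1 + 2 * lam) \<le> 1 / exp 6" by (intro divide_left_mono) (auto simp: add_pos_pos lam)
      thus ?thesis by (simp add: exp_minus inverse_eq_divide)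
    qed
    hence "exp (real n) * (1 / sqrt (1 + 2 * lam)) ^ card {1..n} \<le> exp (real n) * exp (- 6) ^ n"
      using lam by (simp del: real_sqrt_inverse) (intro power_mono, auto)
    also have "\<dots> = exp (- 5 * real n)" by (simp flip: exp_of_nat_mult exp_add)
    finally show "measure (gauss_matrix n N) {\<omega>\<in>space (gauss_matrix n N). P (\<lambda>j\<in>{1..n}. mat_app N \<omega> (snd z) j)} \<le> exp (- 5 * real n)"
      unfolding mat_app_event(2)[OF u1 s] .
  qed
  note fb = finite_Bex_event[OF finI ev]
  show "X \<in> sets (gauss_matrix n N)" unfolding e by (rule fb(1))
  have lnpos: "ln net_const > 0" using net_const_ge by simp
  have "real (card (Sigma \<A> Net)) = (\<Sum>A\<in>\<A>. real (card (Net A)))"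
    using fin Net by (subst card_SigmaI) (auto simp: is_net_def)
  also have "\<dots> \<le> (\<Sum>A\<in>\<A>. exp (real n))"
  proof (rule sum_mono)
    fix A' assume A': "A' \<in> \<A>"
    have "net_const ^ card A' = exp (real (card A') * ln net_const)"
      using net_const_ge by (simp add: exp_of_nat_mult)
    also have "real (card A') * ln net_const \<le> 2 * sparsity * real n * ln net_const"
      using A(2)[OF A'] lnpos by (intro mult_right_mono) auto
    also have "\<dots> = real n" using lnpos by (simp add: sparsity_def)
    finally show "real (card (Net A')) \<le> exp (real n)" using cN[OF A'] by simp
  qed
  also have "\<dots> = real (card \<A>) * exp (real n)" by simp
  also have "\<dots> \<le> exp (2 * real n) * exp (real n)" by (intro mult_right_mono cA) auto
  finally have c: "real (card (Sigma \<A> Net)) \<le> exp (3 * real n)" by (simp flip: exp_add)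
  have "measure (gauss_matrix n N) X \<le> real (card (Sigma \<A> Net)) * exp (- 5 * real n)" unfolding e by (rule fb(2))
  also have "\<dots> \<le> exp (3 * real n) * exp (- 5 * real n)" by (intro mult_right_mono c) auto
  also have "\<dots> = exp (- 2 * real n)" by (simp flip: exp_add)
  also have "\<dots> \<le> exp (- real n)" by simp
  finally show "measure (gauss_matrix n N) X \<le> exp (- real n)" .
qed

text \<open>The first term of \<open>C3\<close> pays for the exponential moments; the 5 leaves exp
  (- 5 n) for one net point, against at most exp (4 n) points.\<close>

lemma bad_flat:
  assumes W: "is_net {1..n} 1 W" "real (card W) \<le> 16 ^ n" and q: "q > 0" and D: "D \<ge> 0"
    and \<rho>: "\<And>i. i \<in> {1..N} \<Longrightarrow> \<rho> i > 0" and \<rho>q: "(\<Sum>i\<in>{k+1..N}. \<rho> i powr q) \<le> b * real n"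
    and C3: "C3 = 2 * exp ((q + D)\<^sup>2) * b + 5"
  defines "X \<equiv> {\<omega>\<in>space (gauss_matrix n N). \<exists>w\<in>W. (\<Sum>i\<in>{k+1..N}. trunc q D (\<rho> i) (row_comb n \<omega> w i)) \<ge> C3 * real n}"
  shows "X \<in> sets (gauss_matrix n N)" "measure (gauss_matrix n N) X \<le> exp (- real n)"
proof -
  define P where "P x \<longleftrightarrow> (\<Sum>i\<in>{k+1..N}. trunc q D (\<rho> i) (x i)) \<ge> C3 * real n" for x :: "nat \<Rightarrow> real"
  have sub: "{k+1..N} \<subseteq> {1..N}" by auto
  have e: "X = {\<omega>\<in>space (gauss_matrix n N). \<exists>w\<in>W. P (\<lambda>i\<in>{1..N}. row_comb n \<omega> w i)}"
  proof -
    have "(\<Sum>i\<in>{k+1..N}. trunc q D (\<rho> i) ((\<lambda>i\<in>{1..N}. row_comb n \<omega> w i) i)) = (\<Sum>i\<in>{k+1..N}. trunc q D (\<rho> i) (row_comb n \<omega> w i))" for w \<omega>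
      by (rule sum.cong) auto
    thus ?thesis unfolding X_def P_def by simp
  qed
  have finI: "finite W" using W by (auto simp: is_net_def)
  have ev: "{\<omega>\<in>space (gauss_matrix n N). P (\<lambda>i\<in>{1..N}. row_comb n \<omega> w i)} \<in> sets (gauss_matrix n N)"
    "measure (gauss_matrix n N) {\<omega>\<in>space (gauss_matrix n N). P (\<lambda>i\<in>{1..N}. row_comb n \<omega> w i)} \<le> exp (- 5 * real n)"
    if w: "w \<in> W" for w
  proof -
    have u: "unit_on {1..n} w" using W w by (auto simp: is_net_def)
    have s: "{x\<in>space (gauss {1..N}). P x} \<in> sets (gauss {1..N})"
      unfolding P_def by (rule gauss_trunc_set[OF sub])
    show "{\<omega>\<in>space (gauss_matrix n N). P (\<lambda>i\<in>{1..N}. row_comb n \<omega> w i)} \<in> sets (gauss_matrix n N)"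
      by (rule row_comb_event(1)[OF u s])
    have "measure (gauss {1..N}) {x\<in>space (gauss {1..N}). P x} \<le> exp (2 * exp ((q + D)\<^sup>2) * (\<Sum>i\<in>{k+1..N}. \<rho> i powr q) - C3 * real n)"
      unfolding P_def by (rule trunc_sum_tail[OF _ sub q D]) (use \<rho> sub in \<open>auto intro: less_imp_le\<close>)
    also have "\<dots> \<le> exp (- 5 * real n)"
    proof -
      have "2 * exp ((q + D)\<^sup>2) * (\<Sum>i\<in>{k+1..N}. \<rho> i powr q) \<le> 2 * exp ((q + D)\<^sup>2) * (b * real n)"
        by (intro mult_left_mono \<rho>q) auto
      thus ?thesis unfolding C3 by (simp add: algebra_simps)
    qed
    finally show "measure (gauss_matrix n N) {\<omega>\<in>space (gauss_matrix n N). P (\<lambda>i\<in>{1..N}. row_comb n \<omega> w i)} \<le> exp (- 5 * real n)"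
      unfolding row_comb_event(2)[OF u s] .
  qed
  note fb = finite_Bex_event[OF finI ev]
  show "X \<in> sets (gauss_matrix n N)" unfolding e by (rule fb(1))
  have "measure (gauss_matrix n N) X \<le> real (card W) * exp (- 5 * real n)" unfolding e by (rule fb(2))
  also have "\<dots> \<le> exp 4 ^ n * exp (- 5 * real n)"
  proof (rule mult_right_mono)
    show "real (card W) \<le> exp 4 ^ n" using W(2) power_mono[OF exp_two_sixteen(1), of n] by linarith
  qed simp
  also have "\<dots> = exp (- real n)" by (simp flip: exp_of_nat_mult exp_add)
  finally show "measure (gauss_matrix n N) X \<le> exp (- real n)" .
qed

text \<open>The scale \<open>s\<close> stands for the n-th semiaxis, and \<open>b\<close> collects
  what the argument has to know about the others. The constant depends on p and b alone, hence
  neither on n nor on N.\<close>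

lemma section_radius_upper_tail:
  assumes p: "p > 1" and b: "b > 0"
  shows "\<exists>C>0. \<forall>n N k \<sigma> s. 1 \<le> n \<longrightarrow> n < N \<longrightarrow> real k \<le> sparsity * real n \<longrightarrow> s > 0 \<longrightarrow>
    (\<forall>i\<in>{1..N}. \<sigma> i > 0) \<longrightarrow> (\<forall>i\<in>{k+1..N}. \<sigma> i \<le> b * s) \<longrightarrow>
    (\<Sum>i\<in>{k+1..N}. (\<sigma> i / s) powr (p / (p - 1))) \<le> b * real n \<longrightarrow>
    measure (haar_grassmannian N n) {E\<in>space (haar_grassmannian N n).
      section_radius N (p_ellipsoid N p \<sigma>) E > C * (s * real n powr (1 / 2 - 1 / p))} \<le> 3 * exp (- real n)"
proof -
  define q where "q = p / (p - 1)"
  define r where "r = 1 / (p - 1)"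
  have q: "q > 0" and r: "r > 0" using p by (auto simp: q_def r_def)
  \<comment> \<open>The second bound makes every weight at least 1 / sparsity, so that
    \<open>S\<close> has at most sparsity * n elements; the third makes the weights so large that
    the sum of exp (- weight) is at most n.\<close>
  define D where "D = max 1 (max (b / sparsity powr (1 / p)) ((r powr r * b) powr (1 / q)))"
  have D: "D \<ge> 1" "D \<ge> b / sparsity powr (1 / p)" "D \<ge> (r powr r * b) powr (1 / q)" by (auto simp: D_def)
  define C3 where "C3 = 2 * exp ((q + D)\<^sup>2) * b + 5"
  have C3: "C3 \<ge> 0" using b by (auto simp: C3_def)
  define c where "c = exp (- 6 :: real)"
  define C where "C = 4 * (1 + C3) / c + sqrt (D * (1 + b))"
  have C: "C > 0" unfolding C_def using C3 D(1) b by (intro add_pos_nonneg) (simp_all add: c_def)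
  note sp = sparsity_bounds
  show ?thesis
  proof (intro exI[of _ C] conjI C allI impI)
    fix n N k :: nat and \<sigma> :: "nat \<Rightarrow> real" and s :: real
    assume n: "1 \<le> n" and nN: "n < N" and k: "real k \<le> sparsity * real n" and s: "s > 0"
      and \<sigma>: "\<forall>i\<in>{1..N}. \<sigma> i > 0" and \<sigma>b: "\<forall>i\<in>{k+1..N}. \<sigma> i \<le> b * s"
      and \<sigma>q: "(\<Sum>i\<in>{k+1..N}. (\<sigma> i / s) powr (p / (p - 1))) \<le> b * real n"
    define \<rho> where "\<rho> i = \<sigma> i / s" for i
    have \<rho>: "\<rho> i > 0" if "i \<in> {1..N}" for i using \<sigma> that s by (simp add: \<rho>_def)
    have \<rho>b: "\<rho> i \<le> b" if "i \<in> {k+1..N}" for i using \<sigma>b that s by (simp add: \<rho>_def divide_le_eq)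
    have \<rho>q: "(\<Sum>i\<in>{k+1..N}. \<rho> i powr q) \<le> b * real n" using \<sigma>q by (simp add: \<rho>_def q_def)
    have "sparsity * real n \<le> 1 * real n" using sp by (intro mult_right_mono) auto
    hence "real k \<le> real n" using k by linarith
    hence kN: "k \<le> N" using nN by simp
    define \<S> where "\<S> = {S \<in> Pow {k+1..N}. (\<Sum>i\<in>S. (D / \<rho> i) powr p) \<le> real n}"
    define \<A> where "\<A> = (\<lambda>S. {1..k} \<union> S) ` \<S>"
    have finS: "finite \<S>" by (simp add: \<S>_def)
    have v: "(D / \<rho> i) powr p \<ge> 1 / sparsity" "exp (- ((D / \<rho> i) powr p)) \<le> \<rho> i powr q / b" if i: "i \<in> {k+1..N}" for i
    proof -
      have \<rho>i: "\<rho> i > 0" "\<rho> i \<le> b" using \<rho> \<rho>b i by auto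
      have "1 / sparsity powr (1 / p) \<le> D / b" using D(2) b by (simp add: field_simps)
      also have "\<dots> \<le> D / \<rho> i" using \<rho>i D by (intro divide_left_mono) auto
      finally have "(1 / sparsity powr (1 / p)) powr p \<le> (D / \<rho> i) powr p" using p by (intro powr_mono2) auto
      thus "(D / \<rho> i) powr p \<ge> 1 / sparsity" using p sp by (simp add: powr_divide powr_powr)
      have D0: "D > 0" using D by simp
      \<comment> \<open>The exponent r is q / p, so that the power bound on exp (- weight)
        reproduces the q-th powers whose sum is controlled.\<close>
      have pr: "p * r = q" using p by (simp add: r_def q_def)
      have "exp (- ((D / \<rho> i) powr p)) \<le> r powr r * ((D / \<rho> i) powr p) powr (- r)"
        using \<rho>i D0 by (intro exp_minus_le_powr r) simp
      also have "((D / \<rho> i) powr p) powr (- r) = \<rho> i powr q / D powr q"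
        using \<rho>i D0 pr by (simp add: powr_powr powr_minus powr_divide)
      also have "r powr r * (\<rho> i powr q / D powr q) \<le> \<rho> i powr q / b"
      proof -
        have "((r powr r * b) powr (1 / q)) powr q \<le> D powr q" using D(3) q by (intro powr_mono2) auto
        hence "r powr r * b \<le> D powr q" using q b r by (simp add: powr_powr)
        hence "r powr r * b * \<rho> i powr q \<le> D powr q * \<rho> i powr q" by (intro mult_right_mono) auto
        thus ?thesis using b D0 by (simp add: field_simps)
      qed
      finally show "exp (- ((D / \<rho> i) powr p)) \<le> \<rho> i powr q / b" .
    qed
    have cA: "real (card \<A>) \<le> exp (2 * real n)"
    proof -
      have "real (card \<A>) \<le> real (card \<S>)" unfolding \<A>_def using card_image_le[OF finS] by simp
      also have "\<dots> \<le> exp (real n + (\<Sum>i\<in>{k+1..N}. exp (- ((D / \<rho> i) powr p))))"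
        unfolding \<S>_def by (rule card_weighted_subsets_le) simp
      also have "(\<Sum>i\<in>{k+1..N}. exp (- ((D / \<rho> i) powr p))) \<le> (\<Sum>i\<in>{k+1..N}. \<rho> i powr q / b)"
        by (rule sum_mono[OF v(2)])
      also have "\<dots> = (\<Sum>i\<in>{k+1..N}. \<rho> i powr q) / b" by (simp add: sum_divide_distrib)
      also have "\<dots> \<le> real n" using \<rho>q b by (simp add: divide_le_eq mult.commute)
      finally show ?thesis by simp
    qed
    have A1: "A \<subseteq> {1..N}" if "A \<in> \<A>" for A using that kN by (auto simp: \<A>_def \<S>_def)
    have A2: "real (card A) \<le> 2 * sparsity * real n" if A: "A \<in> \<A>" for A
    proof -
      obtain S where S: "S \<in> \<S>" "A = {1..k} \<union> S" using A by (auto simp: \<A>_def)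
      have "(\<Sum>i\<in>S. 1 / sparsity) \<le> (\<Sum>i\<in>S. (D / \<rho> i) powr p)"
        by (rule sum_mono) (use S v(1) in \<open>auto simp: \<S>_def\<close>)
      also have "\<dots> \<le> real n" using S by (simp add: \<S>_def)
      finally have "real (card S) \<le> sparsity * real n" using sp by (simp add: field_simps)
      moreover have "card A \<le> k + card S" using card_Un_le[of "{1..k}" S] S by simp
      ultimately show ?thesis using k by simp
    qed
    have A3: "card A \<le> n" if "A \<in> \<A>" for A
    proof -
      have "2 * sparsity * real n \<le> 1 * real n" using sp by (intro mult_right_mono) auto
      thus ?thesis using A2[OF that] by linarith
    qed
    have finA: "finite \<A>" using finS by (simp add: \<A>_def)
    obtain W where W: "is_net {1..n} 1 W" "real (card W) \<le> 16 ^ n"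
      using unit_net_exists[of 1 "{1..n}"] by auto
    have "\<exists>Y. is_net A (c / 24) Y \<and> real (card Y) \<le> net_const ^ card A" if "A \<in> \<A>" for A
    proof -
      have "finite A" using A1[OF that] finite_subset by blast
      moreover have "1 / (c / 24) + 1 = 24 * exp 6 + 1" by (simp add: c_def exp_minus field_simps)
      ultimately show ?thesis using unit_net_exists[of "c / 24" A] by (auto simp: net_const_def c_def)
    qed
    then obtain Net where Net: "\<And>A. A \<in> \<A> \<Longrightarrow> is_net A (c / 24) (Net A)"
      "\<And>A. A \<in> \<A> \<Longrightarrow> real (card (Net A)) \<le> net_const ^ card A" by metis
    let ?G = "gauss_matrix n N"
    interpret G: prob_space ?G by (rule prob_space_gauss)
    define X1 where "X1 = {\<omega>\<in>space ?G. \<exists>z\<in>W \<times> \<A>. (\<Sum>i\<in>snd z. (row_comb n \<omega> (fst z) i)\<^sup>2) \<ge> 36 * real n}"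
    define X2 where "X2 = {\<omega>\<in>space ?G. \<exists>z\<in>Sigma \<A> Net. (\<Sum>j=1..n. (mat_app N \<omega> (snd z) j)\<^sup>2) \<le> (exp (- 6))\<^sup>2 * real n}"
    define X3 where "X3 = {\<omega>\<in>space ?G. \<exists>w\<in>W. (\<Sum>i\<in>{k+1..N}. trunc q D (\<rho> i) (row_comb n \<omega> w i)) \<ge> C3 * real n}"
    define X0 where "X0 = {\<omega>\<in>space ?G. \<not> nondegenerate N n (row_vec N \<omega>)}"
    have X1: "X1 \<in> sets ?G" "measure ?G X1 \<le> exp (- real n)"
      unfolding X1_def by (rule bad_sparse_large[OF W finA cA A1 A3]; assumption)+
    have X2: "X2 \<in> sets ?G" "measure ?G X2 \<le> exp (- real n)"
      unfolding X2_def by (rule bad_sparse_small[OF n finA cA A1 A2 Net[unfolded c_def]]; assumption)+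
    have D0: "D \<ge> 0" using D by simp
    have X3: "X3 \<in> sets ?G" "measure ?G X3 \<le> exp (- real n)"
      unfolding X3_def by (rule bad_flat[OF W q D0 \<rho> \<rho>q C3_def]; assumption)+
    have X0s: "X0 = space ?G - {\<omega>\<in>space ?G. nondegenerate N n (row_vec N \<omega>)}" by (auto simp: X0_def)
    have X0: "X0 \<in> sets ?G" "measure ?G X0 = 0"
      unfolding X0s by (intro sets.Diff sets.top nondegenerate_set)
        (use measure_zero_of_AE[OF AE_nondegenerate[of n N]] nN X0s in \<open>simp add: X0_def\<close>)
    define R where "R = C * (s * real n powr (1 / 2 - 1 / p))"
    let ?B = "grassmannian_borel N n"
    have main: "section_radius N (p_ellipsoid N p \<sigma>) (kernel_space N n \<omega>) \<le> R" if \<omega>: "\<omega> \<in> space ?G" "\<omega> \<notin> X0 \<union> X1 \<union> X2 \<union> X3" for \<omega>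
    proof (rule section_radius_le)
      have nd: "nondegenerate N n (row_vec N \<omega>)" using \<omega> by (auto simp: X0_def)
      have ke: "kernel_space N n \<omega> = kernel N n (row_vec N \<omega>)" using nd by (simp add: kernel_space_def)
      show "0 \<in> kernel_space N n \<omega>" unfolding ke by (rule subspace_0[OF subspace_kernel(1)])
      fix x assume x: "x \<in> kernel_space N n \<omega>" "x \<in> p_ellipsoid N p \<sigma>"
      \<comment> \<open>In these units the ellipsoid constraint says that the
        \<open>t i powr p\<close> sum to at most n. The absolute value of \<open>\<sigma> i\<close>
        makes t nonnegative also at indices outside {1..N}.\<close>
      define \<tau> where "\<tau> = s * real n powr (- (1 / p))"
      define t where "t i = real n powr (1 / p) * (\<bar>x i\<bar> / \<bar>\<sigma> i\<bar>)" for i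
      have n0: "real n > 0" using n by simp
      have "L2_set x {1..N} \<le> \<tau> * sqrt (real n) * (4 * (1 + C3) / c + sqrt (D * (1 + b)))"
      proof (rule kernel_vector_bound[OF p q_def _ n kN _ C3 _ _ \<A>_def[unfolded \<S>_def] W(1) Net(1)])
        show "D > 0" "c > 0" "b \<ge> 0" "\<tau> > 0" using D b s n by (auto simp: c_def \<tau>_def)
        show "(\<Sum>i\<in>A. (row_comb n \<omega> w i)\<^sup>2) \<le> 36 * real n" if "w \<in> W" "A \<in> \<A>" for w A
          using \<omega> that by (fastforce simp: X1_def)
        show "c\<^sup>2 * real n \<le> (\<Sum>j=1..n. (mat_app N \<omega> y j)\<^sup>2)" if "A \<in> \<A>" "y \<in> Net A" for A y
          using \<omega> that by (fastforce simp: X2_def c_def)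
        show "(\<Sum>i\<in>{k+1..N}. trunc q D (\<rho> i) (row_comb n \<omega> w i)) \<le> C3 * real n" if "w \<in> W" for w
          using \<omega> that by (fastforce simp: X3_def)
        show "\<rho> i > 0" if "i \<in> {1..N}" for i by (rule \<rho>[OF that])
        show "t i \<ge> 0" for i by (simp add: t_def)
        have "(\<Sum>i=1..N. t i powr p) = (\<Sum>i=1..N. real n * (\<bar>x i\<bar> / \<sigma> i) powr p)"
        proof (rule sum.cong[OF refl])
          fix i assume i: "i \<in> {1..N}"
          have "t i powr p = (real n powr (1 / p)) powr p * (\<bar>x i\<bar> / \<bar>\<sigma> i\<bar>) powr p" unfolding t_def powr_mult ..
          also have "\<bar>\<sigma> i\<bar> = \<sigma> i" using \<sigma> i by (simp add: less_imp_le)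
          finally show "t i powr p = real n * (\<bar>x i\<bar> / \<sigma> i) powr p" using p by (simp add: powr_powr)
        qed
        also have "\<dots> = real n * (\<Sum>i=1..N. (\<bar>x i\<bar> / \<sigma> i) powr p)" by (simp add: sum_distrib_left)
        also have "\<dots> \<le> real n * 1" using x(2) by (intro mult_left_mono) (auto simp: p_ellipsoid_def)
        finally show "(\<Sum>i=1..N. t i powr p) \<le> real n" by simp
        show "\<bar>x i\<bar> = \<tau> * (\<rho> i * t i)" if i: "i \<in> {1..N}" for i
        proof -
          have "\<sigma> i > 0" using \<sigma> i by simp
          moreover have "real n powr (- (1 / p)) * real n powr (1 / p) = 1" using n0 by (simp flip: powr_add)
          ultimately show ?thesis using s by (simp add: \<tau>_def \<rho>_def t_def field_simps)
        qed
        show "mat_app N \<omega> x j = 0" if "j \<in> {1..n}" for j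
        proof -
          have "ip N (row_vec N \<omega> j) x = 0" using x(1) that by (auto simp: ke kernel_def)
          moreover have "mat_app N \<omega> x j = ip N (row_vec N \<omega> j) x"
            unfolding mat_app_def ip_def by (rule sum.cong) (auto simp: row_vec_def)
          ultimately show ?thesis by simp
        qed
        show "(\<Sum>i\<in>{k+1..N}. \<rho> i powr q) \<le> b * real n" by (rule \<rho>q)
      qed
      also have "\<tau> * sqrt (real n) = s * real n powr (1 / 2 - 1 / p)"
        using n0 by (simp add: \<tau>_def powr_half_sqrt[symmetric] powr_add[symmetric])
      finally show "L2_set x {1..N} \<le> R" by (simp add: R_def C_def mult.commute)
    qed
    have m: "kernel_space N n \<in> ?G \<rightarrow>\<^sub>M ?B" by (rule kernel_space_measurable) (use nN in simp)
    have ev: "{E\<in>space ?B. section_radius N (p_ellipsoid N p \<sigma>) E > R} \<in> sets ?B"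
      by (rule borel_measurable_less) (use p in \<open>auto intro!: section_radius_measurable \<sigma>\<close>)
    have H: "haar_grassmannian N n = distr ?G ?B (kernel_space N n)" by (rule haar_kernel) (use nN in simp)
    have "measure (haar_grassmannian N n) {E\<in>space (haar_grassmannian N n). section_radius N (p_ellipsoid N p \<sigma>) E > R}
      = measure ?G (kernel_space N n -` {E\<in>space ?B. section_radius N (p_ellipsoid N p \<sigma>) E > R} \<inter> space ?G)"
      unfolding H using measure_distr[OF m ev] by simp
    also have "\<dots> \<le> measure ?G (X0 \<union> X1 \<union> X2 \<union> X3)"
    proof (rule G.finite_measure_mono)
      show "kernel_space N n -` {E\<in>space ?B. section_radius N (p_ellipsoid N p \<sigma>) E > R} \<inter> space ?G \<subseteq> X0 \<union> X1 \<union> X2 \<union> X3"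
        using main by fastforce
    qed (use X0 X1 X2 X3 in auto)
    also have "\<dots> \<le> measure ?G X0 + measure ?G X1 + measure ?G X2 + measure ?G X3"
      using measure_Un_le[OF X0(1) X1(1)] measure_Un_le[OF sets.Un[OF X0(1) X1(1)] X2(1)]
        measure_Un_le[OF sets.Un[OF sets.Un[OF X0(1) X1(1)] X2(1)] X3(1)] by linarith
    also have "\<dots> \<le> 3 * exp (- real n)" using X0 X1 X2 X3 by simp
    finally show "measure (haar_grassmannian N n) {E\<in>space (haar_grassmannian N n).
      section_radius N (p_ellipsoid N p \<sigma>) E > C * (s * real n powr (1 / 2 - 1 / p))} \<le> 3 * exp (- real n)"
      by (simp add: R_def)
  qed
qed

section \<open>The lower tail\<close>


lemma Rvec_mono: "m \<le> N \<Longrightarrow> Rvec m \<subseteq> Rvec N"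
  by (auto simp: Rvec_def)

lemma sum_Rvec_eq:
  fixes m N :: nat
  assumes "m \<le> N" "\<And>i. i \<in> {1..N} \<Longrightarrow> i \<notin> {1..m} \<Longrightarrow> f i = 0" shows "(\<Sum>i=1..N. f i) = (\<Sum>i=1..m. f i)"
proof (rule sum.mono_neutral_right)
  show "finite {1..N}" by simp
  show "{1..m} \<subseteq> {1..N}" using assms(1) by simp
  show "\<forall>i\<in>{1..N} - {1..m}. f i = 0" using assms(2) by blast
qed

lemma Rvec_zero: "x \<in> Rvec m \<Longrightarrow> i \<notin> {1..m} \<Longrightarrow> x i = 0"
  unfolding Rvec_def by blast

lemma p_ellipsoid_mono:
  assumes "m \<le> N" "p > 0" shows "p_ellipsoid m p \<sigma> \<subseteq> p_ellipsoid N p \<sigma>"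
proof
  fix x assume x: "x \<in> p_ellipsoid m p \<sigma>"
  hence xR: "x \<in> Rvec m" by (simp add: p_ellipsoid_def)
  have "(\<Sum>i=1..N. (\<bar>x i\<bar> / \<sigma> i) powr p) = (\<Sum>i=1..m. (\<bar>x i\<bar> / \<sigma> i) powr p)"
    by (rule sum_Rvec_eq[OF assms(1)]) (use assms in \<open>simp add: Rvec_zero[OF xR]\<close>)
  thus "x \<in> p_ellipsoid N p \<sigma>" using x Rvec_mono[OF assms(1)] by (auto simp: p_ellipsoid_def)
qed

lemma section_radius_mono:
  assumes mN: "m \<le> N" and p: "p > 0" and \<sigma>: "\<forall>i\<in>{1..N}. \<sigma> i > 0" and E: "E \<in> grassmannian m n" and sub: "E \<subseteq> E'"
  shows "section_radius m (p_ellipsoid m p \<sigma>) E \<le> section_radius N (p_ellipsoid N p \<sigma>) E'"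
proof (rule section_radius_le)
  show "0 \<in> E" by (rule subspace_0[OF grassmannianD(1)[OF E]])
  fix y assume y: "y \<in> E" "y \<in> p_ellipsoid m p \<sigma>"
  have yR: "y \<in> Rvec m" using y by (simp add: p_ellipsoid_def)
  have "L2_set y {1..m} = L2_set y {1..N}" unfolding L2_set_def
    by (subst sum_Rvec_eq[OF mN]) (simp_all add: Rvec_zero[OF yR])
  also have "\<dots> \<le> section_radius N (p_ellipsoid N p \<sigma>) E'"
    by (rule section_radius_ge[OF p \<sigma>]) (use y sub p_ellipsoid_mono[OF mN p] in auto)
  finally show "L2_set y {1..m} \<le> section_radius N (p_ellipsoid N p \<sigma>) E'" .
qed

text \<open>
  The kernel of an \<open>n\<close> by \<open>N\<close> Gaussian matrix contains the kernel of its first \<open>n + 1\<close> columns, whose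
  law is by uniqueness of the Haar measure that of the line spanned by a Gaussian vector.
\<close>

lemma section_radius_lower_tail_le_line:
  assumes nN: "n < N" and p: "p > 0" and \<sigma>: "\<forall>i\<in>{1..N}. \<sigma> i > 0"
    and Bad: "Bad \<in> sets (gauss {1..n+1})"
    and line: "\<And>h. h \<in> space (gauss {1..n+1}) \<Longrightarrow> h \<notin> Bad \<Longrightarrow>
      R \<le> section_radius (n+1) (p_ellipsoid (n+1) p \<sigma>) (line_space (n+1) h)"
  shows "measure (haar_grassmannian N n) {E\<in>space (haar_grassmannian N n). section_radius N (p_ellipsoid N p \<sigma>) E < R}
    \<le> measure (gauss {1..n+1}) Bad"
proof -
  define m where "m = n + 1"
  have mN: "m \<le> N" and nm: "n \<le> m" and m1: "m \<ge> 1" and mn: "m - 1 = n" using nN by (auto simp: m_def)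
  have nN': "n \<le> N" using nN by simp
  let ?G = "gauss_matrix n N" and ?Gm = "gauss_matrix n m" and ?g = "gauss {1..m}"
  let ?B = "grassmannian_borel N n" and ?Bm = "grassmannian_borel m n"
  let ?s = "\<lambda>E. section_radius N (p_ellipsoid N p \<sigma>) E" and ?sm = "\<lambda>E. section_radius m (p_ellipsoid m p \<sigma>) E"
  interpret G: prob_space ?G by (rule prob_space_gauss)
  interpret g: prob_space ?g by (rule prob_space_gauss)
  have \<sigma>m: "\<forall>i\<in>{1..m}. \<sigma> i > 0" using \<sigma> mN by auto
  define r where "r \<omega> = (\<lambda>z\<in>{1..n} \<times> {1..m}. \<omega> z)" for \<omega> :: "nat \<times> nat \<Rightarrow> real"
  have rm: "r \<in> ?G \<rightarrow>\<^sub>M ?Gm" unfolding r_def gauss_def by (rule measurable_restrict) (use mN in auto)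
  have rd: "distr ?G ?Gm r = ?Gm" unfolding r_def by (rule gauss_reindex[of "\<lambda>z. z"]) (use mN in auto)
  note kN = kernel_space_measurable[OF nN'] and km = kernel_space_measurable[OF nm]
  have evN: "{E\<in>space ?B. ?s E < R} \<in> sets ?B"
    by (rule borel_measurable_less[OF section_radius_measurable[OF p \<sigma>]]) simp
  have evm: "{E\<in>space ?Bm. ?sm E < R} \<in> sets ?Bm"
    by (rule borel_measurable_less[OF section_radius_measurable[OF p \<sigma>m]]) simp
  have lm: "line_space m \<in> ?g \<rightarrow>\<^sub>M ?Bm" using line_space_measurable[OF m1] by (simp add: mn)
  have sub: "kernel m n (row_vec m (r \<omega>)) \<subseteq> kernel N n (row_vec N \<omega>)" for \<omega>
  proof
    fix x assume x: "x \<in> kernel m n (row_vec m (r \<omega>))"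
    hence xR: "x \<in> Rvec m" by (simp add: kernel_def)
    have "ip N (row_vec N \<omega> j) x = 0" if j: "j \<in> {1..n}" for j
    proof -
      have "ip N (row_vec N \<omega> j) x = (\<Sum>i=1..m. row_vec N \<omega> j i * x i)"
        unfolding ip_def by (rule sum_Rvec_eq[OF mN]) (simp add: Rvec_zero[OF xR])
      also have "\<dots> = ip m (row_vec m (r \<omega>) j) x"
        unfolding ip_def by (rule sum.cong) (use j mN in \<open>auto simp: row_vec_def r_def\<close>)
      finally show ?thesis using x j by (simp add: kernel_def)
    qed
    thus "x \<in> kernel N n (row_vec N \<omega>)" using xR Rvec_mono[OF mN] by (auto simp: kernel_def)
  qed
  have AE1: "AE \<omega> in ?G. nondegenerate N n (row_vec N \<omega>)" by (rule AE_nondegenerate[OF nN'])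
  have AE2: "AE \<omega> in ?G. nondegenerate m n (row_vec m (r \<omega>))"
  proof -
    have "AE \<omega> in distr ?G ?Gm r. nondegenerate m n (row_vec m \<omega>)" unfolding rd by (rule AE_nondegenerate[OF nm])
    thus ?thesis by (subst (asm) AE_distr_iff[OF rm nondegenerate_set])
  qed
  have AE: "AE \<omega> in ?G. \<omega> \<in> kernel_space N n -` {E\<in>space ?B. ?s E < R} \<inter> space ?G \<longrightarrow>
      \<omega> \<in> r -` (kernel_space m n -` {E\<in>space ?Bm. ?sm E < R} \<inter> space ?Gm) \<inter> space ?G"
    using AE1 AE2
  proof eventually_elim
    case (elim \<omega>)
    have "?sm (kernel_space m n (r \<omega>)) \<le> ?s (kernel_space N n \<omega>)"
      by (rule section_radius_mono[OF mN p \<sigma> kernel_space_grassmannian[OF nm]]) (use elim sub in \<open>simp add: kernel_space_def\<close>)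
    thus ?case using measurable_space[OF rm] kernel_space_grassmannian[OF nm] by auto
  qed
  have hN: "haar_grassmannian N n = distr ?G ?B (kernel_space N n)" by (rule haar_kernel[OF nN'])
  have hm: "haar_grassmannian m n = distr ?Gm ?Bm (kernel_space m n)" by (rule haar_kernel[OF nm])
  have hl: "haar_grassmannian m n = distr ?g ?Bm (line_space m)" using haar_line[OF m1] by (simp add: mn)
  have "measure (haar_grassmannian N n) {E\<in>space (haar_grassmannian N n). ?s E < R}
    = measure ?G (kernel_space N n -` {E\<in>space ?B. ?s E < R} \<inter> space ?G)"
    unfolding hN using measure_distr[OF kN evN] by simp
  also have "\<dots> \<le> measure ?G (r -` (kernel_space m n -` {E\<in>space ?Bm. ?sm E < R} \<inter> space ?Gm) \<inter> space ?G)"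
    by (rule G.finite_measure_mono_AE[OF AE]) (rule measurable_sets[OF rm measurable_sets[OF km evm]])
  also have "\<dots> = measure (distr ?G ?Gm r) (kernel_space m n -` {E\<in>space ?Bm. ?sm E < R} \<inter> space ?Gm)"
    by (rule measure_distr[OF rm measurable_sets[OF km evm], symmetric])
  also have "\<dots> = measure (distr ?Gm ?Bm (kernel_space m n)) {E\<in>space ?Bm. ?sm E < R}"
    unfolding rd by (rule measure_distr[OF km evm, symmetric])
  \<comment> \<open>Both laws are the Haar measure on the lines in dimension n + 1.\<close>
  also have "\<dots> = measure (distr ?g ?Bm (line_space m)) {E\<in>space ?Bm. ?sm E < R}"
    using hm hl by simp
  also have "\<dots> = measure ?g (line_space m -` {E\<in>space ?Bm. ?sm E < R} \<inter> space ?g)"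
    by (rule measure_distr[OF lm evm])
  also have "\<dots> \<le> measure ?g Bad"
  proof (rule g.finite_measure_mono)
    show "line_space m -` {E\<in>space ?Bm. ?sm E < R} \<inter> space ?g \<subseteq> Bad"
      using line unfolding m_def by fastforce
  qed (use Bad in \<open>simp add: m_def\<close>)
  finally show ?thesis by (simp add: m_def)
qed

text \<open>The ellipsoid contains the p-ball of radius s, and the multiple \<open>lam\<close> of h
  is a point of that ball on the line.\<close>

lemma line_section_radius_ge:
  assumes m: "m \<ge> 1" and p: "p > 0" and \<sigma>: "\<forall>i\<in>{1..m}. \<sigma> i \<ge> s" and s: "s > 0" and lam: "lam \<ge> 0"
    and h: "(\<Sum>i=1..m. (lam * \<bar>h i\<bar>) powr p) \<le> s powr p" and nz: "vec_of m h \<noteq> 0"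
  shows "lam * L2_set h {1..m} \<le> section_radius m (p_ellipsoid m p \<sigma>) (line_space m h)"
proof -
  define y where "y = lam *\<^sub>R vec_of m h"
  have yi: "y i = lam * h i" if "i \<in> {1..m}" for i using that by (simp add: y_def vec_of_def)
  have \<sigma>pos: "\<forall>i\<in>{1..m}. \<sigma> i > 0" using \<sigma> s by force
  have "y \<in> line_space m h" unfolding line_space_def y_def using nz by (auto intro: span_scale span_base)
  moreover have "y \<in> p_ellipsoid m p \<sigma>"
  proof -
    have "(\<Sum>i=1..m. (\<bar>y i\<bar> / \<sigma> i) powr p) \<le> (\<Sum>i=1..m. (lam * \<bar>h i\<bar>) powr p / s powr p)"
    proof (rule sum_mono)
      fix i assume i: "i \<in> {1..m}"
      have "\<bar>y i\<bar> / \<sigma> i \<le> (lam * \<bar>h i\<bar>) / s"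
        unfolding yi[OF i] using \<sigma> s lam i by (auto simp: abs_mult intro!: divide_left_mono mult_pos_pos bspec[OF \<sigma>pos])
      hence "(\<bar>y i\<bar> / \<sigma> i) powr p \<le> ((lam * \<bar>h i\<bar>) / s) powr p"
        using p bspec[OF \<sigma>pos i] by (intro powr_mono2) auto
      thus "(\<bar>y i\<bar> / \<sigma> i) powr p \<le> (lam * \<bar>h i\<bar>) powr p / s powr p" by (simp only: powr_divide)
    qed
    also have "\<dots> \<le> 1" using h s by (simp add: sum_divide_distrib[symmetric])
    finally show ?thesis unfolding p_ellipsoid_def y_def
      using subspace_scale[OF subspace_Rvec vec_of_Rvec] by blast
  qed
  ultimately have "L2_set y {1..m} \<le> section_radius m (p_ellipsoid m p \<sigma>) (line_space m h)"
    by (rule section_radius_ge[OF p \<sigma>pos])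
  moreover have "L2_set y {1..m} = L2_set (\<lambda>i. lam * h i) {1..m}" by (rule L2_set_cong) (simp_all add: yi)
  ultimately show ?thesis using lam by (simp add: L2_set_scale)
qed

lemma rate_le:
  assumes n: "n \<ge> 1" and p: "p > 1"
  shows "real n powr (1 / 2 - 1 / p) \<le> 2 * (sqrt (real (n + 1)) * real (n + 1) powr (- (1 / p)))"
proof -
  have n0: "real n > 0" using n by simp
  have "real n powr (1 / 2 - 1 / p) = sqrt (real n) * real n powr (- (1 / p))"
    using n0 by (simp add: powr_half_sqrt[symmetric] powr_add[symmetric])
  also have "\<dots> \<le> sqrt (real (n + 1)) * (2 * real (n + 1) powr (- (1 / p)))"
  proof (rule mult_mono)
    have "real (n + 1) powr (1 / p) \<le> (2 * real n) powr (1 / p)" using n p by (intro powr_mono2) auto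
    also have "\<dots> = 2 powr (1 / p) * real n powr (1 / p)" by (simp add: powr_mult)
    also have "\<dots> \<le> 2 * real n powr (1 / p)"
      using p powr_mono[of "1 / p" 1 "2::real"] by (intro mult_right_mono) auto
    finally show "real n powr (- (1 / p)) \<le> 2 * real (n + 1) powr (- (1 / p))"
      using n0 by (simp add: powr_minus field_simps)
  qed auto
  finally show ?thesis by simp
qed

text \<open>For p \<le> 2 the p-norm is at most m powr (1/p - 1/2) times the Euclidean norm, for
  every vector; up to the constant lost below, every line therefore satisfies the lower bound, and
  the exceptional event is null.\<close>

lemma section_radius_lower_small_p:
  assumes p: "p > 1" "p \<le> 2" and n: "n \<ge> 1" and nN: "n < N" and s: "s > 0"
    and \<sigma>: "\<forall>i\<in>{1..N}. \<sigma> i > 0" "\<forall>i\<in>{1..n+1}. \<sigma> i \<ge> s"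
  shows "measure (haar_grassmannian N n) {E\<in>space (haar_grassmannian N n).
    section_radius N (p_ellipsoid N p \<sigma>) E < (1 / 4) * (s * real n powr (1 / 2 - 1 / p))} = 0"
proof -
  define m where "m = n + 1"
  have m: "m \<ge> 1" "real m > 0" by (auto simp: m_def)
  have p0: "p > 0" using p by simp
  define Bad where "Bad = {h\<in>space (gauss {1..m}). vec_of m h = 0}"
  have Bad: "Bad \<in> sets (gauss {1..m})" unfolding Bad_def by (rule gauss_vec_zero_set)
  have Bad0: "measure (gauss {1..m}) Bad = 0"
    using measure_zero_of_AE[OF AE_gauss_vec_nonzero[OF m(1)]] by (simp add: Bad_def)
  have line: "(1 / 4) * (s * real n powr (1 / 2 - 1 / p)) \<le> section_radius m (p_ellipsoid m p \<sigma>) (line_space m h)"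
    if h: "h \<in> space (gauss {1..m})" "h \<notin> Bad" for h
  proof -
    have nz: "vec_of m h \<noteq> 0" using h by (simp add: Bad_def)
    define L where "L = L2_set h {1..m}"
    have "ip m (vec_of m h) (vec_of m h) > 0"
      using ip_self_eq_0[OF vec_of_Rvec, of m h] nz ip_self_nonneg[of m "vec_of m h"] by force
    also have "ip m (vec_of m h) (vec_of m h) = (\<Sum>i=1..m. (h i)\<^sup>2)"
      unfolding ip_def by (rule sum.cong) (auto simp: vec_of_def power2_eq_square)
    finally have L: "L > 0" unfolding L_def L2_set_def by simp
    have L2: "(\<Sum>i=1..m. (h i)\<^sup>2) = L\<^sup>2" unfolding L_def L2_set_def by (simp add: sum_nonneg)
    \<comment> \<open>The factor sqrt m / L makes the squares of the numbers a below sum to m. Since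
      a powr p \<le> 1 + a^2, the p-th powers sum to at most 2 m, which (2 m) powr (- 1/p)
      compensates.\<close>
    define lam where "lam = s * (2 * real m) powr (- (1 / p)) * sqrt (real m) / L"
    have lam: "lam \<ge> 0" using s L by (simp add: lam_def)
    have "(\<Sum>i=1..m. (lam * \<bar>h i\<bar>) powr p) \<le> (\<Sum>i=1..m. s powr p / (2 * real m) * (1 + real m / L\<^sup>2 * (h i)\<^sup>2))"
    proof (rule sum_mono)
      fix i
      define a where "a = sqrt (real m) / L * \<bar>h i\<bar>"
      have a0: "a \<ge> 0" using L by (simp add: a_def)
      have "lam * \<bar>h i\<bar> = s * (2 * real m) powr (- (1 / p)) * a" by (simp add: lam_def a_def)
      hence "(lam * \<bar>h i\<bar>) powr p = s powr p * ((2 * real m) powr (- (1 / p))) powr p * a powr p"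
        by (simp only: powr_mult)
      also have "((2 * real m) powr (- (1 / p))) powr p = 1 / (2 * real m)"
        unfolding powr_powr using p0 m by (simp add: powr_minus inverse_eq_divide)
      also have "s powr p * (1 / (2 * real m)) * a powr p \<le> s powr p * (1 / (2 * real m)) * (1 + a\<^sup>2)"
      proof (rule mult_left_mono)
        show "a powr p \<le> 1 + a\<^sup>2"
        proof (cases "a \<le> 1")
          case True
          have "a powr p \<le> 1 powr p" using True a0 p by (intro powr_mono2) auto
          thus ?thesis by (simp add: add_increasing2)
        next
          case False
          have "a powr p \<le> a powr 2" using False p by (intro powr_mono) auto
          thus ?thesis using False by simp
        qed
      qed (use m in simp)
      also have "a\<^sup>2 = real m / L\<^sup>2 * (h i)\<^sup>2" by (simp add: a_def power_mult_distrib power_divide)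
      finally show "(lam * \<bar>h i\<bar>) powr p \<le> s powr p / (2 * real m) * (1 + real m / L\<^sup>2 * (h i)\<^sup>2)" by simp
    qed
    also have "\<dots> = s powr p / (2 * real m) * (real m + real m / L\<^sup>2 * L\<^sup>2)"
      unfolding L2[symmetric] sum_distrib_left[symmetric] sum.distrib by simp
    also have "\<dots> = s powr p" using m L by simp
    finally have "lam * L2_set h {1..m} \<le> section_radius m (p_ellipsoid m p \<sigma>) (line_space m h)"
      using line_section_radius_ge[OF m(1) p0 _ s lam _ nz] \<sigma>(2) by (simp add: m_def)
    moreover have "lam * L2_set h {1..m} = s * (2 * real m) powr (- (1 / p)) * sqrt (real m)"
      using L by (simp add: lam_def L_def)
    moreover have "(1 / 4) * (s * real n powr (1 / 2 - 1 / p)) \<le> s * (2 * real m) powr (- (1 / p)) * sqrt (real m)"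
    proof -
      have "(1 / 2 :: real) \<le> 2 powr (- (1 / p))"
        using powr_mono[of "- 1" "- (1 / p)" "2 :: real"] p by (simp add: powr_minus)
      hence "(1 / 2) * real m powr (- (1 / p)) \<le> (2 * real m) powr (- (1 / p))"
        unfolding powr_mult by (rule mult_right_mono) simp
      hence "s * ((1 / 2) * real m powr (- (1 / p))) * sqrt (real m) \<le> s * (2 * real m) powr (- (1 / p)) * sqrt (real m)"
        using s by (intro mult_right_mono mult_left_mono) auto
      moreover have "(1 / 4) * (s * real n powr (1 / 2 - 1 / p)) \<le> (1 / 4) * (s * (2 * (sqrt (real m) * real m powr (- (1 / p)))))"
        using rate_le[OF n p(1)] s by (intro mult_left_mono) (auto simp: m_def)
      ultimately show ?thesis by (simp add: mult_ac)
    qed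
    ultimately show ?thesis by simp
  qed
  have "measure (haar_grassmannian N n) {E\<in>space (haar_grassmannian N n).
    section_radius N (p_ellipsoid N p \<sigma>) E < (1 / 4) * (s * real n powr (1 / 2 - 1 / p))} \<le> measure (gauss {1..m}) Bad"
    unfolding m_def by (rule section_radius_lower_tail_le_line[OF nN p0 \<sigma>(1)]) (use Bad line in \<open>simp_all add: m_def\<close>)
  thus ?thesis using Bad0 by (simp add: measure_le_0_iff)
qed


section \<open>The p-norm of a Gaussian vector for p > 2\<close>

text \<open>The divisor makes the values at most y^2/8. The exponential then costs exp (y^2/8) and
  the power itself, up to a constant, another exp (y^2/8): together the exp (y^2/4) of
  \<open>exp_moment_le\<close>.\<close>

definition flat_power :: "real \<Rightarrow> real \<Rightarrow> real \<Rightarrow> real"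
  where "flat_power p M y = (if \<bar>y\<bar> \<le> M then \<bar>y\<bar> powr p / (8 * M powr (p - 2)) else 0)"

lemma powr_le_exp_square: "p > 0 \<Longrightarrow> \<bar>y\<bar> powr p \<le> exp (2 * p\<^sup>2 + y\<^sup>2 / 8)" for y p :: real
  using abs_powr_le_exp[of p y] mult_abs_le_square[of 2 p y] by (simp add: order_trans[OF _ exp_le_cancel_iff[THEN iffD2]])

lemma flat_power_le:
  assumes p: "p > 2" and M: "M > 0"
  shows "0 \<le> flat_power p M y" "flat_power p M y \<le> y\<^sup>2 / 8"
proof -
  show "0 \<le> flat_power p M y" by (simp add: flat_power_def)
  show "flat_power p M y \<le> y\<^sup>2 / 8"
  proof (cases "\<bar>y\<bar> \<le> M \<and> y \<noteq> 0")
    case True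
    have "\<bar>y\<bar> powr p = \<bar>y\<bar> powr ((p - 2) + 2)" by simp
    also have "\<dots> = \<bar>y\<bar> powr (p - 2) * \<bar>y\<bar> powr 2" by (rule powr_add)
    also have "\<bar>y\<bar> powr 2 = y\<^sup>2" using True by (simp add: powr_numeral)
    also have "\<bar>y\<bar> powr (p - 2) * y\<^sup>2 \<le> M powr (p - 2) * y\<^sup>2" using True p by (intro mult_right_mono powr_mono2) auto
    finally show ?thesis using True M by (simp add: flat_power_def field_simps)
  qed (auto simp: flat_power_def)
qed

lemma flat_power_exp_moment:
  assumes p: "p > 2" and M: "M > 0"
  shows "(\<integral>\<^sup>+y. ennreal (exp (flat_power p M y)) \<partial>stdn) \<le> ennreal (exp (2 * (exp (2 * p\<^sup>2) / (8 * M powr (p - 2)))))"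
proof (rule exp_moment_le)
  fix y
  have "flat_power p M y * exp (flat_power p M y) \<le> (\<bar>y\<bar> powr p / (8 * M powr (p - 2))) * exp (y\<^sup>2 / 8)"
    using flat_power_le[OF p M, of y] by (intro mult_mono) (auto simp: flat_power_def)
  also have "\<dots> \<le> (exp (2 * p\<^sup>2 + y\<^sup>2 / 8) / (8 * M powr (p - 2))) * exp (y\<^sup>2 / 8)"
    using powr_le_exp_square[of p y] p by (intro mult_right_mono divide_right_mono) auto
  also have "\<dots> = exp (2 * p\<^sup>2) / (8 * M powr (p - 2)) * (exp (y\<^sup>2 / 8) * exp (y\<^sup>2 / 8))" by (simp add: exp_add)
  also have "exp (y\<^sup>2 / 8) * exp (y\<^sup>2 / 8) = exp (y\<^sup>2 / 4)" by (simp flip: exp_add)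
  finally show "flat_power p M y * exp (flat_power p M y) \<le> exp (2 * p\<^sup>2) / (8 * M powr (p - 2)) * exp (y\<^sup>2 / 4)" .
qed (use M in simp)

lemma flat_power_measurable: "flat_power p M \<in> borel_measurable borel"
  unfolding flat_power_def by measurable

text \<open>
  For \<open>p > 2\<close> the entries above \<open>M = C m powr (1/p)\<close> are excluded by a union bound; below this level
  \<open>\<bar>y\<bar> powr p \<le> M powr (p - 2) * y\<^sup>2\<close>, so that an exponential moment is available.
\<close>

lemma gauss_power_sum_tail:
  assumes p: "p > 2" and A: "A \<ge> 0"
  shows "\<exists>T>0. \<forall>m\<ge>1. measure (gauss {1..m}) {h\<in>space (gauss {1..m}). (\<Sum>i=1..m. \<bar>h i\<bar> powr p) > T * real m}
    \<le> 2 * exp (- A * p * real m powr (2 / p))"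
proof -
  \<comment> \<open>Here C^2/4 = p (A + 1). With X = m powr (2/p), the union bound over m entries
    costs p X / 2 in the exponent, another p X / 2 \<ge> 1 covers sqrt 2, and A p X remains.\<close>
  define C where "C = 2 * sqrt (p * (A + 1))"
  have C: "C > 0" using p A by (simp add: C_def)
  \<comment> \<open>The first term pays for the exponential moments of the m entries. The second
    pays for the deviation: multiplied by l m = X / (8 C powr (p - 2)), with l and X as below, it
    gives A p X.\<close>
  define T where "T = 2 * exp (2 * p\<^sup>2) + 8 * C powr (p - 2) * (p * A)"
  have T: "T > 0" using p A by (simp add: T_def add_pos_nonneg)
  show ?thesis
  proof (intro exI[of _ T] conjI T allI impI)
    fix m :: nat assume m: "m \<ge> 1"
    let ?g = "gauss {1..m}"
    interpret g: prob_space ?g by (rule prob_space_gauss)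
    define X where "X = real m powr (2 / p)"
    have m0: "real m > 0" using m by simp
    have X1: "X \<ge> 1" unfolding X_def using m p by (intro ge_one_powr_ge_zero) auto
    define M where "M = C * real m powr (1 / p)"
    have M: "M > 0" using C m0 by (simp add: M_def)
    have M2: "M\<^sup>2 = C\<^sup>2 * X"
    proof -
      have "(real m powr (1 / p))\<^sup>2 = X" unfolding X_def by (simp add: power2_eq_square flip: powr_add)
      thus ?thesis by (simp add: M_def power_mult_distrib)
    qed
    have C2: "C\<^sup>2 = 4 * (p * (A + 1))" using p A by (simp add: C_def power_mult_distrib)
    define l where "l = 1 / (8 * M powr (p - 2))"
    have lm: "l * real m = X / (8 * C powr (p - 2))"
    proof -
      have "M powr (p - 2) = C powr (p - 2) * real m powr (1 / p * (p - 2))" by (simp add: M_def powr_mult powr_powr)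
      moreover have "real m powr (1 / p * (p - 2)) * X = real m"
      proof -
        have "1 / p * (p - 2) + 2 / p = 1" using p by (simp add: field_simps)
        thus ?thesis unfolding X_def powr_add[symmetric] using m0 by simp
      qed
      ultimately show ?thesis using C m0 by (simp add: l_def field_simps)
    qed
    define B1 where "B1 = {h\<in>space ?g. \<exists>i\<in>{1..m}. (h i)\<^sup>2 \<ge> M\<^sup>2}"
    define B2 where "B2 = {h\<in>space ?g. (\<Sum>i=1..m. flat_power p M (h i)) \<ge> l * (T * real m)}"
    have s1: "{h\<in>space ?g. (h i)\<^sup>2 \<ge> M\<^sup>2} \<in> sets ?g" "measure ?g {h\<in>space ?g. (h i)\<^sup>2 \<ge> M\<^sup>2} \<le> exp (- M\<^sup>2 / 4) * sqrt 2"
      if "i \<in> {1..m}" for i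
      using gauss_sum_squares_set(1)[of "{1..m}" "{i}" "M\<^sup>2"] chi_square_upper[of "{1..m}" "{i}" "M\<^sup>2"] that by simp_all
    have fb: "B1 \<in> sets ?g" "measure ?g B1 \<le> real (card {1..m}) * (exp (- M\<^sup>2 / 4) * sqrt 2)"
      unfolding B1_def by (rule finite_Bex_event[where P = "\<lambda>i h. (h i)\<^sup>2 \<ge> M\<^sup>2", OF _ s1]; simp)+
    have B1: "B1 \<in> sets ?g" "measure ?g B1 \<le> exp (- A * p * X)"
    proof -
      show "B1 \<in> sets ?g" by (rule fb(1))
      have "measure ?g B1 \<le> real m * (exp (- M\<^sup>2 / 4) * sqrt 2)" using fb(2) by simp
      also have "real m * (exp (- M\<^sup>2 / 4) * sqrt 2) \<le> exp (p / 2 * X) * (exp (- M\<^sup>2 / 4) * exp 1)"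
      proof (intro mult_mono exp_two_sixteen(2) order_refl)
        \<comment> \<open>As m = X powr (p/2), the entropy of the union bound is at most p X / 2, of
          the same form as the exponent sought.\<close>
        have "ln (real m) = p / 2 * ln X" unfolding X_def using m0 p by (simp add: ln_powr)
        also have "\<dots> \<le> p / 2 * X" using p X1 ln_le_minus_one[of X] by (intro mult_left_mono) auto
        finally have "exp (ln (real m)) \<le> exp (p / 2 * X)" by simp
        thus "real m \<le> exp (p / 2 * X)" using m0 by simp
      qed auto
      also have "\<dots> = exp (p / 2 * X - M\<^sup>2 / 4 + 1)" by (simp flip: exp_add)
      also have "\<dots> \<le> exp (- A * p * X)"
      proof -
        have "1 * 1 \<le> p / 2 * X" using p X1 by (intro mult_mono) auto
        moreover have "M\<^sup>2 / 4 = A * p * X + p * X" unfolding M2 C2 by (simp add: algebra_simps)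
        moreover have "p / 2 * X = p * X / 2" "- A * p * X = - (A * p * X)" by simp_all
        ultimately have "p / 2 * X - M\<^sup>2 / 4 + 1 \<le> - A * p * X" by linarith
        thus ?thesis by simp
      qed
      finally show "measure ?g B1 \<le> exp (- A * p * X)" .
    qed
    have fm: "(\<lambda>h. flat_power p M (h i)) \<in> borel_measurable ?g" if "i \<in> {1..m}" for i
      by (rule measurable_compose[OF gauss_component_measurable[OF that] flat_power_measurable])
    have B2: "B2 \<in> sets ?g" "measure ?g B2 \<le> exp (- A * p * X)"
    proof -
      have [measurable]: "(\<lambda>h. flat_power p M (h i)) \<in> borel_measurable ?g" if "i \<in> {1..m}" for i by (rule fm[OF that])
      show "B2 \<in> sets ?g" unfolding B2_def by measurable
      have "measure ?g B2 \<le> exp (- (l * (T * real m))) * (\<Prod>i\<in>{1..m}. exp (2 * (exp (2 * p\<^sup>2) / (8 * M powr (p - 2)))))"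
        unfolding B2_def by (rule gauss_exp_moment[OF _ _ flat_power_measurable flat_power_exp_moment[OF p M]]) auto
      also have "2 * (exp (2 * p\<^sup>2) / (8 * M powr (p - 2))) = 2 * exp (2 * p\<^sup>2) * l" by (simp add: l_def)
      also have "(\<Prod>i\<in>{1..m}. exp (2 * exp (2 * p\<^sup>2) * l)) = exp (real m * (2 * exp (2 * p\<^sup>2) * l))"
        by (simp flip: exp_of_nat_mult)
      also have "exp (- (l * (T * real m))) * \<dots> = exp (- (l * real m) * (T - 2 * exp (2 * p\<^sup>2)))"
        by (simp flip: exp_add add: algebra_simps)
      also have "- (l * real m) * (T - 2 * exp (2 * p\<^sup>2)) = - A * p * X"
        unfolding lm using C by (simp add: T_def)
      finally show "measure ?g B2 \<le> exp (- A * p * X)" .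
    qed
    have "{h\<in>space ?g. (\<Sum>i=1..m. \<bar>h i\<bar> powr p) > T * real m} \<subseteq> B1 \<union> B2"
    proof
      fix h assume "h \<in> {h\<in>space ?g. (\<Sum>i=1..m. \<bar>h i\<bar> powr p) > T * real m}"
      hence h: "h \<in> space ?g" "(\<Sum>i=1..m. \<bar>h i\<bar> powr p) > T * real m" by auto
      show "h \<in> B1 \<union> B2"
      proof (cases "h \<in> B1")
        case False
        have "\<bar>h i\<bar> \<le> M" if "i \<in> {1..m}" for i
        proof -
          have "\<not> (h i)\<^sup>2 \<ge> M\<^sup>2" using False h(1) that by (auto simp: B1_def)
          thus ?thesis using M by (metis abs_le_square_iff abs_of_pos linear)
        qed
        hence "(\<Sum>i=1..m. flat_power p M (h i)) = (\<Sum>i=1..m. l * \<bar>h i\<bar> powr p)"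
          by (intro sum.cong) (auto simp: flat_power_def l_def)
        also have "\<dots> = l * (\<Sum>i=1..m. \<bar>h i\<bar> powr p)" by (simp add: sum_distrib_left)
        also have "\<dots> \<ge> l * (T * real m)" using h(2) M by (intro mult_left_mono) (auto simp: l_def)
        finally show ?thesis using h(1) by (simp add: B2_def)
      qed simp
    qed
    hence "measure ?g {h\<in>space ?g. (\<Sum>i=1..m. \<bar>h i\<bar> powr p) > T * real m} \<le> measure ?g (B1 \<union> B2)"
      by (rule g.finite_measure_mono) (use B1 B2 in auto)
    also have "\<dots> \<le> measure ?g B1 + measure ?g B2" by (rule measure_Un_le[OF B1(1) B2(1)])
    also have "\<dots> \<le> 2 * exp (- A * p * X)" using B1(2) B2(2) by simp
    finally show "measure ?g {h\<in>space ?g. (\<Sum>i=1..m. \<bar>h i\<bar> powr p) > T * real m} \<le> 2 * exp (- A * p * real m powr (2 / p))"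
      by (simp add: X_def)
  qed
qed

lemma gauss_norm_small_ball:
  assumes c: "c > 0"
  shows "measure (gauss {1..m}) {h\<in>space (gauss {1..m}). (\<Sum>i=1..m. (h i)\<^sup>2) \<le> c\<^sup>2 * real m} \<le> (exp 1 * c) ^ m"
proof -
  define lam where "lam = 1 / c\<^sup>2"
  have lam: "lam > 0" using c by (simp add: lam_def)
  have "measure (gauss {1..m}) {h\<in>space (gauss {1..m}). (\<Sum>i=1..m. (h i)\<^sup>2) \<le> c\<^sup>2 * real m}
    \<le> exp (lam * (c\<^sup>2 * real m)) * (1 / sqrt (1 + 2 * lam)) ^ card {1..m}"
    by (rule chi_square_lower[OF _ lam]) simp
  also have "lam * (c\<^sup>2 * real m) = real m" using c by (simp add: lam_def)
  also have "exp (real m) = exp 1 ^ m" by (simp flip: exp_of_nat_mult)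
  also have "(1 / sqrt (1 + 2 * lam)) ^ card {1..m} \<le> c ^ m"
  proof -
    have "sqrt lam \<le> sqrt (1 + 2 * lam)" using lam by simp
    moreover have "sqrt lam = 1 / c" using c by (simp add: lam_def real_sqrt_divide)
    ultimately have "1 / sqrt (1 + 2 * lam) \<le> 1 / (1 / c)" using c lam by (intro divide_left_mono) (auto intro!: mult_pos_pos)
    thus ?thesis using lam by simp (intro power_mono, auto)
  qed
  finally show ?thesis by (simp add: power_mult_distrib)
qed

lemma section_radius_lower_large_p:
  assumes p: "p > 2" and A: "A \<ge> 0"
  shows "\<exists>c>0. \<forall>n N \<sigma> s. 1 \<le> n \<longrightarrow> n < N \<longrightarrow> s > 0 \<longrightarrow> (\<forall>i\<in>{1..N}. \<sigma> i > 0) \<longrightarrow> (\<forall>i\<in>{1..n+1}. \<sigma> i \<ge> s) \<longrightarrow>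
    measure (haar_grassmannian N n) {E\<in>space (haar_grassmannian N n).
      section_radius N (p_ellipsoid N p \<sigma>) E < c * (s * real n powr (1 / 2 - 1 / p))} \<le> 3 * exp (- A * p * real n powr (2 / p))"
proof -
  obtain T where T: "T > 0" "\<And>m. m \<ge> 1 \<Longrightarrow> measure (gauss {1..m}) {h\<in>space (gauss {1..m}). (\<Sum>i=1..m. \<bar>h i\<bar> powr p) > T * real m}
    \<le> 2 * exp (- A * p * real m powr (2 / p))"
    using gauss_power_sum_tail[OF p A] by auto
  \<comment> \<open>Then exp 1 * d = exp (- A p), so the Euclidean norm is below d sqrt m with
    probability at most exp (- A p m), and m \<ge> m powr (2/p).\<close>
  define d where "d = exp (- (A * p + 1))"
  have d: "d > 0" by (simp add: d_def)
  \<comment> \<open>The half compensates the factor 2 of \<open>rate_le\<close>, the price of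
    passing from n + 1 to n.\<close>
  define c where "c = d * T powr (- (1 / p)) / 2"
  have c: "c > 0" using d T by (simp add: c_def)
  have p0: "p > 0" "p > 1" using p by auto
  show ?thesis
  proof (intro exI[of _ c] conjI c allI impI)
    fix n N :: nat and \<sigma> :: "nat \<Rightarrow> real" and s :: real
    assume n: "1 \<le> n" and nN: "n < N" and s: "s > 0" and \<sigma>: "\<forall>i\<in>{1..N}. \<sigma> i > 0" "\<forall>i\<in>{1..n+1}. \<sigma> i \<ge> s"
    define m where "m = n + 1"
    have m: "m \<ge> 1" "real m > 0" by (auto simp: m_def)
    let ?g = "gauss {1..m}"
    define B1 where "B1 = {h\<in>space ?g. (\<Sum>i=1..m. (h i)\<^sup>2) \<le> d\<^sup>2 * real m}"
    define B2 where "B2 = {h\<in>space ?g. (\<Sum>i=1..m. \<bar>h i\<bar> powr p) > T * real m}"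
    have B1: "B1 \<in> sets ?g" unfolding B1_def by (rule gauss_sum_squares_set(2)) auto
    have B2: "B2 \<in> sets ?g"
    proof -
      have [measurable]: "(\<lambda>h. h i) \<in> borel_measurable ?g" if "i \<in> {1..m}" for i by (rule gauss_component_measurable[OF that])
      show ?thesis unfolding B2_def by measurable
    qed
    have line: "c * (s * real n powr (1 / 2 - 1 / p)) \<le> section_radius m (p_ellipsoid m p \<sigma>) (line_space m h)"
      if h: "h \<in> space ?g" "h \<notin> B1 \<union> B2" for h
    proof -
      have h1: "(\<Sum>i=1..m. (h i)\<^sup>2) > d\<^sup>2 * real m" and h2: "(\<Sum>i=1..m. \<bar>h i\<bar> powr p) \<le> T * real m"
        using h by (auto simp: B1_def B2_def)
      have nz: "vec_of m h \<noteq> 0"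
      proof
        assume z: "vec_of m h = 0"
        have "h i = 0" if "i \<in> {1..m}" for i
        proof -
          have "vec_of m h i = 0" using z by (simp add: fun_apply_simps)
          thus ?thesis using that by (simp add: vec_of_def)
        qed
        hence "(\<Sum>i=1..m. (h i)\<^sup>2) = 0" by simp
        moreover have "d\<^sup>2 * real m \<ge> 0" by simp
        ultimately show False using h1 by linarith
      qed
      have "d * sqrt (real m) = sqrt (d\<^sup>2 * real m)" using d by (simp add: real_sqrt_mult)
      also have "\<dots> \<le> L2_set h {1..m}" unfolding L2_set_def using h1 by (intro real_sqrt_le_mono) simp
      finally have L: "d * sqrt (real m) \<le> L2_set h {1..m}" .
      define lam where "lam = s * (T * real m) powr (- (1 / p))"
      have lam: "lam \<ge> 0" using s by (simp add: lam_def)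
      have lp: "lam powr p = s powr p / (T * real m)"
      proof -
        have "((T * real m) powr (- (1 / p))) powr p = 1 / (T * real m)"
          unfolding powr_powr using p0 T m by (simp add: powr_minus inverse_eq_divide)
        thus ?thesis by (simp add: lam_def powr_mult)
      qed
      have "(\<Sum>i=1..m. (lam * \<bar>h i\<bar>) powr p) = lam powr p * (\<Sum>i=1..m. \<bar>h i\<bar> powr p)"
        by (simp add: powr_mult sum_distrib_left)
      also have "\<dots> \<le> lam powr p * (T * real m)" by (intro mult_left_mono h2) simp
      also have "\<dots> = s powr p" unfolding lp using T m by simp
      finally have "lam * L2_set h {1..m} \<le> section_radius m (p_ellipsoid m p \<sigma>) (line_space m h)"
        using line_section_radius_ge[OF m(1) p0(1) _ s lam _ nz] \<sigma>(2) by (simp add: m_def)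
      moreover have "c * (s * real n powr (1 / 2 - 1 / p)) \<le> lam * L2_set h {1..m}"
      proof -
        have "c * (s * real n powr (1 / 2 - 1 / p)) \<le> c * (s * (2 * (sqrt (real m) * real m powr (- (1 / p)))))"
          unfolding m_def using rate_le[OF n p0(2)] s c by (intro mult_left_mono) auto
        also have "\<dots> = lam * (d * sqrt (real m))" by (simp add: c_def lam_def powr_mult)
        also have "\<dots> \<le> lam * L2_set h {1..m}" by (intro mult_left_mono L lam)
        finally show ?thesis .
      qed
      ultimately show ?thesis by linarith
    qed
    have "measure (haar_grassmannian N n) {E\<in>space (haar_grassmannian N n).
      section_radius N (p_ellipsoid N p \<sigma>) E < c * (s * real n powr (1 / 2 - 1 / p))} \<le> measure (gauss {1..n+1}) (B1 \<union> B2)"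
      by (rule section_radius_lower_tail_le_line[OF nN p0(1) \<sigma>(1)]) (use B1 B2 line in \<open>auto simp: m_def\<close>)
    also have "\<dots> \<le> measure ?g B1 + measure ?g B2" unfolding m_def[symmetric] by (rule measure_Un_le[OF B1 B2])
    also have "measure ?g B1 \<le> (exp 1 * d) ^ m" unfolding B1_def by (rule gauss_norm_small_ball[OF d])
    also have "(exp 1 * d) ^ m = exp (- (A * p * real m))" by (simp add: d_def flip: exp_add exp_of_nat_mult)
    also have "exp (- (A * p * real m)) \<le> exp (- A * p * real m powr (2 / p))"
    proof -
      have "real m powr (2 / p) \<le> real m powr 1" using m p by (intro powr_mono) auto
      thus ?thesis using A p0 m by (simp add: mult_left_mono)
    qed
    also have "measure ?g B2 \<le> 2 * exp (- A * p * real m powr (2 / p))" unfolding B2_def by (rule T(2)[OF m(1)])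
    finally have "measure (haar_grassmannian N n) {E\<in>space (haar_grassmannian N n).
      section_radius N (p_ellipsoid N p \<sigma>) E < c * (s * real n powr (1 / 2 - 1 / p))} \<le> 3 * exp (- A * p * real m powr (2 / p))" by simp
    also have "\<dots> \<le> 3 * exp (- A * p * real n powr (2 / p))"
    proof -
      have "real n powr (2 / p) \<le> real m powr (2 / p)" using p0 by (intro powr_mono2) (auto simp: m_def)
      thus ?thesis using A p0 by (simp add: mult_left_mono)
    qed
    finally show "measure (haar_grassmannian N n) {E\<in>space (haar_grassmannian N n).
      section_radius N (p_ellipsoid N p \<sigma>) E < c * (s * real n powr (1 / 2 - 1 / p))} \<le> 3 * exp (- A * p * real n powr (2 / p))" .
  qed
qed

section \<open>The semiaxes and the main theorem\<close>


text \<open>For i > n, i + 1 is at most i/n times n + 1: its logarithm exceeds that of n + 1 by at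
  most ln (i/n), which any positive power of i/n dominates up to a constant.\<close>

lemma log_ratio_le:
  fixes i n :: nat
  assumes d: "d > 0" and i: "i \<ge> 1" and n: "n \<ge> 1"
  shows "ln (real i + 1) / ln (real n + 1) \<le> (1 + 1 / (d * ln 2)) * max 1 (real i / real n) powr d"
proof -
  let ?K = "1 + 1 / (d * ln 2)" and ?x = "max 1 (real i / real n)"
  have ln2: "ln (2::real) > 0" by simp
  have K: "?K \<ge> 1" using d ln2 by simp
  have xd: "?x powr d \<ge> 1" using d by (intro ge_one_powr_ge_zero) auto
  have lnn: "ln (real n + 1) \<ge> ln 2" using n by simp
  show ?thesis
  proof (cases "i \<le> n")
    case True
    have "ln (real i + 1) \<le> ln (real n + 1)" using True by simp
    hence "ln (real i + 1) / ln (real n + 1) \<le> 1 * 1" using lnn ln2 by (simp add: divide_le_eq)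
    also have "1 * 1 \<le> ?K * ?x powr d" using K xd by (intro mult_mono) auto
    finally show ?thesis by simp
  next
    case False
    define x where "x = real i / real n"
    have x: "x \<ge> 1" using False n by (simp add: x_def)
    have mx: "?x = x" using x by (simp add: x_def)
    have "real i + 1 \<le> x * (real n + 1)" using x n by (simp add: x_def field_simps)
    hence "ln (real i + 1) \<le> ln (x * (real n + 1))" by simp
    also have "\<dots> = ln x + ln (real n + 1)" using x by (simp add: ln_mult)
    finally have "ln (real i + 1) / ln (real n + 1) \<le> (ln x + ln (real n + 1)) / ln (real n + 1)"
      using lnn ln2 by (intro divide_right_mono) auto
    also have "\<dots> = 1 + ln x / ln (real n + 1)" using lnn ln2 by (simp add: add_divide_distrib)
    also have "ln x / ln (real n + 1) \<le> ln x / ln 2" using lnn ln2 x by (intro divide_left_mono) auto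
    also have "ln x / ln 2 \<le> (x powr d / d) / ln 2" using ln_powr_bound[OF x d] ln2 by (intro divide_right_mono) auto
    also have "1 + (x powr d / d) / ln 2 \<le> x powr d + (x powr d / d) / ln 2" using xd mx by simp
    also have "\<dots> = ?K * x powr d" by (simp add: algebra_simps)
    finally show ?thesis unfolding mx by simp
  qed
qed

lemma semiaxes_pos: "j \<ge> 1 \<Longrightarrow> semiaxes \<alpha> \<beta> j > 0"
  by (simp add: semiaxes_def)

text \<open>The logarithmic factor is traded for an arbitrarily small power of the ratio. As \<beta>
  may have either sign, the ratio and its inverse both occur.\<close>

lemma semiaxes_ratio:
  assumes e: "e > 0"
  shows "\<exists>K\<ge>1. \<forall>i n. i \<ge> 1 \<longrightarrow> n \<ge> 1 \<longrightarrow>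
    semiaxes \<alpha> \<beta> i \<le> K * ((real n / real i) powr \<alpha> * max (real i / real n) (real n / real i) powr e) * semiaxes \<alpha> \<beta> n"
proof -
  \<comment> \<open>So that \<open>d * \<bar>\<beta>\<bar> \<le> e\<close>; the summand 1 covers
    \<beta> = 0.\<close>
  define d where "d = e / (\<bar>\<beta>\<bar> + 1)"
  have d: "d > 0" using e by (simp add: d_def)
  have db: "d * \<bar>\<beta>\<bar> \<le> e" using e by (simp add: d_def field_simps)
  define L where "L = 1 + 1 / (d * ln 2)"
  have L: "L \<ge> 1" using d by (simp add: L_def)
  show ?thesis
  proof (intro exI[of _ "L powr \<bar>\<beta>\<bar>"] conjI allI impI)
    show "1 \<le> L powr \<bar>\<beta>\<bar>" using L by (intro ge_one_powr_ge_zero) auto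
    fix i n :: nat assume i: "i \<ge> 1" and n: "n \<ge> 1"
    define x where "x = max (real i / real n) (real n / real i)"
    have x: "x \<ge> 1" using i n by (cases "i \<le> n") (auto simp: x_def le_max_iff_disj)
    define li ln' where "li = ln (real i + 1)" and "ln' = ln (real n + 1)"
    have pos: "li > 0" "ln' > 0" using i n by (auto simp: li_def ln'_def)
    have r: "li / ln' \<le> L * x powr d" "ln' / li \<le> L * x powr d"
    proof -
      have "max 1 (real i / real n) powr d \<le> x powr d" "max 1 (real n / real i) powr d \<le> x powr d"
        using x d by (auto intro!: powr_mono2 simp: x_def)
      hence "L * max 1 (real i / real n) powr d \<le> L * x powr d" "L * max 1 (real n / real i) powr d \<le> L * x powr d"
        using L by (auto intro!: mult_left_mono)
      thus "li / ln' \<le> L * x powr d" "ln' / li \<le> L * x powr d"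
        using log_ratio_le[OF d i n] log_ratio_le[OF d n i] unfolding li_def ln'_def L_def by linarith+
    qed
    have "(li / ln') powr (- \<beta>) \<le> (L * x powr d) powr \<bar>\<beta>\<bar>"
    proof (cases "\<beta> \<ge> 0")
      case True
      have "(li / ln') powr (- \<beta>) = (ln' / li) powr \<beta>" using pos by (simp add: powr_minus powr_divide field_simps)
      also have "\<dots> \<le> (L * x powr d) powr \<beta>" using r(2) pos True by (intro powr_mono2) auto
      finally show ?thesis using True by simp
    next
      case False
      have "(li / ln') powr (- \<beta>) \<le> (L * x powr d) powr (- \<beta>)" using False r(1) pos by (intro powr_mono2) auto
      thus ?thesis using False by simp
    qed
    also have "\<dots> = L powr \<bar>\<beta>\<bar> * x powr (d * \<bar>\<beta>\<bar>)" by (simp add: powr_mult powr_powr)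
    also have "\<dots> \<le> L powr \<bar>\<beta>\<bar> * x powr e" using x db by (intro mult_left_mono powr_mono) auto
    finally have "li powr (- \<beta>) \<le> L powr \<bar>\<beta>\<bar> * x powr e * ln' powr (- \<beta>)"
      using pos by (simp only: powr_divide) (simp add: divide_le_eq)
    hence "real i powr (- \<alpha>) * li powr (- \<beta>) \<le> real i powr (- \<alpha>) * (L powr \<bar>\<beta>\<bar> * x powr e * ln' powr (- \<beta>))"
      by (intro mult_left_mono) auto
    also have "\<dots> = L powr \<bar>\<beta>\<bar> * ((real n / real i) powr \<alpha> * x powr e) * (real n powr (- \<alpha>) * ln' powr (- \<beta>))"
    proof -
      have "real i powr (- \<alpha>) = (real n / real i) powr \<alpha> * real n powr (- \<alpha>)"
        using i n by (simp add: powr_minus powr_divide field_simps)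
      thus ?thesis by (simp add: mult_ac)
    qed
    finally show "semiaxes \<alpha> \<beta> i \<le> L powr \<bar>\<beta>\<bar> * ((real n / real i) powr \<alpha> * max (real i / real n) (real n / real i) powr e) * semiaxes \<alpha> \<beta> n"
      by (simp add: semiaxes_def li_def ln'_def x_def)
  qed
qed

lemma semiaxes_upper:
  assumes e: "e > 0" "e < \<alpha>" and \<eta>: "0 < \<eta>" "\<eta> \<le> 1"
  shows "\<exists>K\<ge>1. \<forall>i n. i \<ge> 1 \<longrightarrow> n \<ge> 1 \<longrightarrow> real i \<ge> \<eta> * real n \<longrightarrow>
    semiaxes \<alpha> \<beta> i \<le> K * (real n / real i) powr (\<alpha> - e) * semiaxes \<alpha> \<beta> n"
proof -
  obtain K where K: "K \<ge> 1" "\<And>i n. i \<ge> 1 \<Longrightarrow> n \<ge> 1 \<Longrightarrow>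
    semiaxes \<alpha> \<beta> i \<le> K * ((real n / real i) powr \<alpha> * max (real i / real n) (real n / real i) powr e) * semiaxes \<alpha> \<beta> n"
    using semiaxes_ratio[OF e(1), of \<alpha> \<beta>] by blast
  \<comment> \<open>For x = i/n \<ge> \<eta> both x and 1/x are at most x / \<eta>^2, so the maximum
    is replaced by a multiple of x.\<close>
  define M where "M = (1 / \<eta>\<^sup>2) powr e"
  have M: "M \<ge> 1" unfolding M_def using \<eta> e by (intro ge_one_powr_ge_zero) (auto simp: power_le_one)
  show ?thesis
  proof (intro exI[of _ "K * M"] conjI allI impI)
    show "1 \<le> K * M" using mult_mono[OF K(1) M] K(1) by simp
    fix i n :: nat assume i: "i \<ge> 1" and n: "n \<ge> 1" and le: "real i \<ge> \<eta> * real n"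
    define x where "x = real i / real n"
    have x: "x \<ge> \<eta>" "x > 0" using le n i by (auto simp: x_def le_divide_eq)
    have nx: "real n / real i = 1 / x" by (simp add: x_def)
    have "max x (1 / x) \<le> x * (1 / \<eta>\<^sup>2)"
    proof (rule max.boundedI)
      show "x \<le> x * (1 / \<eta>\<^sup>2)" using x \<eta> by (simp add: mult_left_le power_le_one le_divide_eq)
      have "1 * (\<eta> * \<eta>) \<le> x * x" using x \<eta> by (simp add: mult_mono)
      thus "1 / x \<le> x * (1 / \<eta>\<^sup>2)" using x \<eta> by (simp add: field_simps power2_eq_square)
    qed
    hence "max x (1 / x) powr e \<le> (x * (1 / \<eta>\<^sup>2)) powr e" using e x by (intro powr_mono2) (auto simp: le_max_iff_disj)
    also have "\<dots> = x powr e * M" by (simp only: powr_mult M_def)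
    finally have m: "max x (1 / x) powr e \<le> x powr e * M" .
    have "(1 / x) powr \<alpha> * max x (1 / x) powr e \<le> (1 / x) powr \<alpha> * (x powr e * M)"
      by (rule mult_left_mono[OF m]) simp
    also have "\<dots> = M * (1 / x) powr (\<alpha> - e)" using x by (simp add: powr_diff powr_divide field_simps)
    finally have "K * ((1 / x) powr \<alpha> * max x (1 / x) powr e) * semiaxes \<alpha> \<beta> n \<le> K * (M * (1 / x) powr (\<alpha> - e)) * semiaxes \<alpha> \<beta> n"
      using K(1) semiaxes_pos[OF n, of \<alpha> \<beta>] by (intro mult_right_mono mult_left_mono) auto
    thus "semiaxes \<alpha> \<beta> i \<le> K * M * (real n / real i) powr (\<alpha> - e) * semiaxes \<alpha> \<beta> n"
      using K(2)[OF i n] unfolding nx x_def[symmetric] by (simp add: mult_ac)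
  qed
qed

text \<open>The ratio bound with i and n exchanged. The index n + 1 is included because the line
  lives in dimension n + 1; i/n is then at most 2.\<close>

lemma semiaxes_lower:
  assumes \<alpha>: "\<alpha> > 0"
  shows "\<exists>K\<ge>1. \<forall>i n. i \<ge> 1 \<longrightarrow> n \<ge> 1 \<longrightarrow> i \<le> n + 1 \<longrightarrow> semiaxes \<alpha> \<beta> n / K \<le> semiaxes \<alpha> \<beta> i"
proof -
  define e where "e = \<alpha> / 2"
  have e: "e > 0" "e < \<alpha>" using \<alpha> by (auto simp: e_def)
  obtain K where K: "K \<ge> 1" "\<And>i n. i \<ge> 1 \<Longrightarrow> n \<ge> 1 \<Longrightarrow>
    semiaxes \<alpha> \<beta> i \<le> K * ((real n / real i) powr \<alpha> * max (real i / real n) (real n / real i) powr e) * semiaxes \<alpha> \<beta> n"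
    using semiaxes_ratio[OF e(1), of \<alpha> \<beta>] by blast
  define M where "M = 2 powr (\<alpha> + e)"
  have M: "M \<ge> 1" unfolding M_def using e by (intro ge_one_powr_ge_zero) auto
  show ?thesis
  proof (intro exI[of _ "K * M"] conjI allI impI)
    show "1 \<le> K * M" using mult_mono[OF K(1) M] K(1) by simp
    fix i n :: nat assume i: "i \<ge> 1" and n: "n \<ge> 1" and le: "i \<le> n + 1"
    define x where "x = real i / real n"
    have x: "x \<le> 2" "x > 0" using le n i by (auto simp: x_def divide_le_eq)
    have nx: "real n / real i = 1 / x" by (simp add: x_def)
    have "x powr \<alpha> * max (1 / x) x powr e \<le> M"
    proof (cases "x \<ge> 1")
      case True
      hence "1 / x \<le> x" using mult_mono[of 1 x 1 x] by (simp add: divide_le_eq)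
      hence "x powr \<alpha> * max (1 / x) x powr e = x powr (\<alpha> + e)" by (simp add: powr_add max_absorb2)
      also have "\<dots> \<le> M" unfolding M_def using x e by (intro powr_mono2) auto
      finally show ?thesis .
    next
      case False
      hence "x \<le> 1 / x" using mult_mono[of x 1 x 1] x by (simp add: le_divide_eq)
      hence "x powr \<alpha> * max (1 / x) x powr e = x powr (\<alpha> - e)" using x by (simp add: powr_diff powr_divide max_absorb1)
      also have "\<dots> \<le> 1 powr (\<alpha> - e)" using x e False by (intro powr_mono2) auto
      finally show ?thesis using M by simp
    qed
    hence "K * (x powr \<alpha> * max (1 / x) x powr e) * semiaxes \<alpha> \<beta> i \<le> K * M * semiaxes \<alpha> \<beta> i"
      using K(1) semiaxes_pos[OF i, of \<alpha> \<beta>] by (intro mult_right_mono mult_left_mono) auto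
    hence "semiaxes \<alpha> \<beta> n \<le> K * M * semiaxes \<alpha> \<beta> i"
      using K(2)[OF n i] unfolding nx x_def[symmetric] by simp
    thus "semiaxes \<alpha> \<beta> n / (K * M) \<le> semiaxes \<alpha> \<beta> i" using K(1) M by (simp add: divide_le_eq mult.commute)
  qed
qed

text \<open>Comparison with the integral: by the mean value theorem each term after the first is at
  most a difference of consecutive values of x powr (1 - s) / (s - 1), and these telescope.\<close>

lemma sum_powr_tail:
  fixes s :: real and m N :: nat
  assumes s: "s > 1" and m: "m \<ge> 1"
  shows "(\<Sum>i=m..N. real i powr (- s)) \<le> real m powr (1 - s) * (s / (s - 1))"
proof (cases "m \<le> N")
  case True
  have step: "real (Suc k) powr (- s) \<le> (real k powr (1 - s) - real (Suc k) powr (1 - s)) / (s - 1)" if k: "k \<ge> 1" for k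
  proof -
    have "\<exists>z>real k. z < real (Suc k) \<and> real (Suc k) powr (1 - s) - real k powr (1 - s) = (real (Suc k) - real k) * ((1 - s) * z powr (1 - s - 1))"
      by (rule MVT2) (use k in \<open>auto intro!: derivative_eq_intros\<close>)
    then obtain z where z: "z > real k" "z < real (Suc k)"
      "real (Suc k) powr (1 - s) - real k powr (1 - s) = (1 - s) * z powr (- s)" by auto
    have "real (Suc k) powr (- s) \<le> z powr (- s)" using z k s by (intro powr_mono2') auto
    moreover have "(real k powr (1 - s) - real (Suc k) powr (1 - s)) / (s - 1) = z powr (- s)"
    proof -
      have "real k powr (1 - s) - real (Suc k) powr (1 - s) = (s - 1) * z powr (- s)" using z(3) by (simp add: algebra_simps)
      thus ?thesis using s by simp
    qed
    ultimately show ?thesis by simp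
  qed
  have "(\<Sum>i=m..N. real i powr (- s)) \<le> real m powr (- s) + (real m powr (1 - s) - real N powr (1 - s)) / (s - 1)"
    using True
  proof (induction N rule: dec_induct)
    case (step k)
    have "(\<Sum>i=m..Suc k. real i powr (- s)) = (\<Sum>i=m..k. real i powr (- s)) + real (Suc k) powr (- s)"
      using step by simp
    also have "\<dots> \<le> real m powr (- s) + (real m powr (1 - s) - real k powr (1 - s)) / (s - 1) + (real k powr (1 - s) - real (Suc k) powr (1 - s)) / (s - 1)"
      using step.IH \<open>\<And>k. k \<ge> 1 \<Longrightarrow> _\<close>[of k] step.hyps m by (intro add_mono) auto
    finally show ?case by (simp add: diff_divide_distrib)
  qed simp
  also have "\<dots> \<le> real m powr (1 - s) + real m powr (1 - s) / (s - 1)"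
    using s m by (intro add_mono divide_right_mono powr_mono) auto
  also have "\<dots> = real m powr (1 - s) * (s / (s - 1))" using s by (simp add: field_simps)
  finally show ?thesis .
qed (use s in simp)

text \<open>Provides the hypotheses of the upper tail. Beyond \<eta> n the ratios are at most a
  constant times (n/i) powr (\<alpha> - e), and q (\<alpha> - e) > 1 makes their q-th powers sum to
  a multiple of n.\<close>

lemma semiaxes_sum_tail:
  assumes q: "q > 0" and \<alpha>': "q * (\<alpha> - e) > 1" and e: "e > 0" "e < \<alpha>" and \<eta>: "0 < \<eta>" "\<eta> \<le> 1"
  shows "\<exists>b>0. \<forall>n k N. n \<ge> 1 \<longrightarrow> real k + 1 \<ge> \<eta> * real n \<longrightarrow>
    (\<forall>i\<in>{k+1..N}. semiaxes \<alpha> \<beta> i \<le> b * semiaxes \<alpha> \<beta> n) \<and>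
    (\<Sum>i\<in>{k+1..N}. (semiaxes \<alpha> \<beta> i / semiaxes \<alpha> \<beta> n) powr q) \<le> b * real n"
proof -
  obtain K where K: "K \<ge> 1" "\<And>i n. i \<ge> 1 \<Longrightarrow> n \<ge> 1 \<Longrightarrow> real i \<ge> \<eta> * real n \<Longrightarrow>
    semiaxes \<alpha> \<beta> i \<le> K * (real n / real i) powr (\<alpha> - e) * semiaxes \<alpha> \<beta> n"
    using semiaxes_upper[OF e \<eta>, of \<beta>] by blast
  define s where "s = q * (\<alpha> - e)"
  have s: "s > 1" using \<alpha>' by (simp add: s_def)
  define b1 where "b1 = K * (1 / \<eta>) powr (\<alpha> - e)"
  define b2 where "b2 = K powr q * (\<eta> powr (1 - s) * (s / (s - 1)))"
  have b1: "b1 > 0" using K(1) \<eta> by (simp add: b1_def)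
  show ?thesis
  proof (intro exI[of _ "max b1 b2"] conjI allI impI ballI)
    show "0 < max b1 b2" using b1 by simp
    fix n k N :: nat assume n: "n \<ge> 1" and k: "real k + 1 \<ge> \<eta> * real n"
    note sn = semiaxes_pos[OF n, of \<alpha> \<beta>]
    have up: "semiaxes \<alpha> \<beta> i \<le> K * (real n / real i) powr (\<alpha> - e) * semiaxes \<alpha> \<beta> n" and ige: "real i \<ge> \<eta> * real n" "i \<ge> 1"
      if i: "i \<in> {k+1..N}" for i
    proof -
      have "real i \<ge> real k + 1" using i by auto
      thus "real i \<ge> \<eta> * real n" using k by linarith
      show "i \<ge> 1" using i by simp
      thus "semiaxes \<alpha> \<beta> i \<le> K * (real n / real i) powr (\<alpha> - e) * semiaxes \<alpha> \<beta> n" using K(2)[OF _ n] \<open>real i \<ge> \<eta> * real n\<close> by blast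
    qed
    show "semiaxes \<alpha> \<beta> i \<le> max b1 b2 * semiaxes \<alpha> \<beta> n" if i: "i \<in> {k+1..N}" for i
    proof -
      have "real n / real i \<le> 1 / \<eta>" using ige[OF i] \<eta> by (simp add: field_simps)
      hence "(real n / real i) powr (\<alpha> - e) \<le> (1 / \<eta>) powr (\<alpha> - e)" using e by (intro powr_mono2) auto
      hence "K * (real n / real i) powr (\<alpha> - e) \<le> max b1 b2" using K(1) by (simp add: b1_def le_max_iff_disj)
      hence "K * (real n / real i) powr (\<alpha> - e) * semiaxes \<alpha> \<beta> n \<le> max b1 b2 * semiaxes \<alpha> \<beta> n"
        using sn by (intro mult_right_mono) auto
      thus ?thesis using up[OF i] by linarith
    qed
    have "(\<Sum>i\<in>{k+1..N}. (semiaxes \<alpha> \<beta> i / semiaxes \<alpha> \<beta> n) powr q) \<le> (\<Sum>i\<in>{k+1..N}. K powr q * real n powr s * real i powr (- s))"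
    proof (rule sum_mono)
      fix i assume i: "i \<in> {k+1..N}"
      have "semiaxes \<alpha> \<beta> i / semiaxes \<alpha> \<beta> n \<le> K * (real n / real i) powr (\<alpha> - e)" using up[OF i] sn by (simp add: divide_le_eq)
      hence "(semiaxes \<alpha> \<beta> i / semiaxes \<alpha> \<beta> n) powr q \<le> (K * (real n / real i) powr (\<alpha> - e)) powr q"
        using q sn semiaxes_pos[OF ige(2)[OF i], of \<alpha> \<beta>] by (intro powr_mono2) auto
      also have "\<dots> = K powr q * (real n / real i) powr s" by (simp add: powr_mult powr_powr s_def mult.commute)
      also have "(real n / real i) powr s = real n powr s * real i powr (- s)" by (simp add: powr_divide powr_minus_divide)
      also have "K powr q * (real n powr s * real i powr (- s)) = K powr q * real n powr s * real i powr (- s)" by simp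
      finally show "(semiaxes \<alpha> \<beta> i / semiaxes \<alpha> \<beta> n) powr q \<le> K powr q * real n powr s * real i powr (- s)" .
    qed
    also have "\<dots> = K powr q * real n powr s * (\<Sum>i=k+1..N. real i powr (- s))" by (simp add: sum_distrib_left)
    also have "\<dots> \<le> K powr q * real n powr s * ((\<eta> * real n) powr (1 - s) * (s / (s - 1)))"
    proof (rule mult_left_mono)
      have "(\<Sum>i=k+1..N. real i powr (- s)) \<le> real (k + 1) powr (1 - s) * (s / (s - 1))" by (rule sum_powr_tail[OF s]) simp
      also have "\<dots> \<le> (\<eta> * real n) powr (1 - s) * (s / (s - 1))"
        using k \<eta> n s by (intro mult_right_mono powr_mono2') (auto simp: add.commute)
      finally show "(\<Sum>i=k+1..N. real i powr (- s)) \<le> (\<eta> * real n) powr (1 - s) * (s / (s - 1))" .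
    qed simp
    also have "\<dots> = b2 * (real n powr s * real n powr (1 - s))" by (simp add: b2_def powr_mult)
    also have "real n powr s * real n powr (1 - s) = real n" using n by (simp flip: powr_add)
    also have "b2 * real n \<le> max b1 b2 * real n" by (intro mult_right_mono) auto
    finally show "(\<Sum>i\<in>{k+1..N}. (semiaxes \<alpha> \<beta> i / semiaxes \<alpha> \<beta> n) powr q) \<le> max b1 b2 * real n" .
  qed
qed

section \<open>Assembling the two tails\<close>

text \<open>Young's inequality for \<open>\<bar>y i\<bar> = \<sigma> i * (\<bar>y i\<bar> / \<sigma>
  i)\<close>. For q-summable semiaxes the bound is uniform in N.\<close>

lemma section_radius_le_sum:
  assumes p: "p > 1" and \<sigma>: "\<forall>i\<in>{1..N}. \<sigma> i > 0" and E: "0 \<in> E"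
  shows "section_radius N (p_ellipsoid N p \<sigma>) E \<le> 1 + (\<Sum>i=1..N. \<sigma> i powr (p / (p - 1)))"
proof (rule section_radius_le[OF E])
  fix y assume y: "y \<in> p_ellipsoid N p \<sigma>"
  have "L2_set y {1..N} \<le> (\<Sum>i=1..N. \<bar>y i\<bar>)" by (rule L2_set_le_sum_abs)
  also have "\<dots> \<le> (\<Sum>i=1..N. (\<bar>y i\<bar> / \<sigma> i) powr p + \<sigma> i powr (p / (p - 1)))"
  proof (rule sum_mono)
    fix i assume i: "i \<in> {1..N}"
    have s: "\<sigma> i > 0" using \<sigma> i by simp
    have "\<sigma> i * (\<bar>y i\<bar> / \<sigma> i) \<le> (\<bar>y i\<bar> / \<sigma> i) powr p + \<sigma> i powr (p / (p - 1))"
      by (rule young_simple[OF p]) (use s in auto)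
    thus "\<bar>y i\<bar> \<le> (\<bar>y i\<bar> / \<sigma> i) powr p + \<sigma> i powr (p / (p - 1))" using s by simp
  qed
  also have "\<dots> \<le> 1 + (\<Sum>i=1..N. \<sigma> i powr (p / (p - 1)))"
    using y by (simp add: sum.distrib p_ellipsoid_def)
  finally show "L2_set y {1..N} \<le> 1 + (\<Sum>i=1..N. \<sigma> i powr (p / (p - 1)))" .
qed

lemma haar_prob_space:
  assumes "n \<le> N"
  shows "prob_space (haar_grassmannian N n)" "sets (haar_grassmannian N n) = sets (grassmannian_borel N n)"
    "space (haar_grassmannian N n) = grassmannian N n"
  unfolding haar_kernel[OF assms]
  by (simp_all add: prob_space.prob_space_distr[OF prob_space_gauss kernel_space_measurable[OF assms]])

lemma approx_event_ge:
  assumes M: "prob_space M" and f: "f \<in> borel_measurable M" and r: "r \<ge> 0" and C: "C \<ge> Cu" "C \<ge> 1" "cl > 0" "C \<ge> 1 / cl"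
    and up: "measure M {E\<in>space M. f E > Cu * r} \<le> u" and lo: "measure M {E\<in>space M. f E < cl * r} \<le> v"
  shows "measure M {E\<in>space M. approx_const C (f E) r} \<ge> 1 - (u + v)"
proof -
  interpret M: prob_space M by fact
  note [measurable] = f
  let ?U = "{E\<in>space M. f E > Cu * r}" and ?L = "{E\<in>space M. f E < cl * r}"
  have "space M - {E\<in>space M. approx_const C (f E) r} \<subseteq> ?U \<union> ?L"
  proof
    fix E assume E: "E \<in> space M - {E\<in>space M. approx_const C (f E) r}"
    have "Cu * r \<le> C * r" using C r by (intro mult_right_mono) auto
    moreover have "inverse C * r \<le> cl * r"
      using C r by (intro mult_right_mono) (auto simp: field_simps)
    ultimately show "E \<in> ?U \<union> ?L" using E by (auto simp: approx_const_def)
  qed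
  hence "measure M (space M - {E\<in>space M. approx_const C (f E) r}) \<le> measure M (?U \<union> ?L)"
    by (rule M.finite_measure_mono) measurable
  also have "\<dots> \<le> measure M ?U + measure M ?L" by (rule measure_Un_le) measurable
  also have "\<dots> \<le> u + v" using up lo by simp
  finally have "measure M (space M - {E\<in>space M. approx_const C (f E) r}) \<le> u + v" .
  moreover have "{E\<in>space M. approx_const C (f E) r} \<in> sets M" unfolding approx_const_def by measurable
  ultimately show ?thesis using M.prob_compl[of "{E\<in>space M. approx_const C (f E) r}"] by simp
qed

lemma three_le_exp: "3 / 2 \<le> exp (3 / 4 :: real)" "x \<ge> 2 \<Longrightarrow> 3 \<le> exp (3 / 4 * x :: real)"
proof -
  show 1: "3 / 2 \<le> exp (3 / 4 :: real)" using exp_ge_add_one_self[of "3 / 4 :: real"] by linarith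
  have "(3 / 2) ^ 3 \<le> exp (1 / 2 :: real) ^ 3" using exp_ge_add_one_self[of "1 / 2 :: real"] by (intro power_mono) auto
  also have "exp (1 / 2 :: real) ^ 3 = exp (3 / 2)" by (simp flip: exp_of_nat_mult)
  finally have "3 \<le> exp (3 / 2 :: real)" by (simp add: power3_eq_cube)
  also assume "x \<ge> 2"
  hence "exp (3 / 2) \<le> exp (3 / 4 * x)" by simp
  finally show "3 \<le> exp (3 / 4 * x)" .
qed

text \<open>Beyond p powr (p / (p - 2)) the probability exp (- n) of the upper tail is at most the
  one allowed for p > 2; the n below are treated separately.\<close>

lemma eventually_power_le:
  assumes p: "p > 2" shows "\<exists>n0. \<forall>n\<ge>n0. p * real n powr (2 / p) \<le> real n"
proof -
  define d where "d = 1 - 2 / p"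
  have d: "d > 0" using p by (simp add: d_def)
  obtain n0 :: nat where n0: "real n0 \<ge> p powr (1 / d)" using real_arch_simple by blast
  show ?thesis
  proof (intro exI allI impI)
    fix n assume n: "n \<ge> n0"
    have pos: "p powr (1 / d) > 0" using p by simp
    have n1: "real n \<ge> p powr (1 / d)" using n n0 by linarith
    hence nn: "real n > 0" using pos by linarith
    have "p = (p powr (1 / d)) powr d" using d p by (simp add: powr_powr)
    also have "\<dots> \<le> real n powr d" using n1 d by (intro powr_mono2) auto
    finally have "p * real n powr (2 / p) \<le> real n powr d * real n powr (2 / p)" by (rule mult_right_mono) simp
    also have "\<dots> = real n" using nn by (simp add: d_def flip: powr_add)
    finally show "p * real n powr (2 / p) \<le> real n" .
  qed
qed

theorem proposition6p3:
  shows "\<exists>\<gamma>>0::real. \<forall>p \<alpha> \<beta> :: real. p > 1 \<longrightarrow> \<alpha> > 1 - 1 / p \<longrightarrow>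
    (\<exists>C\<ge>1::real. \<forall>n N :: nat. 1 \<le> n \<longrightarrow> n < N \<longrightarrow>
      measure (haar_grassmannian N n)
        {E \<in> space (haar_grassmannian N n).
          approx_const C (section_radius N (p_ellipsoid N p (semiaxes \<alpha> \<beta>)) E)
            (real n powr (1 / 2 - 1 / p - \<alpha>) * ln (real n + 1) powr (- \<beta>))}
      \<ge> (if p \<le> 2 then 1 - 2 * exp (- \<gamma> * real n)
          else 1 - 2 * exp (- \<gamma> * p * real n powr (2 / p))))"
proof (rule exI[of _ "1 / 4"], intro conjI allI impI)
  \<comment> \<open>The tails add up to 3 exp (- x) or 6 exp (- x), where x is n or p * n powr
    (2/p); giving up 3/4 of the exponent reduces the prefactor to 2.\<close>
  show "(0::real) < 1 / 4" by simp
  fix p \<alpha> \<beta> :: real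
  assume p: "p > 1" and \<alpha>: "\<alpha> > 1 - 1 / p"
  define q where "q = p / (p - 1)"
  \<comment> \<open>Half of the slack in the hypothesis on \<alpha>; the other half keeps q
    (\<alpha> - e) > 1.\<close>
  define e where "e = (\<alpha> - (1 - 1 / p)) / 2"
  have q: "q > 0" using p by (simp add: q_def)
  have p1: "1 - 1 / p > 0" using p by simp
  have e: "e > 0" "e < \<alpha>" "\<alpha> - e > 1 - 1 / p" using \<alpha> p1 unfolding e_def by argo+
  have q\<alpha>: "q * (\<alpha> - e) > 1"
  proof -
    have "q * (1 - 1 / p) = 1" using p by (simp add: q_def field_simps)
    thus ?thesis using mult_strict_left_mono[OF e(3) q] by simp
  qed
  let ?\<sigma> = "semiaxes \<alpha> \<beta>"
  let ?R = "\<lambda>N. section_radius N (p_ellipsoid N p ?\<sigma>)"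
  define r where "r n = real n powr (1 / 2 - 1 / p - \<alpha>) * ln (real n + 1) powr (- \<beta>)" for n :: nat
  have r_eq: "r n = ?\<sigma> n * real n powr (1 / 2 - 1 / p)" if "n \<ge> 1" for n
    using that unfolding r_def semiaxes_def by (simp add: powr_add[symmetric])
  have r_pos: "r n > 0" if "n \<ge> 1" for n using that by (simp add: r_def)
  have "sparsity \<le> 1" using sparsity_bounds by simp
  from semiaxes_sum_tail[OF q q\<alpha> e(1,2) sparsity_bounds(1) this, of \<beta>]
  obtain b where b: "b > 0" "\<forall>n k N. n \<ge> 1 \<longrightarrow> real k + 1 \<ge> sparsity * real n \<longrightarrow>
    (\<forall>i\<in>{k+1..N}. ?\<sigma> i \<le> b * ?\<sigma> n) \<and> (\<Sum>i\<in>{k+1..N}. (?\<sigma> i / ?\<sigma> n) powr q) \<le> b * real n" by (elim exE conjE)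
  from section_radius_upper_tail[OF p b(1)]
  obtain Cu where Cu: "Cu > 0" "\<forall>n N k \<sigma> s. 1 \<le> n \<longrightarrow> n < N \<longrightarrow> real k \<le> sparsity * real n \<longrightarrow> s > 0 \<longrightarrow>
    (\<forall>i\<in>{1..N}. \<sigma> i > 0) \<longrightarrow> (\<forall>i\<in>{k+1..N}. \<sigma> i \<le> b * s) \<longrightarrow>
    (\<Sum>i\<in>{k+1..N}. (\<sigma> i / s) powr (p / (p - 1))) \<le> b * real n \<longrightarrow>
    measure (haar_grassmannian N n) {E\<in>space (haar_grassmannian N n).
      section_radius N (p_ellipsoid N p \<sigma>) E > Cu * (s * real n powr (1 / 2 - 1 / p))} \<le> 3 * exp (- real n)"
    by (elim exE conjE)
  have upper: "measure (haar_grassmannian N n) {E\<in>space (haar_grassmannian N n). ?R N E > Cu * r n} \<le> 3 * exp (- real n)"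
    if n: "n \<ge> 1" "n < N" for n N
  proof -
    \<comment> \<open>The largest k that the upper tail admits; rounding down still leaves k + 1
      \<ge> sparsity * n, as the tail sums require.\<close>
    define k where "k = nat \<lfloor>sparsity * real n\<rfloor>"
    have nn: "0 \<le> sparsity * real n" using sparsity_bounds by simp
    have k: "real k \<le> sparsity * real n" "real k + 1 \<ge> sparsity * real n" using nn unfolding k_def by linarith+
    have "(\<forall>i\<in>{k+1..N}. ?\<sigma> i \<le> b * ?\<sigma> n)" "(\<Sum>i\<in>{k+1..N}. (?\<sigma> i / ?\<sigma> n) powr (p / (p - 1))) \<le> b * real n"
      using b(2)[rule_format, OF n(1) k(2), of N] unfolding q_def by blast+
    thus ?thesis unfolding r_eq[OF n(1)]
      by (intro Cu(2)[rule_format, OF n k(1) semiaxes_pos[OF n(1)]]) (auto intro: semiaxes_pos)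
  qed
  have \<sigma>pos: "\<forall>i\<in>{1..N}. ?\<sigma> i > 0" for N by (simp add: semiaxes_pos)
  have "\<alpha> > 0" using \<alpha> p1 by simp
  then obtain K where K: "K \<ge> 1" "\<And>i n. i \<ge> 1 \<Longrightarrow> n \<ge> 1 \<Longrightarrow> i \<le> n + 1 \<Longrightarrow> ?\<sigma> n / K \<le> ?\<sigma> i"
    using semiaxes_lower[of \<alpha> \<beta>] by blast
  have meas: "?R N \<in> borel_measurable (haar_grassmannian N n)" if "n < N" for n N
  proof -
    have "?R N \<in> borel_measurable (grassmannian_borel N n)"
      by (rule section_radius_measurable[OF _ \<sigma>pos]) (use p in simp)
    thus ?thesis by (subst measurable_cong_sets[OF haar_prob_space(2) refl]) (use that in simp_all)
  qed
  show "\<exists>C\<ge>1::real. \<forall>n N :: nat. 1 \<le> n \<longrightarrow> n < N \<longrightarrow>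
      measure (haar_grassmannian N n)
        {E \<in> space (haar_grassmannian N n).
          approx_const C (section_radius N (p_ellipsoid N p (semiaxes \<alpha> \<beta>)) E)
            (real n powr (1 / 2 - 1 / p - \<alpha>) * ln (real n + 1) powr (- \<beta>))}
      \<ge> (if p \<le> 2 then 1 - 2 * exp (- (1 / 4) * real n)
          else 1 - 2 * exp (- (1 / 4) * p * real n powr (2 / p)))"
  proof (cases "p \<le> 2")
    case True
    define C where "C = max (max 1 Cu) (4 * K)"
    have lower: "measure (haar_grassmannian N n) {E\<in>space (haar_grassmannian N n). ?R N E < (1 / (4 * K)) * r n} \<le> 0"
      if n: "n \<ge> 1" "n < N" for n N
    proof -
      have e: "(1 / (4 * K)) * r n = (1 / 4) * (?\<sigma> n / K * real n powr (1 / 2 - 1 / p))" by (simp add: r_eq[OF n(1)])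
      have "measure (haar_grassmannian N n) {E\<in>space (haar_grassmannian N n). ?R N E < (1 / 4) * (?\<sigma> n / K * real n powr (1 / 2 - 1 / p))} = 0"
        by (rule section_radius_lower_small_p[OF p True n _ \<sigma>pos]) (use K n semiaxes_pos in auto)
      thus ?thesis unfolding e by simp
    qed
    have "measure (haar_grassmannian N n) {E \<in> space (haar_grassmannian N n). approx_const C (?R N E) (r n)} \<ge> 1 - 2 * exp (- (1 / 4) * real n)"
      if n: "n \<ge> 1" "n < N" for n N
    proof -
      have "1 - (3 * exp (- real n) + 0) \<le> measure (haar_grassmannian N n) {E \<in> space (haar_grassmannian N n). approx_const C (?R N E) (r n)}"
        by (rule approx_event_ge[OF haar_prob_space(1) meas[OF n(2)] _ _ _ _ _ upper[OF n] lower[OF n]])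
           (use n K r_pos in \<open>auto simp: C_def less_imp_le\<close>)
      moreover have "3 * exp (- real n) \<le> 2 * exp (- (1 / 4) * real n)"
      proof -
        have "exp (3 / 4 :: real) \<le> exp (3 / 4 * real n)" using n by simp
        hence "3 / 2 \<le> exp (3 / 4 * real n)" using three_le_exp(1) by linarith
        hence "3 / 2 * exp (- real n) \<le> exp (3 / 4 * real n) * exp (- real n)" by (intro mult_right_mono) auto
        also have "\<dots> = exp (- (1 / 4) * real n)" by (simp flip: exp_add)
        finally show ?thesis by simp
      qed
      ultimately show ?thesis by linarith
    qed
    thus ?thesis using True by (intro exI[of _ C]) (auto simp: C_def r_def)
  next
    case False
    hence p2: "p > 2" by simp
    have "(0::real) \<le> 1" by simp
    from section_radius_lower_large_p[OF p2 this]
    obtain c where c: "c > 0" "\<forall>n N \<sigma> s. 1 \<le> n \<longrightarrow> n < N \<longrightarrow> s > 0 \<longrightarrow> (\<forall>i\<in>{1..N}. \<sigma> i > 0) \<longrightarrow> (\<forall>i\<in>{1..n+1}. \<sigma> i \<ge> s) \<longrightarrow>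
      measure (haar_grassmannian N n) {E\<in>space (haar_grassmannian N n).
        section_radius N (p_ellipsoid N p \<sigma>) E < c * (s * real n powr (1 / 2 - 1 / p))} \<le> 3 * exp (- 1 * p * real n powr (2 / p))"
      by (elim exE conjE)
    have lower: "measure (haar_grassmannian N n) {E\<in>space (haar_grassmannian N n). ?R N E < (c / K) * r n} \<le> 3 * exp (- (p * real n powr (2 / p)))"
      if n: "n \<ge> 1" "n < N" for n N
    proof -
      have e: "(c / K) * r n = c * (?\<sigma> n / K * real n powr (1 / 2 - 1 / p))" by (simp add: r_eq[OF n(1)])
      have "measure (haar_grassmannian N n) {E\<in>space (haar_grassmannian N n). ?R N E < c * (?\<sigma> n / K * real n powr (1 / 2 - 1 / p))}
        \<le> 3 * exp (- 1 * p * real n powr (2 / p))"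
        by (rule c(2)[rule_format, OF n]) (use K n semiaxes_pos in auto)
      thus ?thesis unfolding e by simp
    qed
    obtain n0 where n0: "\<And>n. n \<ge> n0 \<Longrightarrow> p * real n powr (2 / p) \<le> real n" using eventually_power_le[OF p2] by blast
    \<comment> \<open>From the summability bound with n = 1 and k = 0: no section, in any dimension
      N, has radius above B.\<close>
    define B where "B = 1 + ?\<sigma> 1 powr q * b"
    have B: "?R N E \<le> B" if E: "E \<in> grassmannian N n" for N E n
    proof -
      have "(\<Sum>i=1..N. (?\<sigma> i / ?\<sigma> 1) powr q) \<le> b" using b(2)[rule_format, of 1 0 N] sparsity_bounds by simp
      hence "?\<sigma> 1 powr q * (\<Sum>i=1..N. (?\<sigma> i / ?\<sigma> 1) powr q) \<le> ?\<sigma> 1 powr q * b" by (intro mult_left_mono) auto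
      moreover have "?\<sigma> 1 powr q * (\<Sum>i=1..N. (?\<sigma> i / ?\<sigma> 1) powr q) = (\<Sum>i=1..N. ?\<sigma> i powr q)"
        using semiaxes_pos[of 1 \<alpha> \<beta>] by (simp add: sum_distrib_left powr_divide)
      moreover have "?R N E \<le> 1 + (\<Sum>i=1..N. ?\<sigma> i powr q)"
        unfolding q_def by (rule section_radius_le_sum[OF p \<sigma>pos subspace_0[OF grassmannianD(1)[OF E]]])
      ultimately show ?thesis by (simp add: B_def)
    qed
    \<comment> \<open>The sum dominates each B / r n with n \<le> n0, so for these n the radius
      never exceeds C0 * r n and the exceptional event is empty.\<close>
    define C0 where "C0 = (\<Sum>n=1..n0. B / r n)"
    have Bpos: "B > 0" using b(1) by (simp add: B_def add_pos_nonneg)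
    define C where "C = max (max 1 (max Cu C0)) (K / c)"
    have upper2: "measure (haar_grassmannian N n) {E\<in>space (haar_grassmannian N n). ?R N E > max Cu C0 * r n} \<le> 3 * exp (- (p * real n powr (2 / p)))"
      if n: "n \<ge> 1" "n < N" for n N
    proof (cases "n \<ge> n0")
      case True
      interpret H: prob_space "haar_grassmannian N n" by (rule haar_prob_space(1)) (use n in simp)
      note [measurable] = meas[OF n(2)]
      have "Cu * r n \<le> max Cu C0 * r n" using r_pos[OF n(1)] by (intro mult_right_mono) auto
      hence "measure (haar_grassmannian N n) {E\<in>space (haar_grassmannian N n). ?R N E > max Cu C0 * r n}
        \<le> measure (haar_grassmannian N n) {E\<in>space (haar_grassmannian N n). ?R N E > Cu * r n}"
        by (intro H.finite_measure_mono) auto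
      also have "\<dots> \<le> 3 * exp (- real n)" by (rule upper[OF n])
      also have "\<dots> \<le> 3 * exp (- (p * real n powr (2 / p)))" using n0[OF True] by simp
      finally show ?thesis .
    next
      case False
      have "B / r n \<le> C0" unfolding C0_def
        by (rule member_le_sum) (use False n r_pos Bpos in \<open>auto simp: less_imp_le\<close>)
      hence "B \<le> C0 * r n" using r_pos[OF n(1)] by (simp add: divide_le_eq)
      also have "\<dots> \<le> max Cu C0 * r n" using r_pos[OF n(1)] by (intro mult_right_mono) auto
      finally have empty: "{E\<in>space (haar_grassmannian N n). ?R N E > max Cu C0 * r n} = {}"
        using B haar_prob_space(3)[of n N] n by fastforce
      show ?thesis unfolding empty by simp
    qed
    have "measure (haar_grassmannian N n) {E \<in> space (haar_grassmannian N n). approx_const C (?R N E) (r n)} \<ge> 1 - 2 * exp (- (1 / 4) * p * real n powr (2 / p))"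
      if n: "n \<ge> 1" "n < N" for n N
    proof -
      define X where "X = p * real n powr (2 / p)"
      have "1 - (3 * exp (- X) + 3 * exp (- X)) \<le> measure (haar_grassmannian N n) {E \<in> space (haar_grassmannian N n). approx_const C (?R N E) (r n)}"
        unfolding X_def
        by (rule approx_event_ge[OF haar_prob_space(1) meas[OF n(2)] _ _ _ _ _ upper2[OF n] lower[OF n]])
           (use n K c r_pos in \<open>auto simp: C_def less_imp_le\<close>)
      moreover have "3 * exp (- X) \<le> exp (- (1 / 4) * X)"
      proof -
        have "1 \<le> real n powr (2 / p)" using n p2 by (intro ge_one_powr_ge_zero) auto
        hence "2 * 1 \<le> X" unfolding X_def using p2 by (intro mult_mono) auto
        hence "3 \<le> exp (3 / 4 * X)" by (intro three_le_exp(2)) simp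
        hence "3 * exp (- X) \<le> exp (3 / 4 * X) * exp (- X)" by (intro mult_right_mono) auto
        also have "\<dots> = exp (- (1 / 4) * X)" by (simp flip: exp_add)
        finally show ?thesis .
      qed
      ultimately show ?thesis by (simp add: X_def mult.assoc)
    qed
    thus ?thesis using False by (intro exI[of _ C]) (auto simp: C_def r_def)
  qed
qed

end
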